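(* Let $n\ge2$ and let $X$ be an $n$-dimensional toric Kato manifold with toric divisor $D_T$ and matrix $A\in\mathrm{GL}(n,\mathbb Z)$. Let $\Gamma=\langle\gamma\rangle\cong\mathbb Z$ be the deck group of the universal cover of $X$ and let $L_{\det A}$ be the flat line bundle on $X$ determined by $\rho:\Gamma\to\mathbb C^*$, $\rho(\gamma)=\det A\in\{1,-1\}$. Then $$K_X\otimes L_{\det A}=\mathcal O_X(-D_T).$$ In particular, $X$ has negative Kodaira dimension.
   Context: Notation: $N=\mathbb Z^n$, $T_N=(\mathbb C^* )^n$, $\mathbb B\subset\mathbb C^n$ is the open unit ball; $\mathbb C^n$ carries the standard $T_N$-action. A Kato data is a pair $(\pi,\sigma)$ with $\pi:\hat{\mathbb B}\to\mathbb B$ a proper modification of complex manifolds at $0$ and $\sigma:\overline{\mathbb B}\to\hat{\mathbb B}$ a holomorphic embedding (defined near the closed ball). The Kato manifold $X=X(\pi,\sigma)$ is the compact complex manifold obtained by gluing small neighbourhoods of the two boundary components of $\hat{\mathbb B}\setminus\sigma(\mathbb B)$ via $\sigma\circ\pi$. The data is toric if $\pi$ extends to a $T_N$-equivariant proper modification $\pi:\hat{\mathbb C}^n\to\mathbb C^n$ at $0$ with $\hat{\mathbb C}^n$ a smooth toric variety, and there is $\nu\in\mathrm{Aut}_{gr}(T_N)$ with $\sigma(\underline\mu z)=\nu(\underline\mu)\sigma(z)$ whenever defined; then $X$ is a toric Kato manifold. Let $\hat\Sigma$ be the fan of $\hat{\mathbb C}^n$ and $\tau_A\in\hat\Sigma$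 the $n$-dimensional cone of the fixed point $\sigma(0)$. There are $\underline\lambda\in T_N$ and $A=(a_{jk})\in\mathrm{GL}(n,\mathbb Z)$, whose columns are the primitive generators of $\tau_A$ in some order, such that the germ $F:=\pi\circ\sigma$ is $F(z)=\underline\lambda z^A$, with $j$-th component $\lambda_j\prod_kz_k^{a_{jk}}$. $A$ is the matrix of $X$. Universal cover and toric divisor: put $\Sigma_A=\{A^m\tau\mid\tau\in\hat\Sigma\setminus\{\tau_A\},\,m\in\mathbb Z\}$, $W_T(F)=\{z\in T_N\mid\lim_m\|F^m(z)\|=0\}$, and let $\widetilde X$ be the interior of the closure of $W_T(F)$ in the toric variety $X(\Sigma_A,N)$. Then $\widetilde X$ is the universal cover of $X$, with deck group $\Gamma\cong\mathbb Z$ generated by $\gamma$ = the extension of $F$; let $q:\widetilde X\to X$ be the covering map. Let $\widetilde D_T^X=\sum_{\nu\in\Sigma_A^{(1)}}\overline{\mathrm{orb}\,\nu}\cap\widetilde X$ (so its support is $\widetilde X\setminus W_T(F)$). The toric divisor $D_T$ is the divisor $\widetilde D_T^X/\Gamma$ on $X$, characterized by $q^*D_T=\widetilde D_T^X$. *)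

theory Defs
  imports "HOL-Analysis.Analysis"
begin

section \<open>Holomorphic maps and complex manifolds\<close>

definition holo_map_on :: "(complex^'n \<Rightarrow> complex^'m) \<Rightarrow> (complex^'n) set \<Rightarrow> bool" where
  "holo_map_on f S \<longleftrightarrow>
     (\<forall>z\<in>S. \<exists>L. (f has_derivative L) (at z) \<and> (\<forall>c v. L (c *s v) = c *s L v))"

definition holo_fun_on :: "(complex^'n \<Rightarrow> complex) \<Rightarrow> (complex^'n) set \<Rightarrow> bool" where
  "holo_fun_on f S \<longleftrightarrow>
     (\<forall>z\<in>S. \<exists>L. (f has_derivative L) (at z) \<and> (\<forall>c v. L (c *s v) = c * L v))"

record ('a, 'n) cmanifold =
  mtop :: "'a topology"
  charts :: "('a set \<times> ('a \<Rightarrow> (complex, 'n::finite) vec)) set"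

abbreviation carrier :: "('a, 'n::finite) cmanifold \<Rightarrow> 'a set" where
  "carrier M \<equiv> topspace (mtop M)"

definition complex_manifold :: "('a, 'n::finite) cmanifold \<Rightarrow> bool" where
  "complex_manifold M \<longleftrightarrow>
     Hausdorff_space (mtop M) \<and> second_countable (mtop M) \<and>
     carrier M = (\<Union>(U,\<phi>)\<in>charts M. U) \<and>
     (\<forall>(U,\<phi>)\<in>charts M. openin (mtop M) U \<and> open (\<phi> ` U) \<and>
        homeomorphic_map (subtopology (mtop M) U) (top_of_set (\<phi> ` U)) \<phi>) \<and>
     (\<forall>(U,\<phi>)\<in>charts M. \<forall>(V,\<psi>)\<in>charts M.
        holo_map_on (\<psi> \<circ> inv_into U \<phi>) (\<phi> ` (U \<inter> V)))"

definition Cn :: "(complex^'n, 'n::finite) cmanifold" where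
  "Cn = \<lparr>mtop = euclidean, charts = {(UNIV, id)}\<rparr>"

definition open_sub :: "('a, 'n::finite) cmanifold \<Rightarrow> 'a set \<Rightarrow> ('a, 'n) cmanifold" where
  "open_sub M U = \<lparr>mtop = subtopology (mtop M) U, charts = (\<lambda>(V,\<phi>). (V \<inter> U, \<phi>)) ` charts M\<rparr>"

definition holo_fun :: "('a, 'n::finite) cmanifold \<Rightarrow> 'a set \<Rightarrow> ('a \<Rightarrow> complex) \<Rightarrow> bool" where
  "holo_fun M U f \<longleftrightarrow> openin (mtop M) U \<and>
     (\<forall>(V,\<phi>)\<in>charts M. holo_fun_on (f \<circ> inv_into V \<phi>) (\<phi> ` (U \<inter> V)))"

definition unit_fun :: "('a, 'n::finite) cmanifold \<Rightarrow> 'a set \<Rightarrow> ('a \<Rightarrow> complex) \<Rightarrow> bool" where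
  "unit_fun M U f \<longleftrightarrow> holo_fun M U f \<and> (\<forall>x\<in>U. f x \<noteq> 0)"

definition holo_map ::
  "('a, 'n::finite) cmanifold \<Rightarrow> ('b, 'm::finite) cmanifold \<Rightarrow> ('a \<Rightarrow> 'b) \<Rightarrow> bool" where
  "holo_map M N f \<longleftrightarrow> continuous_map (mtop M) (mtop N) f \<and>
     (\<forall>(U,\<phi>)\<in>charts M. \<forall>(V,\<psi>)\<in>charts N.
        holo_map_on (\<psi> \<circ> f \<circ> inv_into U \<phi>) (\<phi> ` {x\<in>U. f x \<in> V}))"

definition biholo ::
  "('a, 'n::finite) cmanifold \<Rightarrow> ('b, 'm::finite) cmanifold \<Rightarrow> ('a \<Rightarrow> 'b) \<Rightarrow> bool" where
  "biholo M N f \<longleftrightarrow> holo_map M N f \<and>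
     (\<exists>g. holo_map N M g \<and> (\<forall>x\<in>carrier M. g (f x) = x) \<and> (\<forall>y\<in>carrier N. f (g y) = y))"

definition proper_modification_at ::
  "('a, 'n::finite) cmanifold \<Rightarrow> ('b, 'n) cmanifold \<Rightarrow> ('a \<Rightarrow> 'b) \<Rightarrow> 'b \<Rightarrow> bool" where
  "proper_modification_at M N f p \<longleftrightarrow> p \<in> carrier N \<and>
     holo_map M N f \<and> proper_map (mtop M) (mtop N) f \<and> f ` carrier M = carrier N \<and>
     mtop M interior_of {x\<in>carrier M. f x = p} = {} \<and>
     biholo (open_sub M {x\<in>carrier M. f x \<noteq> p}) (open_sub N (carrier N - {p})) f"


section \<open>Kato manifolds\<close>

definition kato_data ::
  "('a, 'n::finite) cmanifold \<Rightarrow> ('a \<Rightarrow> complex^'n) \<Rightarrow> (complex^'n \<Rightarrow> 'a) \<Rightarrow> bool" where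
  "kato_data M \<pi> \<sigma> \<longleftrightarrow> complex_manifold M \<and>
     proper_modification_at M (open_sub Cn (ball 0 1)) \<pi> 0 \<and>
     (\<exists>U. open U \<and> cball 0 1 \<subseteq> U \<and> openin (mtop M) (\<sigma> ` U) \<and>
          biholo (open_sub Cn U) (open_sub M (\<sigma> ` U)) \<sigma>)"

text \<open>
  The collar of the outer boundary is the part of \<open>M\<close> lying over \<open>1 - \<epsilon> < norm z < 1\<close>, the collar
  of the inner boundary is the image of that shell under \<open>\<sigma>\<close>.  The collars are small enough when
  \<open>\<pi> \<circ> \<sigma>\<close> maps the closed ball into the ball of radius \<open>1 - \<epsilon>\<close>: then they are disjoint open
  subsets of \<open>kato_domain\<close> and \<open>\<sigma> \<circ> \<pi>\<close> maps the first biholomorphically onto the second.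
\<close>

definition collar_width :: "('a \<Rightarrow> complex^'n) \<Rightarrow> (complex^'n \<Rightarrow> 'a) \<Rightarrow> real \<Rightarrow> bool" where
  "collar_width \<pi> \<sigma> \<epsilon> \<longleftrightarrow> 0 < \<epsilon> \<and> \<epsilon> < 1 \<and> (\<pi> \<circ> \<sigma>) ` cball 0 1 \<subseteq> ball 0 (1 - \<epsilon>)"

definition kato_domain ::
  "('a, 'n::finite) cmanifold \<Rightarrow> (complex^'n \<Rightarrow> 'a) \<Rightarrow> real \<Rightarrow> 'a set" where
  "kato_domain M \<sigma> \<epsilon> = carrier M - \<sigma> ` cball 0 (1 - \<epsilon>)"

definition glue_rel ::
  "('a, 'n::finite) cmanifold \<Rightarrow> ('a \<Rightarrow> complex^'n) \<Rightarrow> (complex^'n \<Rightarrow> 'a) \<Rightarrow> real \<Rightarrow> ('a \<times> 'a) set" where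
  "glue_rel M \<pi> \<sigma> \<epsilon> =
     {(x, y). x \<in> kato_domain M \<sigma> \<epsilon> \<and> y \<in> kato_domain M \<sigma> \<epsilon> \<and>
        (x = y \<or>
         norm (\<pi> x) > 1 - \<epsilon> \<and> y = \<sigma> (\<pi> x) \<or>
         norm (\<pi> y) > 1 - \<epsilon> \<and> x = \<sigma> (\<pi> y))}"

definition kato_proj ::
  "('a, 'n::finite) cmanifold \<Rightarrow> ('a \<Rightarrow> complex^'n) \<Rightarrow> (complex^'n \<Rightarrow> 'a) \<Rightarrow> real \<Rightarrow> 'a \<Rightarrow> 'a set" where
  "kato_proj M \<pi> \<sigma> \<epsilon> x = glue_rel M \<pi> \<sigma> \<epsilon> `` {x}"

text \<open>Quotient topology, with the complex structure making \<open>kato_proj\<close> a local biholomorphism.\<close>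

definition kato_manifold ::
  "('a, 'n::finite) cmanifold \<Rightarrow> ('a \<Rightarrow> complex^'n) \<Rightarrow> (complex^'n \<Rightarrow> 'a) \<Rightarrow> real \<Rightarrow>
     ('a set, 'n) cmanifold" where
  "kato_manifold M \<pi> \<sigma> \<epsilon> =
     (let W = kato_domain M \<sigma> \<epsilon>; p = kato_proj M \<pi> \<sigma> \<epsilon> in
      \<lparr>mtop = topology (\<lambda>V. V \<subseteq> W // glue_rel M \<pi> \<sigma> \<epsilon> \<and> openin (mtop M) {x\<in>W. p x \<in> V}),
       charts = {(p ` G, \<phi> \<circ> inv_into G p) | G U \<phi>.
          (U, \<phi>) \<in> charts M \<and> openin (mtop M) G \<and> G \<subseteq> U \<inter> W \<and> inj_on p G}\<rparr>)"


section \<open>Smooth fans and their toric varieties\<close>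

text \<open>
  Both lattices \<open>N\<close> and \<open>M\<close> are \<open>int^'n\<close>, paired by the standard scalar product; cones are subsets
  of \<open>real^'n\<close>.
\<close>

definition rvec :: "int^'n \<Rightarrow> real^'n" where
  "rvec v = (\<chi> i. of_int (v $ i))"

definition rmat :: "int^'n^'m \<Rightarrow> real^'n^'m" where
  "rmat A = (\<chi> i j. of_int (A $ i $ j))"

definition smooth_cone :: "(real^'n) set \<Rightarrow> bool" where
  "smooth_cone \<tau> \<longleftrightarrow> (\<exists>(B::int^'n^'n) J. invertible B \<and>
     \<tau> = convex_cone hull (rvec ` (\<lambda>j. column j B) ` J))"

text \<open>The geometric notion \<open>face_of\<close> admits the empty face, which is not a cone.\<close>

definition smooth_fan :: "(real^'n) set set \<Rightarrow> bool" where
  "smooth_fan \<Sigma> \<longleftrightarrow> \<Sigma> \<noteq> {} \<and> (\<forall>\<tau>\<in>\<Sigma>. smooth_cone \<tau>) \<and>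
     (\<forall>\<tau>\<in>\<Sigma>. \<forall>\<rho>. \<rho> face_of \<tau> \<and> \<rho> \<noteq> {} \<longrightarrow> \<rho> \<in> \<Sigma>) \<and>
     (\<forall>\<tau>\<in>\<Sigma>. \<forall>\<tau>'\<in>\<Sigma>. (\<tau> \<inter> \<tau>') face_of \<tau>)"

definition rays :: "(real^'n) set set \<Rightarrow> (real^'n) set set" where
  "rays \<Sigma> = {\<nu>\<in>\<Sigma>. dim \<nu> = 1}"

definition perp :: "(real^'n) set \<Rightarrow> (int^'n) set" where
  "perp \<tau> = {m. \<forall>v\<in>\<tau>. rvec m \<bullet> v = 0}"

text \<open>
  A point of the orbit of \<open>\<tau>\<close> is a group homomorphism from \<open>perp \<tau>\<close> to the nonzero complex numbers.
  Extended by zero, it is the monoid homomorphism on the dual cone of \<open>\<tau>\<close> (or of any cone having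
  \<open>\<tau>\<close> as a face) which corresponds to the point; its value at \<open>m\<close> is the value of the character \<open>m\<close>.
\<close>

type_synonym 'n tpoint = "(real, 'n) vec set \<times> ((int, 'n) vec \<Rightarrow> complex)"

definition orb :: "(real^'n) set \<Rightarrow> 'n tpoint set" where
  "orb \<tau> = {(\<tau>', f). \<tau>' = \<tau> \<and> (\<forall>m. f m \<noteq> 0 \<longleftrightarrow> m \<in> perp \<tau>) \<and>
     (\<forall>m\<in>perp \<tau>. \<forall>m'\<in>perp \<tau>. f (m + m') = f m * f m')}"

definition toric_points :: "(real^'n) set set \<Rightarrow> 'n tpoint set" where
  "toric_points \<Sigma> = (\<Union>\<tau>\<in>\<Sigma>. orb \<tau>)"

definition affine_piece :: "(real^'n) set set \<Rightarrow> (real^'n) set \<Rightarrow> 'n tpoint set" where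
  "affine_piece \<Sigma> \<sigma> = (\<Union>\<tau>\<in>{\<tau>\<in>\<Sigma>. \<tau> face_of \<sigma>}. orb \<tau>)"

text \<open>
  A cone generated by the part \<open>J\<close> of a lattice basis (the columns of \<open>B\<close>) has as its affine piece
  the set of all \<open>z\<close> with \<open>z $ i \<noteq> 0\<close> for \<open>i \<notin> J\<close>; the coordinates are the characters of the
  dual basis (the rows of the inverse matrix \<open>C\<close>).
\<close>

definition toric_charts :: "(real^'n) set set \<Rightarrow> ('n tpoint set \<times> ('n tpoint \<Rightarrow> complex^'n)) set" where
  "toric_charts \<Sigma> = {(affine_piece \<Sigma> \<sigma>, \<lambda>x. \<chi> i. snd x (row i C)) | \<sigma> (C::int^'n^'n).
     \<sigma> \<in> \<Sigma> \<and> (\<exists>(B::int^'n^'n) J. B ** C = mat 1 \<and> C ** B = mat 1 \<and>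
        \<sigma> = convex_cone hull (rvec ` (\<lambda>j. column j B) ` J))}"

definition toric_variety :: "(real^'n) set set \<Rightarrow> ('n::finite tpoint, 'n) cmanifold" where
  "toric_variety \<Sigma> =
     \<lparr>mtop = topology (\<lambda>V. V \<subseteq> toric_points \<Sigma> \<and>
        (\<forall>(U,\<phi>)\<in>toric_charts \<Sigma>. open (\<phi> ` (V \<inter> U)))),
      charts = toric_charts \<Sigma>\<rparr>"

definition torus :: "(complex^'n) set" where
  "torus = {t. \<forall>i. t $ i \<noteq> 0}"

definition character :: "int^'n \<Rightarrow> complex^'n \<Rightarrow> complex" where
  "character m t = (\<Prod>i\<in>UNIV. t $ i powi m $ i)"

definition torus_emb :: "complex^'n \<Rightarrow> 'n tpoint" where
  "torus_emb t = ({0}, \<lambda>m. character m t)"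

definition torus_act :: "complex^'n \<Rightarrow> 'n tpoint \<Rightarrow> 'n tpoint" where
  "torus_act t x = (fst x, \<lambda>m. character m t * snd x m)"


section \<open>Toric Kato data\<close>

text \<open>Multiplication of vectors is componentwise.\<close>

definition torus_aut :: "(complex^'n \<Rightarrow> complex^'n) \<Rightarrow> bool" where
  "torus_aut \<nu> \<longleftrightarrow> biholo (open_sub Cn torus) (open_sub Cn torus) \<nu> \<and>
     (\<forall>s\<in>torus. \<forall>t\<in>torus. \<nu> (s * t) = \<nu> s * \<nu> t)"

definition hat_ball ::
  "(real^'n) set set \<Rightarrow> ('n tpoint \<Rightarrow> complex^'n) \<Rightarrow> ('n::finite tpoint, 'n) cmanifold" where
  "hat_ball \<Sigma> \<pi> = open_sub (toric_variety \<Sigma>) {x\<in>toric_points \<Sigma>. \<pi> x \<in> ball 0 1}"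

definition toric_kato_data ::
  "(real^'n) set set \<Rightarrow> ('n tpoint \<Rightarrow> complex^'n) \<Rightarrow> (complex^'n \<Rightarrow> 'n tpoint) \<Rightarrow> bool" where
  "toric_kato_data \<Sigma> \<pi> \<sigma> \<longleftrightarrow> finite \<Sigma> \<and> smooth_fan \<Sigma> \<and>
     proper_modification_at (toric_variety \<Sigma>) Cn \<pi> 0 \<and>
     (\<forall>t\<in>torus. \<forall>x\<in>toric_points \<Sigma>. \<pi> (torus_act t x) = t * \<pi> x) \<and>
     kato_data (hat_ball \<Sigma> \<pi>) \<pi> \<sigma> \<and>
     (\<exists>\<nu>. torus_aut \<nu> \<and>
        (\<forall>t\<in>torus. \<forall>z\<in>cball 0 1. t * z \<in> cball 0 1 \<longrightarrow> \<sigma> (t * z) = torus_act (\<nu> t) (\<sigma> z)))"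

definition monomial_map :: "complex^'n \<Rightarrow> int^'n^'n \<Rightarrow> complex^'n \<Rightarrow> complex^'n" where
  "monomial_map lam A z = (\<chi> j. lam $ j * (\<Prod>k\<in>UNIV. z $ k powi A $ j $ k))"

text \<open>The cone of the fixed point \<open>\<sigma> 0\<close> is its first component.\<close>

definition kato_matrix ::
  "('n::finite tpoint \<Rightarrow> complex^'n) \<Rightarrow> (complex^'n \<Rightarrow> 'n tpoint) \<Rightarrow>
     complex^'n \<Rightarrow> int^'n^'n \<Rightarrow> bool" where
  "kato_matrix \<pi> \<sigma> lam A \<longleftrightarrow> lam \<in> torus \<and> invertible A \<and>
     fst (\<sigma> 0) = convex_cone hull (rvec ` columns A) \<and>
     (\<forall>\<^sub>F z in nhds 0. \<pi> (\<sigma> z) = monomial_map lam A z)"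


section \<open>The universal cover\<close>

text \<open>Integer iterates of a bijection of \<open>S\<close>.\<close>

definition iter :: "'a set \<Rightarrow> ('a \<Rightarrow> 'a) \<Rightarrow> int \<Rightarrow> 'a \<Rightarrow> 'a" where
  "iter S f k = (if k \<ge> 0 then f ^^ nat k else inv_into S f ^^ nat (- k))"

definition cover_fan :: "(real^'n) set set \<Rightarrow> (real^'n) set \<Rightarrow> int^'n^'n \<Rightarrow> (real^'n) set set" where
  "cover_fan \<Sigma> \<tau>\<^sub>A A = {iter UNIV ((*v) (rmat A)) m ` \<tau> | \<tau> m. \<tau> \<in> \<Sigma> - {\<tau>\<^sub>A}}"

definition torus_basin :: "complex^'n \<Rightarrow> int^'n^'n \<Rightarrow> (complex^'n) set" where
  "torus_basin lam A =
     {z\<in>torus. (\<lambda>m. norm ((monomial_map lam A ^^ m) z)) \<longlonglongrightarrow> 0}"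

definition kato_cover ::
  "(real^'n) set set \<Rightarrow> complex^'n \<Rightarrow> int^'n^'n \<Rightarrow> ('n::finite tpoint, 'n) cmanifold" where
  "kato_cover \<Sigma>\<^sub>A lam A = (let Y = toric_variety \<Sigma>\<^sub>A in
     open_sub Y (mtop Y interior_of (mtop Y closure_of (torus_emb ` torus_basin lam A))))"

definition extends_to_cover ::
  "('n::finite tpoint, 'n) cmanifold \<Rightarrow> complex^'n \<Rightarrow> int^'n^'n \<Rightarrow> ('n tpoint \<Rightarrow> 'n tpoint) \<Rightarrow> bool" where
  "extends_to_cover E lam A \<gamma> \<longleftrightarrow> biholo E E \<gamma> \<and>
     (\<forall>z\<in>torus_basin lam A. \<gamma> (torus_emb z) = torus_emb (monomial_map lam A z))"

definition holo_covering ::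
  "('a, 'n::finite) cmanifold \<Rightarrow> ('b, 'n) cmanifold \<Rightarrow> ('a \<Rightarrow> 'b) \<Rightarrow> bool" where
  "holo_covering E X q \<longleftrightarrow> q ` carrier E = carrier X \<and>
     (\<forall>y\<in>carrier X. \<exists>U \<V>. openin (mtop X) U \<and> y \<in> U \<and>
        \<Union>\<V> = {x\<in>carrier E. q x \<in> U} \<and> pairwise disjnt \<V> \<and>
        (\<forall>V\<in>\<V>. openin (mtop E) V \<and> biholo (open_sub E V) (open_sub X U) q))"

definition simply_connected_space :: "'a topology \<Rightarrow> bool" where
  "simply_connected_space T \<longleftrightarrow> path_connected_space T \<and>
     (\<forall>p. continuous_map (top_of_set {0..1::real}) T p \<and> p 0 = p 1 \<longrightarrow>
        homotopic_with (\<lambda>h. h 0 = p 0 \<and> h 1 = p 0) (top_of_set {0..1}) T p (\<lambda>_. p 0))"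

definition deck_group ::
  "('a, 'n::finite) cmanifold \<Rightarrow> ('a \<Rightarrow> 'b) \<Rightarrow> ('a \<Rightarrow> 'a) set" where
  "deck_group E q = {\<psi>. biholo E E \<psi> \<and> (\<forall>x\<in>carrier E. q (\<psi> x) = q x)}"

text \<open>
  The last two clauses say that the deck group is infinite cyclic, acting freely, and that it is
  transitive on the fibres.  For the universal cover of a connected manifold freeness and
  transitivity are automatic.
\<close>

definition universal_cover_with_generator ::
  "('a, 'n::finite) cmanifold \<Rightarrow> ('b, 'n) cmanifold \<Rightarrow> ('a \<Rightarrow> 'b) \<Rightarrow> ('a \<Rightarrow> 'a) \<Rightarrow> bool" where
  "universal_cover_with_generator E X q \<gamma> \<longleftrightarrow>
     holo_covering E X q \<and> simply_connected_space (mtop E) \<and>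
     \<gamma> \<in> deck_group E q \<and>
     (\<forall>\<psi>\<in>deck_group E q. \<exists>k. \<forall>x\<in>carrier E. \<psi> x = iter (carrier E) \<gamma> k x) \<and>
     (\<forall>x\<in>carrier E. \<forall>k. iter (carrier E) \<gamma> k x = x \<longrightarrow> k = 0) \<and>
     (\<forall>x\<in>carrier E. \<forall>y\<in>carrier E. q x = q y \<longrightarrow> (\<exists>k. y = iter (carrier E) \<gamma> k x))"


section \<open>Divisors\<close>

text \<open>
  Cartier divisors: \<open>(U, f, h)\<close> is the local equation \<open>f / h\<close> on \<open>U\<close>, with \<open>f\<close> and \<open>h\<close> holomorphic
  and vanishing identically on no nonempty open set.
\<close>

type_synonym 'a divisor = "('a set \<times> ('a \<Rightarrow> complex) \<times> ('a \<Rightarrow> complex)) set"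

definition regular_fun :: "('a, 'n::finite) cmanifold \<Rightarrow> 'a set \<Rightarrow> ('a \<Rightarrow> complex) \<Rightarrow> bool" where
  "regular_fun M U f \<longleftrightarrow> holo_fun M U f \<and>
     (\<forall>V. openin (mtop M) V \<and> V \<subseteq> U \<and> V \<noteq> {} \<longrightarrow> (\<exists>x\<in>V. f x \<noteq> 0))"

text \<open>\<open>u\<close> is the holomorphic extension of the quotient \<open>(f / h) / (f' / h')\<close>.\<close>

definition ratio_unit ::
  "('a, 'n::finite) cmanifold \<Rightarrow> 'a set \<times> ('a \<Rightarrow> complex) \<times> ('a \<Rightarrow> complex) \<Rightarrow>
     'a set \<times> ('a \<Rightarrow> complex) \<times> ('a \<Rightarrow> complex) \<Rightarrow> ('a \<Rightarrow> complex) \<Rightarrow> bool" where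
  "ratio_unit M = (\<lambda>(U, f, h) (U', f', h') u. unit_fun M (U \<inter> U') u \<and>
     (\<forall>x\<in>U \<inter> U'. f x * h' x = u x * (f' x * h x)))"

definition cartier_divisor :: "('a, 'n::finite) cmanifold \<Rightarrow> 'a divisor \<Rightarrow> bool" where
  "cartier_divisor M D \<longleftrightarrow> carrier M = (\<Union>(U, f, h)\<in>D. U) \<and>
     (\<forall>(U, f, h)\<in>D. regular_fun M U f \<and> regular_fun M U h) \<and>
     (\<forall>d\<in>D. \<forall>d'\<in>D. \<exists>u. ratio_unit M d d' u)"

definition divisor_eq :: "('a, 'n::finite) cmanifold \<Rightarrow> 'a divisor \<Rightarrow> 'a divisor \<Rightarrow> bool" where
  "divisor_eq M D D' \<longleftrightarrow> cartier_divisor M D \<and> cartier_divisor M D' \<and>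
     (\<forall>d\<in>D. \<forall>d'\<in>D'. \<exists>u. ratio_unit M d d' u)"

definition divisor_uminus :: "'a divisor \<Rightarrow> 'a divisor" where
  "divisor_uminus D = (\<lambda>(U, f, h). (U, h, f)) ` D"

definition divisor_pullback :: "('a, 'n::finite) cmanifold \<Rightarrow> ('a \<Rightarrow> 'b) \<Rightarrow> 'b divisor \<Rightarrow> 'a divisor" where
  "divisor_pullback E q D = (\<lambda>(U, f, h). ({x\<in>carrier E. q x \<in> U}, f \<circ> q, h \<circ> q)) ` D"

text \<open>\<open>f\<close> generates the ideal sheaf of the hypersurface \<open>S\<close> on \<open>U\<close>.\<close>

definition local_equation ::
  "('a, 'n::finite) cmanifold \<Rightarrow> 'a set \<Rightarrow> 'a set \<Rightarrow> ('a \<Rightarrow> complex) \<Rightarrow> bool" where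
  "local_equation M S U f \<longleftrightarrow> holo_fun M U f \<and> (\<forall>x\<in>U \<inter> S. f x = 0) \<and>
     (\<forall>V g. V \<subseteq> U \<and> holo_fun M V g \<and> (\<forall>x\<in>V \<inter> S. g x = 0) \<longrightarrow>
        (\<exists>k. holo_fun M V k \<and> (\<forall>x\<in>V. g x = k x * f x)))"

text \<open>The locally finite sum of the reduced hypersurfaces \<open>S \<nu>\<close>, \<open>\<nu> \<in> I\<close>.\<close>

definition divisor_sum :: "('a, 'n::finite) cmanifold \<Rightarrow> 'i set \<Rightarrow> ('i \<Rightarrow> 'a set) \<Rightarrow> 'a divisor" where
  "divisor_sum M I S =
     {(U, \<lambda>x. \<Prod>\<nu>\<in>{\<nu>\<in>I. S \<nu> \<inter> U \<noteq> {}}. f \<nu> x, \<lambda>_. 1) | U f.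
        openin (mtop M) U \<and> finite {\<nu>\<in>I. S \<nu> \<inter> U \<noteq> {}} \<and>
        (\<forall>\<nu>\<in>{\<nu>\<in>I. S \<nu> \<inter> U \<noteq> {}}. local_equation M (S \<nu>) U (f \<nu>))}"

definition cover_divisor ::
  "(real^'n) set set \<Rightarrow> ('n::finite tpoint, 'n) cmanifold \<Rightarrow> 'n tpoint divisor" where
  "cover_divisor \<Sigma>\<^sub>A E = divisor_sum E (rays \<Sigma>\<^sub>A)
     (\<lambda>\<nu>. (mtop (toric_variety \<Sigma>\<^sub>A) closure_of orb \<nu>) \<inter> carrier E)"


section \<open>Holomorphic line bundles\<close>

text \<open>
  A line bundle is given by transition functions: the components of a section
  satisfy \<open>s i = lb_trans L i j * s j\<close> on \<open>lb_open L i \<inter> lb_open L j\<close>.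
\<close>

record ('i, 'a) line_bundle =
  lb_index :: "'i set"
  lb_open :: "'i \<Rightarrow> 'a set"
  lb_trans :: "'i \<Rightarrow> 'i \<Rightarrow> 'a \<Rightarrow> complex"

definition holo_line_bundle :: "('a, 'n::finite) cmanifold \<Rightarrow> ('i, 'a) line_bundle \<Rightarrow> bool" where
  "holo_line_bundle M L \<longleftrightarrow> carrier M = (\<Union>i\<in>lb_index L. lb_open L i) \<and>
     (\<forall>i\<in>lb_index L. openin (mtop M) (lb_open L i)) \<and>
     (\<forall>i\<in>lb_index L. \<forall>j\<in>lb_index L.
        unit_fun M (lb_open L i \<inter> lb_open L j) (lb_trans L i j)) \<and>
     (\<forall>i\<in>lb_index L. \<forall>j\<in>lb_index L. \<forall>k\<in>lb_index L.
        \<forall>x\<in>lb_open L i \<inter> lb_open L j \<inter> lb_open L k.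
          lb_trans L i j x * lb_trans L j k x = lb_trans L i k x)"

text \<open>An isomorphism is given in the trivialisations by multiplication with the units \<open>c i a\<close>.\<close>

definition lb_iso ::
  "('a, 'n::finite) cmanifold \<Rightarrow> ('i, 'a) line_bundle \<Rightarrow> ('j, 'a) line_bundle \<Rightarrow> bool" where
  "lb_iso M L L' \<longleftrightarrow> holo_line_bundle M L \<and> holo_line_bundle M L' \<and>
     (\<exists>c. (\<forall>i\<in>lb_index L. \<forall>a\<in>lb_index L'. unit_fun M (lb_open L i \<inter> lb_open L' a) (c i a)) \<and>
        (\<forall>i\<in>lb_index L. \<forall>j\<in>lb_index L. \<forall>a\<in>lb_index L'. \<forall>b\<in>lb_index L'.
           \<forall>x\<in>lb_open L i \<inter> lb_open L j \<inter> lb_open L' a \<inter> lb_open L' b.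
             c i a x * lb_trans L i j x = lb_trans L' a b x * c j b x))"

definition lb_tensor ::
  "('i, 'a) line_bundle \<Rightarrow> ('j, 'a) line_bundle \<Rightarrow> ('i \<times> 'j, 'a) line_bundle" where
  "lb_tensor L L' =
     \<lparr>lb_index = lb_index L \<times> lb_index L',
      lb_open = (\<lambda>(i, a). lb_open L i \<inter> lb_open L' a),
      lb_trans = (\<lambda>(i, a) (j, b) x. lb_trans L i j x * lb_trans L' a b x)\<rparr>"

definition lb_power :: "('i, 'a) line_bundle \<Rightarrow> nat \<Rightarrow> ('i, 'a) line_bundle" where
  "lb_power L m = L\<lparr>lb_trans := (\<lambda>i j x. lb_trans L i j x ^ m)\<rparr>"

text \<open>
  In the chart \<open>\<phi>\<close> the frame is \<open>d\<phi>\<^sub>1 \<and> \<dots> \<and> d\<phi>\<^sub>n\<close>, and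
  \<open>d\<phi>'\<^sub>1 \<and> \<dots> \<and> d\<phi>'\<^sub>n = det (\<partial>\<phi>' / \<partial>\<phi>) d\<phi>\<^sub>1 \<and> \<dots> \<and> d\<phi>\<^sub>n\<close>.
  As the derivative is complex linear, \<open>matrix\<close> yields the complex Jacobian matrix.
\<close>

definition canonical_bundle ::
  "('a, 'n::finite) cmanifold \<Rightarrow> ('a set \<times> ('a \<Rightarrow> complex^'n), 'a) line_bundle" where
  "canonical_bundle M =
     \<lparr>lb_index = charts M, lb_open = fst,
      lb_trans = (\<lambda>(U, \<phi>) (U', \<phi>') x.
        det (matrix (frechet_derivative (\<phi>' \<circ> inv_into U \<phi>) (at (\<phi> x)))))\<rparr>"

text \<open>
  The quotient of \<open>E \<times> \<complex>\<close> by \<open>(x, c) \<mapsto> (\<gamma> x, a c)\<close>, where \<open>a = \<rho> \<gamma>\<close>.  A local section \<open>s\<close>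
  of \<open>q\<close> trivialises it by \<open>[s x, c] \<mapsto> c\<close>, and \<open>[s' x, c] = [\<gamma>\<^sup>k (s' x), a\<^sup>k c]\<close>.
\<close>

definition flat_bundle ::
  "('a, 'n::finite) cmanifold \<Rightarrow> ('b, 'n) cmanifold \<Rightarrow> ('a \<Rightarrow> 'b) \<Rightarrow> ('a \<Rightarrow> 'a) \<Rightarrow> complex \<Rightarrow>
     ('b set \<times> ('b \<Rightarrow> 'a), 'b) line_bundle" where
  "flat_bundle E X q \<gamma> a =
     \<lparr>lb_index = {(U, s). openin (mtop X) U \<and>
        continuous_map (subtopology (mtop X) U) (mtop E) s \<and> (\<forall>x\<in>U. q (s x) = x)},
      lb_open = fst,
      lb_trans = (\<lambda>(U, s) (U', s') x. a powi (THE k. s x = iter (carrier E) \<gamma> k (s' x)))\<rparr>"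

text \<open>Sections are the meromorphic \<open>g\<close> with \<open>g f / h\<close> holomorphic for all \<open>(U, f, h) \<in> D\<close>.\<close>

definition divisor_bundle ::
  "('a, 'n::finite) cmanifold \<Rightarrow> 'a divisor \<Rightarrow>
     ('a set \<times> ('a \<Rightarrow> complex) \<times> ('a \<Rightarrow> complex), 'a) line_bundle" where
  "divisor_bundle M D =
     \<lparr>lb_index = D, lb_open = fst, lb_trans = (\<lambda>d d'. SOME u. ratio_unit M d d' u)\<rparr>"


section \<open>Kodaira dimension\<close>

definition lb_section ::
  "('a, 'n::finite) cmanifold \<Rightarrow> ('i, 'a) line_bundle \<Rightarrow> ('i \<Rightarrow> 'a \<Rightarrow> complex) \<Rightarrow> bool" where
  "lb_section M L s \<longleftrightarrow>
     (\<forall>i\<in>lb_index L. holo_fun M (lb_open L i) (s i)) \<and>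
     (\<forall>i\<in>lb_index L. \<forall>j\<in>lb_index L. \<forall>x\<in>lb_open L i \<inter> lb_open L j.
        s i x = lb_trans L i j x * s j x)"

text \<open>The dimension of the space of global sections.\<close>

definition lb_h0 :: "('a, 'n::finite) cmanifold \<Rightarrow> ('i, 'a) line_bundle \<Rightarrow> enat" where
  "lb_h0 M L = Sup {enat r | r. \<exists>s. (\<forall>k<r. lb_section M L (s k)) \<and>
     (\<forall>c. (\<forall>i\<in>lb_index L. \<forall>x\<in>lb_open L i. (\<Sum>k<r. c k * s k i x) = 0) \<longrightarrow> (\<forall>k<r. c k = 0))}"

definition plurigenus :: "('a, 'n::finite) cmanifold \<Rightarrow> nat \<Rightarrow> enat" where
  "plurigenus M m = lb_h0 M (lb_power (canonical_bundle M) m)"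

text \<open>
  For compact \<open>M\<close> the plurigenera are finite, and the Kodaira dimension is their order of growth.
\<close>

definition kodaira_dimension :: "('a, 'n::finite) cmanifold \<Rightarrow> ereal" where
  "kodaira_dimension M =
     (if \<forall>m\<ge>1. plurigenus M m = 0 then - \<infinity>
      else limsup (\<lambda>m. if plurigenus M m = 0 then - \<infinity>
                       else ereal (ln (real (the_enat (plurigenus M m))) / ln (real m))))"

end

theory Submission
  imports Defs "HOL-Complex_Analysis.Conformal_Mappings"
begin

text \<open>
  On the torus the form \<open>\<omega> = dt\<^sub>1/t\<^sub>1 \<and> \<dots> \<and> dt\<^sub>n/t\<^sub>n\<close> is invariant, and a monomial map \<open>t \<mapsto> \<lambda> t\<^sup>A\<close> pulls it
  back to \<open>det A \<cdot> \<omega>\<close>; hence \<open>\<gamma>\<^sup>* \<omega> = det A \<cdot> \<omega>\<close>. In the coordinates \<open>z\<close> of a smooth cone \<open>\<omega>\<close> is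
  \<open>\<plusminus> dz\<^sub>1/z\<^sub>1 \<and> \<dots> \<and> dz\<^sub>n/z\<^sub>n\<close>, so on the universal cover it has simple poles exactly along the toric
  divisor. Read on \<open>X\<close>, it is a
  nowhere vanishing section of the canonical bundle twisted by \<open>D\<^sub>T\<close> and by the character \<open>det A\<close>.

  A pluricanonical section pulled back to the universal cover and divided by \<open>\<omega>\<^sup>m\<close> is a holomorphic
  function that vanishes off the torus and whose modulus is \<open>\<Gamma>\<close>-invariant. Since \<open>X\<close> is compact, the
  modulus attains its maximum and the function is constant. The universal cover is not contained
  in the torus, being simply connected, so the constant is zero.
\<close>

text \<open>Holomorphy is given as complex differentiability at every point, without continuity of
  the derivative. The transition functions of the canonical bundle are Jacobians and must be
  holomorphic themselves, so Cauchy's formula on coordinate circles and differentiation under the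
  integral precede the geometry.

  The form enters only through scalar functions \<open>logjac\<close>, one for each chart of
  \<open>X\<close>: the volume form of the chart divided by the logarithmic form. Poles of the
  latter are therefore zeros of \<open>logjac\<close>, and \<open>logjac\<close> is a local equation
  of the toric divisor.

  Transition functions of the divisor bundle are chosen quotients, known only through products with
  local equations. Identities between them are proved after multiplication by functions with dense
  nonzero locus, and then cancelled.

  The generator \<open>\<gamma>\<close> is given by a formula only on the basin of the torus;
  density of the basin extends it to all torus points of the cover.

  The cover leaves the torus because of a symmetry: multiplying coordinates by complex numbers of
  modulus 1 preserves the basin, so inside the torus there would be a loop that no simply connected
  space allows.\<close>

section \<open>Complex differentiability on complex n-space\<close>

definition cdiff :: "(complex^'n \<Rightarrow> complex) \<Rightarrow> complex^'n \<Rightarrow> bool" where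
  "cdiff f z \<longleftrightarrow> (\<exists>L. (f has_derivative L) (at z) \<and> (\<forall>c v. L (c *s v) = c * L v))"

definition cdiffv :: "(complex^'n \<Rightarrow> complex^'m) \<Rightarrow> complex^'n \<Rightarrow> bool" where
  "cdiffv f z \<longleftrightarrow> (\<exists>L. (f has_derivative L) (at z) \<and> (\<forall>c v. L (c *s v) = c *s L v))"

lemma holo_fun_on_cdiff: "holo_fun_on f S \<longleftrightarrow> (\<forall>z\<in>S. cdiff f z)"
  by (simp add: holo_fun_on_def cdiff_def)

lemma holo_map_on_cdiffv: "holo_map_on f S \<longleftrightarrow> (\<forall>z\<in>S. cdiffv f z)"
  by (simp add: holo_map_on_def cdiffv_def)

lemma bounded_linear_axis: "bounded_linear (axis i :: complex \<Rightarrow> complex^'n)"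
proof -
  have "linear (axis i :: complex \<Rightarrow> complex^'n)"
    by (rule linearI) (auto simp: vec_eq_iff axis_def)
  then show ?thesis by (simp add: linear_linear)
qed

lemma vec_axis_sum: "(x::complex^'n) = (\<Sum>i\<in>UNIV. axis i (x $ i))"
  by (simp add: vec_eq_iff axis_def)

text \<open>A vector function is the sum of its components placed along the axes, so derivative and
  complex linearity can be tested componentwise. Calculus rules are then needed for scalar functions
  only.\<close>

lemma cdiffv_iff: "cdiffv f z \<longleftrightarrow> (\<forall>i. cdiff (\<lambda>w. f w $ i) z)"
proof
  assume "cdiffv f z"
  then obtain L where L: "(f has_derivative L) (at z)" "\<And>c v. L (c *s v) = c *s L v"
    unfolding cdiffv_def by blast
  have "((\<lambda>w. f w $ i) has_derivative (\<lambda>v. L v $ i)) (at z)" for i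
    by (rule bounded_linear.has_derivative[OF bounded_linear_vec_nth L(1)])
  moreover have "L (c *s v) $ i = c * L v $ i" for c v i by (simp add: L)
  ultimately show "\<forall>i. cdiff (\<lambda>w. f w $ i) z"
    unfolding cdiff_def by blast
next
  assume "\<forall>i. cdiff (\<lambda>w. f w $ i) z"
  then obtain L where L: "\<And>i. ((\<lambda>w. f w $ i) has_derivative L i) (at z)" "\<And>i c v. L i (c *s v) = c * L i v"
    unfolding cdiff_def by metis
  have "((\<lambda>w. \<Sum>i\<in>UNIV. axis i (f w $ i)) has_derivative (\<lambda>v. \<Sum>i\<in>UNIV. axis i (L i v))) (at z)"
    by (intro has_derivative_sum bounded_linear.has_derivative[OF bounded_linear_axis] L)
  then have "(f has_derivative (\<lambda>v. \<Sum>i\<in>UNIV. axis i (L i v))) (at z)"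
    by (simp flip: vec_axis_sum)
  moreover have "(\<Sum>i\<in>UNIV. axis i (L i (c *s v))) = c *s (\<Sum>i\<in>UNIV. axis i (L i v))" for c v
    by (simp add: vec_eq_iff axis_def L)
  ultimately show "cdiffv f z" unfolding cdiffv_def by blast
qed

lemma cdiff_const [simp]: "cdiff (\<lambda>_. c) z"
  unfolding cdiff_def by (rule exI[of _ "\<lambda>_. 0"]) auto

lemma cdiff_nth: "cdiff (\<lambda>w. w $ i) z"
  unfolding cdiff_def
  by (rule exI[of _ "\<lambda>v. v $ i"]) (auto intro: bounded_linear_imp_has_derivative bounded_linear_vec_nth)

lemma cdiffv_id: "cdiffv (\<lambda>w. w) z"
  by (simp add: cdiffv_iff cdiff_nth)

lemma cdiff_add: "cdiff f z \<Longrightarrow> cdiff g z \<Longrightarrow> cdiff (\<lambda>w. f w + g w) z"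
  unfolding cdiff_def
  apply (elim exE conjE)
  subgoal for L M by (rule exI[of _ "\<lambda>v. L v + M v"]) (auto intro: has_derivative_add simp: algebra_simps)
  done

lemma cdiff_mult: "cdiff f z \<Longrightarrow> cdiff g z \<Longrightarrow> cdiff (\<lambda>w. f w * g w) z"
  unfolding cdiff_def
  apply (elim exE conjE)
  subgoal for L M
    by (rule exI[of _ "\<lambda>v. f z * M v + L v * g z"]) (rule conjI[OF has_derivative_mult], auto simp: algebra_simps)
  done

lemma cdiff_sum: "(\<And>i. i \<in> I \<Longrightarrow> cdiff (f i) z) \<Longrightarrow> cdiff (\<lambda>w. \<Sum>i\<in>I. f i w) z"
  by (induction I rule: infinite_finite_induct) (auto intro: cdiff_add)

lemma cdiff_prod: "(\<And>i. i \<in> I \<Longrightarrow> cdiff (f i) z) \<Longrightarrow> cdiff (\<lambda>w. \<Prod>i\<in>I. f i w) z"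
  by (induction I rule: infinite_finite_induct) (auto intro: cdiff_mult)

lemma cdiff_power: "cdiff f z \<Longrightarrow> cdiff (\<lambda>w. f w ^ k) z"
  by (induction k) (auto intro: cdiff_mult)

lemma cdiff_inverse:
  assumes "cdiff f z" "f z \<noteq> 0" shows "cdiff (\<lambda>w. inverse (f w)) z"
proof -
  obtain L where L: "(f has_derivative L) (at z)" "\<And>c v. L (c *s v) = c * L v"
    using assms(1) unfolding cdiff_def by blast
  show ?thesis unfolding cdiff_def
    by (rule exI, rule conjI, rule Deriv.has_derivative_inverse[OF assms(2) L(1)]) (simp add: L)
qed

lemma cdiff_powi:
  assumes "cdiff f z" "f z \<noteq> 0 \<or> 0 \<le> k" shows "cdiff (\<lambda>w. f w powi k) z"
proof (cases "0 \<le> k")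
  case True
  then show ?thesis using assms by (simp add: power_int_def cdiff_power)
next
  case False
  with assms have "f z \<noteq> 0" by simp
  with False show ?thesis
    using cdiff_power[OF cdiff_inverse[OF assms(1)]] by (simp add: power_int_def)
qed

lemma cdiff_isCont: "cdiff f z \<Longrightarrow> isCont f z"
  unfolding cdiff_def using has_derivative_continuous by blast

lemma cdiffv_isCont: "cdiffv f z \<Longrightarrow> isCont f z"
  unfolding cdiffv_def using has_derivative_continuous by blast

lemma cdiff_cong_ev:
  assumes "cdiff f z" "\<forall>\<^sub>F w in nhds z. f w = g w" shows "cdiff g z"
proof -
  have "(g has_derivative L) (at z)" if "(f has_derivative L) (at z)" for L
    by (rule has_derivative_transform_eventually[OF that])
      (use assms(2) in \<open>auto dest: eventually_nhds_x_imp_x simp: eventually_at_filter elim: eventually_mono\<close>)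
  with assms(1) show ?thesis unfolding cdiff_def by blast
qed

lemma cdiffv_cong_ev:
  assumes "cdiffv f z" "\<forall>\<^sub>F w in nhds z. f w = g w" shows "cdiffv g z"
  using assms cdiff_cong_ev[of "\<lambda>w. f w $ i" z "\<lambda>w. g w $ i" for i]
  unfolding cdiffv_iff by (metis (mono_tags, lifting) eventually_mono)

lemma cdiff_cong_open:
  assumes "cdiff f z" "open S" "z \<in> S" "\<And>w. w \<in> S \<Longrightarrow> f w = g w" shows "cdiff g z"
  using assms cdiff_cong_ev[of f z g] eventually_nhds by blast

lemma cdiffv_cong_open:
  assumes "cdiffv f z" "open S" "z \<in> S" "\<And>w. w \<in> S \<Longrightarrow> f w = g w" shows "cdiffv g z"
  using assms cdiffv_cong_ev[of f z g] eventually_nhds by blast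

lemma cdiff_compose:
  assumes "cdiffv g z" "cdiff f (g z)" shows "cdiff (\<lambda>w. f (g w)) z"
proof -
  obtain L M where L: "(g has_derivative L) (at z)" "\<And>c v. L (c *s v) = c *s L v"
    and M: "(f has_derivative M) (at (g z))" "\<And>c v. M (c *s v) = c * M v"
    using assms unfolding cdiff_def cdiffv_def by blast
  have "((\<lambda>w. f (g w)) has_derivative (\<lambda>v. M (L v))) (at z)"
    using has_derivative_compose[OF L(1) M(1)] .
  with L M show ?thesis unfolding cdiff_def by (intro exI[of _ "\<lambda>v. M (L v)"]) simp
qed

lemma cdiffv_compose:
  assumes "cdiffv g z" "cdiffv f (g z)" shows "cdiffv (\<lambda>w. f (g w)) z"
  using assms cdiff_compose[OF assms(1), of "\<lambda>w. f w $ i" for i] by (simp add: cdiffv_iff)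

text \<open>The determinant used in \<open>canonical_bundle\<close>. \<open>matrix\<close> evaluates
  the derivative on the vectors \<open>axis k 1\<close> only; complex linearity is what makes this
  the complex Jacobian.\<close>

definition jac :: "(complex^'n \<Rightarrow> complex^'n) \<Rightarrow> complex^'n \<Rightarrow> complex" where
  "jac f z = det (matrix (frechet_derivative f (at z)))"

lemma cdiffv_frechet:
  assumes "cdiffv f z"
  shows "(f has_derivative frechet_derivative f (at z)) (at z)"
    "Vector_Spaces.linear (*s) (*s) (frechet_derivative f (at z))"
proof -
  obtain L where L: "(f has_derivative L) (at z)" "\<And>c v. L (c *s v) = c *s L v"
    using assms unfolding cdiffv_def by blast
  have e: "frechet_derivative f (at z) = L" using frechet_derivative_at[OF L(1)] by simp
  show "(f has_derivative frechet_derivative f (at z)) (at z)" using L e by simp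
  \<comment> \<open>Linearity over the complex field, as \<open>matrix_compose_gen\<close> requires;
    \<open>has_derivative\<close> alone provides real linearity.\<close>
  show "Vector_Spaces.linear (*s) (*s) (frechet_derivative f (at z))"
    unfolding e
    by unfold_locales (simp_all only: L(2) bounded_linear.linear[OF has_derivative_bounded_linear[OF L(1)], THEN linear_add])
qed

lemma jac_compose:
  assumes "cdiffv f z" "cdiffv g (f z)"
  shows "jac (\<lambda>w. g (f w)) z = jac g (f z) * jac f z"
proof -
  have "((\<lambda>w. g (f w)) has_derivative
     (\<lambda>v. frechet_derivative g (at (f z)) (frechet_derivative f (at z) v))) (at z)"
    using has_derivative_compose[OF cdiffv_frechet(1)[OF assms(1)] cdiffv_frechet(1)[OF assms(2)]] .
  from frechet_derivative_at[OF this]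
  have "frechet_derivative (\<lambda>w. g (f w)) (at z) = frechet_derivative g (at (f z)) \<circ> frechet_derivative f (at z)"
    by (simp add: o_def)
  then show ?thesis
    unfolding jac_def
    by (simp add: matrix_compose_gen[OF cdiffv_frechet(2)[OF assms(1)] cdiffv_frechet(2)[OF assms(2)]] det_mul)
qed

lemma jac_cong_ev:
  assumes "cdiffv f z" "\<forall>\<^sub>F w in nhds z. f w = g w" shows "jac g z = jac f z"
proof -
  have "(g has_derivative frechet_derivative f (at z)) (at z)"
    by (rule has_derivative_transform_eventually[OF cdiffv_frechet(1)[OF assms(1)]])
      (use assms(2) in \<open>auto dest: eventually_nhds_x_imp_x simp: eventually_at_filter elim: eventually_mono\<close>)
  from frechet_derivative_at[OF this] show ?thesis unfolding jac_def by simp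
qed

lemma jac_cong_open:
  assumes "cdiffv f z" "open S" "z \<in> S" "\<And>w. w \<in> S \<Longrightarrow> f w = g w" shows "jac g z = jac f z"
  using assms jac_cong_ev[of f z g] eventually_nhds by blast

lemma jac_id: "jac (\<lambda>w. w) z = 1"
  unfolding jac_def frechet_derivative_ident by (simp add: matrix_id_mat_1[unfolded id_def])

lemma cdiff_frechet:
  assumes "cdiff f z"
  shows "(f has_derivative frechet_derivative f (at z)) (at z)"
    "frechet_derivative f (at z) (c *s v) = c * frechet_derivative f (at z) v"
proof -
  obtain L where L: "(f has_derivative L) (at z)" "\<And>c v. L (c *s v) = c * L v"
    using assms unfolding cdiff_def by blast
  have e: "frechet_derivative f (at z) = L" using frechet_derivative_at[OF L(1)] by simp
  show "(f has_derivative frechet_derivative f (at z)) (at z)" using L e by simp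
  show "frechet_derivative f (at z) (c *s v) = c * frechet_derivative f (at z) v"
    using L e by simp
qed

section \<open>Cauchy's formula and holomorphy of Jacobians\<close>

lemma has_derivative_line:
  "((\<lambda>\<zeta>. z + \<zeta> *s v) has_derivative (\<lambda>\<zeta>. \<zeta> *s v)) (at (w::complex))" for v :: "complex^'n"
proof -
  have "linear (\<lambda>\<zeta>::complex. \<zeta> *s v)"
    by (rule linearI) (auto simp: vec_eq_iff algebra_simps)
  then have "bounded_linear (\<lambda>\<zeta>::complex. \<zeta> *s v)"
    by (simp add: linear_linear)
  from has_derivative_add[OF has_derivative_const[of z] bounded_linear_imp_has_derivative[OF this]]
  show ?thesis by simp
qed

text \<open>On a complex line \<open>f\<close> becomes a function of one variable. This is the
  entrance for Cauchy's formula, the maximum principle and the computation of Jacobians.\<close>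

lemma cdiff_line:
  fixes v :: "complex^'n"
  assumes "cdiff f (z + w *s v)"
  shows "((\<lambda>\<zeta>. f (z + \<zeta> *s v)) has_field_derivative frechet_derivative f (at (z + w *s v)) v) (at w)"
proof -
  have "((\<lambda>\<zeta>. f (z + \<zeta> *s v)) has_derivative (\<lambda>\<zeta>. frechet_derivative f (at (z + w *s v)) (\<zeta> *s v))) (at w)"
    using has_derivative_compose[OF has_derivative_line cdiff_frechet(1)[OF assms]] .
  then show ?thesis
    unfolding has_field_derivative_def cdiff_frechet(2)[OF assms]
    by (simp add: mult.commute[of _ "frechet_derivative f (at (z + w *s v)) v"])
qed

definition partial :: "'n \<Rightarrow> (complex^'n \<Rightarrow> complex) \<Rightarrow> complex^'n \<Rightarrow> complex" where
  "partial k f z = frechet_derivative f (at z) (axis k 1)"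

text \<open>The circle about 0 parametrised by the unit interval, as in
  \<open>circlepath 0 r\<close>.\<close>

abbreviation circ :: "real \<Rightarrow> real \<Rightarrow> complex" where
  "circ r t \<equiv> of_real r * exp (2 * of_real pi * \<i> * of_real t)"

lemma norm_smult_complex: "norm (c *s v) = norm c * norm v" for v :: "complex^'n"
  by (simp add: norm_vec_def L2_set_def norm_mult power_mult_distrib real_sqrt_mult flip: sum_distrib_left)

lemma norm_complex_axis: "norm (axis k 1 :: complex^'n) = 1"
proof -
  have "norm (axis k 1 :: complex^'n) = sqrt (\<Sum>i\<in>UNIV. if i = k then 1 else 0)"
    unfolding norm_vec_def L2_set_def by (intro arg_cong[where f=sqrt] sum.cong) (auto simp: axis_def)
  then show ?thesis by simp
qed

lemma norm_circ_axis: "norm (circ r t *s axis k 1 :: complex^'n) = \<bar>r\<bar>"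
  unfolding norm_smult_complex norm_complex_axis by (simp add: norm_mult)

text \<open>Cauchy's formula for the first derivative of the restriction of \<open>f\<close> to a
  coordinate line. It expresses a derivative by values of \<open>f\<close>, and with a fixed radius
  it can be studied as a function of the centre \<open>z\<close>.\<close>

lemma partial_integral:
  fixes f :: "complex^'n \<Rightarrow> complex"
  assumes f: "\<And>w. w \<in> cball z r \<Longrightarrow> cdiff f w" and r: "0 < r"
  shows "partial k f z = integral (cbox 0 1) (\<lambda>t. f (z + circ r t *s axis k 1) / circ r t)"
proof -
  let ?g = "\<lambda>\<zeta>. f (z + \<zeta> *s axis k 1)"
  have nrm: "norm (\<zeta> *s axis k 1 :: complex^'n) = norm \<zeta>" for \<zeta> :: complex
    by (simp add: norm_smult_complex norm_complex_axis)
  have d: "(?g has_field_derivative frechet_derivative f (at (z + \<zeta> *s axis k 1)) (axis k 1)) (at \<zeta>)"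
    if "\<zeta> \<in> cball 0 r" for \<zeta>
    by (rule cdiff_line, rule f) (use that in \<open>simp add: dist_norm nrm\<close>)
  have "?g holomorphic_on cball 0 r"
    unfolding holomorphic_on_def using d field_differentiable_at_within field_differentiable_def by blast
  then have h: "continuous_on (cball 0 r) ?g" "?g holomorphic_on ball 0 r"
    using holomorphic_on_imp_continuous_on holomorphic_on_subset ball_subset_cball by blast+
  have "(?g has_field_derivative (1 / (2 * of_real pi * \<i>) *
      contour_integral (circlepath 0 r) (\<lambda>u. ?g u / (u - 0)^2))) (at 0)"
    by (rule Cauchy_derivative_integral_circlepath(2)[OF h]) (simp add: r)
  moreover have "(?g has_field_derivative partial k f z) (at 0)"
    using d[of 0] r by (simp add: partial_def)
  ultimately have "partial k f z = 1 / (2 * of_real pi * \<i>) *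
      contour_integral (circlepath 0 r) (\<lambda>u. ?g u / (u - 0)^2)"
    using DERIV_unique by blast
  also have "\<dots> = 1 / (2 * of_real pi * \<i>) * integral {0..1} (\<lambda>t. ?g (circ r t) / (circ r t)^2
       * (2 * of_real pi * \<i> * circ r t))"
    unfolding contour_integral_integral vector_derivative_circlepath
    by (simp add: circlepath mult_ac)
  also have "\<dots> = integral {0..1} (\<lambda>t. 1 / (2 * of_real pi * \<i>) * (?g (circ r t) / (circ r t)^2
       * (2 * of_real pi * \<i> * circ r t)))"
    by (rule integral_mult_right[symmetric])
  \<comment> \<open>The velocity of the circle is 2 pi i times its position, which cancels the
    constant and one of the two powers in the denominator.\<close>
  also have "(\<lambda>t. 1 / (2 * of_real pi * \<i>) * (?g (circ r t) / (circ r t)^2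
       * (2 * of_real pi * \<i> * circ r t))) = (\<lambda>t. ?g (circ r t) / circ r t)"
    using r by (auto simp: fun_eq_iff field_simps power2_eq_square)
  finally show ?thesis by simp
qed

lemma cdiff_continuous_on: "(\<And>w. w \<in> S \<Longrightarrow> cdiff f w) \<Longrightarrow> continuous_on S f"
  by (simp add: cdiff_isCont continuous_at_imp_continuous_on)

text \<open>Joint continuity in centre and angle, the hypothesis of the theorems on parameter
  integrals. It serves both for \<open>f\<close> and for its operator-valued derivative.\<close>

lemma continuous_on_shift:
  fixes f :: "complex^'n \<Rightarrow> 'b::topological_space"
  assumes "continuous_on S f" "\<And>x. x \<in> T \<Longrightarrow> cball x r \<subseteq> S" "0 < r"
  shows "continuous_on (T \<times> cbox 0 1) (\<lambda>(x, t). f (x + circ r t *s axis k 1))"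
proof -
  have b: "continuous_on UNIV (\<lambda>\<zeta>::complex. \<zeta> *s (axis k 1 :: complex^'n))"
    using has_derivative_continuous[OF has_derivative_line[of 0 "axis k 1 :: complex^'n"]]
    by (simp add: continuous_on_eq_continuous_at)
  have "continuous_on (T \<times> cbox 0 1) (\<lambda>p. fst p + circ r (snd p) *s (axis k 1 :: complex^'n))"
    by (intro continuous_intros continuous_on_compose2[OF b]) auto
  then have "continuous_on (T \<times> cbox 0 1) (\<lambda>p. f (fst p + circ r (snd p) *s axis k 1))"
    by (rule continuous_on_compose2[OF assms(1)])
      (use assms in \<open>force simp: dist_norm norm_circ_axis\<close>)
  then show ?thesis by (simp add: case_prod_beta')
qed

text \<open>Cauchy's integral with a locally fixed radius depends continuously on the centre. This
  gives the continuity of the derivative that the Leibniz rule demands in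
  \<open>cdiff_partial\<close>.\<close>

lemma partial_continuous_on:
  fixes f :: "complex^'n \<Rightarrow> complex"
  assumes S: "open S" and f: "\<And>w. w \<in> S \<Longrightarrow> cdiff f w"
  shows "continuous_on S (partial k f)"
proof -
  have "isCont (partial k f) z" if z: "z \<in> S" for z
  proof -
    obtain e where e: "e > 0" "cball z e \<subseteq> S" using S z open_contains_cball by blast
    let ?r = "e / 2" let ?T = "ball z (e/2)"
    \<comment> \<open>Circles of radius \<open>e / 2\<close> about centres within
      \<open>e / 2\<close> of \<open>z\<close> stay in \<open>cball z e\<close>, so one radius
      serves all nearby centres.\<close>
    have sub: "cball x ?r \<subseteq> S" if "x \<in> ?T" for x
      using that e by (smt (verit, best) cball_subset_cball_iff dist_commute field_sum_of_halves mem_ball subset_trans)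
    have "continuous_on ?T (\<lambda>x. integral (cbox 0 1) (\<lambda>t. f (x + circ ?r t *s axis k 1) / circ ?r t))"
    proof (rule integral_continuous_on_param)
      show "continuous_on (?T \<times> cbox 0 1) (\<lambda>(x, t). f (x + circ ?r t *s axis k 1) / circ ?r t)"
        using continuous_on_shift[OF cdiff_continuous_on[OF f], where T="?T" and r="?r" and k=k] sub e(1)
        unfolding case_prod_beta'
        by (intro continuous_on_divide) (auto intro!: continuous_intros)
    qed
    then have "continuous_on ?T (partial k f)"
    proof (rule continuous_on_cong[THEN iffD1, rotated -1, OF _ refl])
      fix x assume "x \<in> ?T"
      then show "integral (cbox 0 1) (\<lambda>t. f (x + circ ?r t *s axis k 1) / circ ?r t) = partial k f x"
        using partial_integral[of x ?r f k] f sub e(1) by (metis half_gt_zero subsetD)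
    qed
    moreover have "z \<in> ?T" using e(1) by simp
    ultimately show ?thesis using continuous_on_eq_continuous_at open_ball by blast
  qed
  then show ?thesis by (simp add: continuous_at_imp_continuous_on)
qed

lemma cdiff_partial_sum:
  assumes "cdiff f z" shows "frechet_derivative f (at z) v = (\<Sum>k\<in>UNIV. v $ k * partial k f z)"
proof -
  let ?L = "frechet_derivative f (at z)"
  have lin: "linear ?L"
    using cdiff_frechet(1)[OF assms] has_derivative_linear by blast
  have "v = (\<Sum>k\<in>UNIV. v $ k *s axis k 1)" by (simp add: vec_eq_iff axis_def if_distrib cong: if_cong)
  then have "?L v = ?L (\<Sum>k\<in>UNIV. v $ k *s axis k 1)" by simp
  also have "\<dots> = (\<Sum>k\<in>UNIV. ?L (v $ k *s axis k 1))" using lin by (simp add: linear_sum)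
  finally show ?thesis by (simp add: cdiff_frechet(2)[OF assms] partial_def)
qed

text \<open>The derivative as an operator-valued function, the form required by the Leibniz rule.
  Assembling it from the partial derivatives makes its continuity a consequence of theirs.\<close>

definition blin_partials :: "(complex^'n \<Rightarrow> complex) \<Rightarrow> complex^'n \<Rightarrow> (complex^'n) \<Rightarrow>\<^sub>L complex" where
  "blin_partials f z = (\<Sum>k\<in>UNIV. blinfun_mult_right (partial k f z) o\<^sub>L Blinfun (\<lambda>v. v $ k))"

lemma blin_partials_apply:
  assumes "cdiff f z" shows "blinfun_apply (blin_partials f z) = frechet_derivative f (at z)"
  unfolding blin_partials_def cdiff_partial_sum[OF assms, abs_def]
  by (simp add: fun_eq_iff blinfun.sum_left bounded_linear_Blinfun_apply bounded_linear_vec_nth mult.commute)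

lemma blin_partials_continuous_on:
  assumes "open S" "\<And>w. w \<in> S \<Longrightarrow> cdiff f w" shows "continuous_on S (blin_partials f)"
  unfolding blin_partials_def
  by (intro continuous_on_sum bounded_bilinear.continuous_on[OF bounded_bilinear_blinfun_compose]
      bounded_linear.continuous_on[OF bounded_linear_blinfun_mult_right]
      partial_continuous_on assms continuous_on_const)

text \<open>Differentiate Cauchy's integral under the integral sign. The derivative of the integral
  is complex linear because the derivative of the integrand is so at each angle.\<close>

lemma cdiff_partial:
  fixes f :: "complex^'n \<Rightarrow> complex"
  assumes S: "open S" and f: "\<And>w. w \<in> S \<Longrightarrow> cdiff f w" and z: "z \<in> S"
  shows "cdiff (partial k f) z"
proof -
  obtain e where e: "e > 0" "cball z e \<subseteq> S" using S z open_contains_cball by blast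
  let ?r = "e / 2" let ?T = "ball z (e/2)"
  have sub: "cball x ?r \<subseteq> S" if "x \<in> ?T" for x
    using that e by (smt (verit, best) cball_subset_cball_iff dist_commute field_sum_of_halves mem_ball subset_trans)
  have r: "?r > 0" using e by simp
  have inS: "x + circ ?r t *s axis k 1 \<in> S" if "x \<in> ?T" for x t
  proof -
    have "x + circ ?r t *s axis k 1 \<in> cball x ?r" 
      using r norm_circ_axis[of ?r t k] by (simp only: mem_cball dist_norm) (simp del: of_real_divide)
    then show ?thesis using sub[OF that] by blast
  qed
  define K where "K x t = f (x + circ ?r t *s axis k 1) / circ ?r t" for x t
  define K' where "K' x t = blinfun_mult_right (1 / circ ?r t) o\<^sub>L blin_partials f (x + circ ?r t *s axis k 1)" for x t
  have contc: "continuous_on X (\<lambda>p. 1 / circ ?r (snd p))" for X :: "('x::topological_space \<times> real) set"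
    using r by (auto intro!: continuous_intros)
  have contK': "continuous_on (?T \<times> cbox 0 1) (\<lambda>(x, t). K' x t)"
    unfolding K'_def case_prod_beta'
    using continuous_on_shift[OF blin_partials_continuous_on[OF S f] sub r, where k=k, unfolded case_prod_beta']
    by (intro bounded_bilinear.continuous_on[OF bounded_bilinear_blinfun_compose]
      bounded_linear.continuous_on[OF bounded_linear_blinfun_mult_right] contc)
  have contK: "continuous_on (?T \<times> cbox 0 1) (\<lambda>(x, t). K x t)"
    using continuous_on_shift[OF cdiff_continuous_on[OF f] sub r, where T="?T" and k=k] r
    unfolding K_def case_prod_beta' by (intro continuous_on_divide) (auto intro!: continuous_intros)
  have slice: "continuous_on (cbox 0 1) (h x)" if "continuous_on (?T \<times> cbox 0 1) (\<lambda>(x, t). h x t)" "x \<in> ?T"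
    for h :: "complex^'n \<Rightarrow> real \<Rightarrow> 'w::topological_space" and x
  proof -
    have "continuous_on (cbox 0 1) (\<lambda>t. case (x, t) of (x, t) \<Rightarrow> h x t)"
      by (rule continuous_on_compose2[OF that(1)]) (use that(2) in \<open>auto intro!: continuous_intros\<close>)
    then show ?thesis by simp
  qed
  have zT: "z \<in> ?T" using r by simp
  have "((\<lambda>x. integral (cbox 0 1) (K x)) has_derivative integral (cbox 0 1) (K' z)) (at z within ?T)"
  proof (rule leibniz_rule[where fx = K'])
    fix x t assume x: "x \<in> ?T"
    have c: "cdiff f (x + circ ?r t *s axis k 1)" using f inS[OF x] by blast
    have "((\<lambda>x. f (x + circ ?r t *s axis k 1)) has_derivative
       frechet_derivative f (at (x + circ ?r t *s axis k 1))) (at x)"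
      by (rule has_derivative_compose[where f="\<lambda>x. x + circ ?r t *s axis k 1" and f'="\<lambda>x. x", OF _ cdiff_frechet(1)[OF c]])
        (auto intro!: derivative_eq_intros)
    then have "((\<lambda>x. 1 / circ ?r t * f (x + circ ?r t *s axis k 1)) has_derivative
       (\<lambda>v. 1 / circ ?r t * frechet_derivative f (at (x + circ ?r t *s axis k 1)) v)) (at x)"
      by (rule has_derivative_mult_right)
    moreover have "(\<lambda>x. K x t) = (\<lambda>x. 1 / circ ?r t * f (x + circ ?r t *s axis k 1))"
      unfolding K_def by (rule ext) (simp only: times_divide_eq_left mult_1_left)
    moreover have "blinfun_apply (K' x t) =
        (\<lambda>v. 1 / circ ?r t * frechet_derivative f (at (x + circ ?r t *s axis k 1)) v)"
      by (rule ext) (simp only: K'_def blinfun_apply_blinfun_compose blinfun_mult_right.rep_eq blin_partials_apply[OF c])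
    ultimately have "((\<lambda>x. K x t) has_derivative blinfun_apply (K' x t)) (at x)" by simp
    from this show "((\<lambda>x. K x t) has_derivative blinfun_apply (K' x t)) (at x within ?T)"
      by (rule has_derivative_at_withinI)
  next
    fix x assume "x \<in> ?T"
    then show "K x integrable_on cbox 0 1" by (intro integrable_continuous slice contK)
  qed (use contK' zT in auto)
  then have D: "((\<lambda>x. integral (cbox 0 1) (K x)) has_derivative integral (cbox 0 1) (K' z)) (at z)"
    using zT at_within_open[OF _ open_ball] by metis
  have K'i: "K' z integrable_on cbox 0 1" by (intro integrable_continuous slice contK' zT)
  have ev: "blinfun_apply (integral (cbox 0 1) (K' z)) v = integral (cbox 0 1) (\<lambda>t. blinfun_apply (K' z t) v)" for v
    using integral_linear[OF K'i blinfun.bounded_linear_left[of v]] by (simp add: o_def)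
  have "blinfun_apply (integral (cbox 0 1) (K' z)) (c *s v) = c * blinfun_apply (integral (cbox 0 1) (K' z)) v" for c v
  proof -
    have "blinfun_apply (K' z t) (c *s v) = c * blinfun_apply (K' z t) v" for t
      unfolding K'_def using blin_partials_apply[OF f[OF inS[OF zT]]] cdiff_frechet(2)[OF f[OF inS[OF zT]]] by simp
    then show ?thesis unfolding ev by (simp add: integral_mult_right)
  qed
  with D have "cdiff (\<lambda>x. integral (cbox 0 1) (K x)) z" unfolding cdiff_def by blast
  then show ?thesis
  proof (rule cdiff_cong_open[OF _ open_ball zT])
    fix x assume "x \<in> ?T"
    then show "integral (cbox 0 1) (K x) = partial k f x"
      using partial_integral[of x ?r f k] f sub r unfolding K_def by (metis subsetD)
  qed
qed

lemma jac_partial: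
  assumes "cdiffv f z" shows "jac f z = det (\<chi> i j. partial j (\<lambda>w. f w $ i) z)"
proof -
  have "frechet_derivative f (at z) v $ i = frechet_derivative (\<lambda>w. f w $ i) (at z) v" for i v
  proof -
    have "((\<lambda>w. f w $ i) has_derivative (\<lambda>v. frechet_derivative f (at z) v $ i)) (at z)"
      by (rule bounded_linear.has_derivative[OF bounded_linear_vec_nth cdiffv_frechet(1)[OF assms]])
    from frechet_derivative_at[OF this] show ?thesis by metis
  qed
  then show ?thesis unfolding jac_def partial_def by (simp add: matrix_def)
qed

text \<open>The determinant is a polynomial in the partial derivatives of the components. This makes
  the transition functions of the canonical bundle holomorphic.\<close>

lemma cdiff_jac:
  assumes S: "open S" and f: "\<And>w. w \<in> S \<Longrightarrow> cdiffv f w" and z: "z \<in> S"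
  shows "cdiff (jac f) z"
proof -
  have "cdiff (\<lambda>z. det (\<chi> i j. partial j (\<lambda>w. f w $ i) z)) z"
    unfolding det_def
    by (intro cdiff_sum cdiff_mult cdiff_const cdiff_prod, simp, rule cdiff_partial[OF S _ z])
      (use f in \<open>simp add: cdiffv_iff\<close>)
  then show ?thesis
    by (rule cdiff_cong_open[OF _ S z]) (simp add: jac_partial f)
qed

text \<open>Once \<open>f\<close> is known to be differentiable, its Jacobian can be computed from
  one-variable derivatives along the coordinate axes.\<close>

lemma jac_eqI:
  assumes "\<And>i j. ((\<lambda>\<zeta>. f (z + \<zeta> *s axis j 1) $ i) has_field_derivative M $ i $ j) (at 0)" "cdiffv f z"
  shows "jac f z = det M"
proof -
  have "partial j (\<lambda>w. f w $ i) z = M $ i $ j" for i j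
  proof -
    have "cdiff (\<lambda>w. f w $ i) (z + 0 *s axis j 1)" using assms(2) by (simp add: cdiffv_iff)
    from cdiff_line[OF this] show ?thesis
      unfolding partial_def using DERIV_unique[OF _ assms(1)] by simp
  qed
  then show ?thesis by (simp add: jac_partial[OF assms(2)])
qed

section \<open>Jacobians of monomial maps, and the maximum principle\<close>

lemma of_int_det: "det (\<chi> i j. of_int (M $ i $ j)) = (of_int (det M) :: 'a::comm_ring_1)"
  by (simp add: det_def)

lemma monomial_map_cdiffv:
  assumes "t \<in> torus" shows "cdiffv (monomial_map lam A) t"
  unfolding cdiffv_iff monomial_map_def using assms
  by (auto simp: torus_def intro!: cdiff_mult cdiff_const cdiff_prod cdiff_powi cdiff_nth)

lemma det_scale_rows_columns:
  fixes M :: "'a::field^'n^'n"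
  shows "det (\<chi> i j. u i * M $ i $ j * v j) = (\<Prod>i\<in>UNIV. u i) * det M * (\<Prod>j\<in>UNIV. v j)"
proof -
  have "det (\<chi> i j. u i * M $ i $ j * v j) = (\<Prod>i\<in>UNIV. u i) * det (\<chi> i j. M $ i $ j * v j)"
    using det_rows_mul[of u "\<lambda>i. \<chi> j. M $ i $ j * v j"]
    by (simp add: vector_scalar_mult_def mult.assoc)
  also have "det (\<chi> i j. M $ i $ j * v j) = det (transpose (\<chi> i j. M $ i $ j * v j))" by simp
  also have "\<dots> = det (\<chi> i. v i *s (transpose M $ i))"
    by (simp add: transpose_def vector_scalar_mult_def mult.commute)
  also have "\<dots> = (\<Prod>j\<in>UNIV. v j) * det (\<chi> i. transpose M $ i)" by (rule det_rows_mul)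
  finally show ?thesis by (simp add: mult_ac)
qed

text \<open>The logarithmic derivative of the i-th component with respect to the j-th variable is
  the exponent \<open>A $ i $ j\<close>. So the Jacobian matrix is \<open>A\<close> with rows scaled
  by the components of the map and columns by the inverse coordinates. In terms of forms: the map
  pulls the logarithmic volume form back to \<open>det A\<close> times itself.\<close>

lemma monomial_map_jac:
  assumes t: "t \<in> torus"
  shows "jac (monomial_map lam A) t =
    of_int (det A) * (\<Prod>j\<in>UNIV. monomial_map lam A t $ j) / (\<Prod>k\<in>UNIV. t $ k)"
proof -
  have nz: "t $ k \<noteq> 0" for k using t by (simp add: torus_def)
  have "jac (monomial_map lam A) t = det (\<chi> i j. monomial_map lam A t $ i * (\<chi> i j. of_int (A $ i $ j)) $ i $ j * inverse (t $ j))"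
  proof (rule jac_eqI[OF _ monomial_map_cdiffv[OF t]])
    fix i j
    let ?R = "\<Prod>k\<in>UNIV-{j}. t $ k powi A $ i $ k"
    \<comment> \<open>Along the j-th axis only the factor with exponent \<open>A $ i $ j\<close>
      varies.\<close>
    have e: "monomial_map lam A (t + \<zeta> *s axis j 1) $ i = lam $ i * (?R * (t $ j + \<zeta>) powi A $ i $ j)" for \<zeta>
    proof -
      have "(\<Prod>k\<in>UNIV. (t + \<zeta> *s axis j 1) $ k powi A $ i $ k) =
        (t $ j + \<zeta>) powi A $ i $ j * (\<Prod>k\<in>UNIV-{j}. (t + \<zeta> *s axis j 1) $ k powi A $ i $ k)"
        by (subst prod.remove[of _ j]) (auto simp: axis_def)
      also have "(\<Prod>k\<in>UNIV-{j}. (t + \<zeta> *s axis j 1) $ k powi A $ i $ k) = ?R"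
        by (rule prod.cong) (auto simp: axis_def)
      finally show ?thesis by (simp add: monomial_map_def)
    qed
    have "((\<lambda>\<zeta>. lam $ i * (?R * (t $ j + \<zeta>) powi A $ i $ j)) has_field_derivative
        lam $ i * (?R * (of_int (A $ i $ j) * t $ j powi (A $ i $ j - 1)))) (at 0)"
      using nz[of j] by (auto intro!: derivative_eq_intros)
    moreover have "lam $ i * (?R * (of_int (A $ i $ j) * t $ j powi (A $ i $ j - 1))) =
       monomial_map lam A t $ i * of_int (A $ i $ j) * inverse (t $ j)"
      using e[of 0] nz[of j] by (simp add: power_int_diff field_simps)
    ultimately show "((\<lambda>\<zeta>. monomial_map lam A (t + \<zeta> *s axis j 1) $ i) has_field_derivative
        (\<chi> i j. monomial_map lam A t $ i * (\<chi> i j. of_int (A $ i $ j)) $ i $ j * inverse (t $ j)) $ i $ j) (at 0)"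
      unfolding e by simp
  qed
  also have "\<dots> = (\<Prod>i\<in>UNIV. monomial_map lam A t $ i) * of_int (det A) * (\<Prod>j\<in>UNIV. inverse (t $ j))"
    unfolding det_scale_rows_columns of_int_det ..
  also have "(\<Prod>j\<in>UNIV. inverse (t $ j)) = inverse (\<Prod>k\<in>UNIV. t $ k)"
    using prod_inversef[of "\<lambda>j. t $ j" UNIV] by (simp add: o_def)
  finally show ?thesis by (simp add: divide_inverse mult_ac)
qed

text \<open>Apply the one-variable principle on the complex line through \<open>z\<close> and
  \<open>w\<close>, with parameter 0 at \<open>z\<close> and 1 at \<open>w\<close>.\<close>

lemma cdiff_max_modulus:
  fixes g :: "complex^'n \<Rightarrow> complex"
  assumes g: "\<And>w. w \<in> ball z r \<Longrightarrow> cdiff g w" and m: "\<And>w. w \<in> ball z r \<Longrightarrow> norm (g w) \<le> norm (g z)"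
    and w: "w \<in> ball z r"
  shows "g w = g z"
proof (cases "w = z")
  case False
  define v where "v = w - z"
  have v: "0 < norm v" "norm v < r" using False w by (auto simp: v_def dist_norm norm_minus_commute)
  \<comment> \<open>The parameters whose points lie in the ball form the disc of this radius; as it
    exceeds 1, the disc contains the parameter of \<open>w\<close>.\<close>
  let ?R = "r / norm v"
  have R: "?R > 1" using v by simp
  have i: "z + \<zeta> *s v \<in> ball z r" if "\<zeta> \<in> ball 0 ?R" for \<zeta>
    using that v by (simp add: dist_norm norm_smult_complex field_simps)
  have "(\<lambda>\<zeta>. g (z + \<zeta> *s v)) holomorphic_on ball 0 ?R"
    unfolding holomorphic_on_def using cdiff_line[OF g[OF i]]
    using field_differentiable_at_within field_differentiable_def by blast
  then have "(\<lambda>\<zeta>. g (z + \<zeta> *s v)) constant_on ball 0 ?R"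
    by (rule maximum_modulus_principle[where U="ball 0 ?R" and \<xi>=0]) (use R m[OF i] in auto)
  then obtain c where "\<And>\<zeta>. \<zeta> \<in> ball 0 ?R \<Longrightarrow> g (z + \<zeta> *s v) = c" unfolding constant_on_def by blast
  from this[of 0] this[of 1] show ?thesis using R by (simp add: v_def)
qed simp

section \<open>Atlases and holomorphic functions on manifolds\<close>

text \<open>The chart clauses of \<open>complex_manifold\<close>. All local arguments live on this
  level, and this is what is established for toric varieties, for the cover and for the glued
  quotient.\<close>

definition atlas :: "('a, 'n::finite) cmanifold \<Rightarrow> bool" where
  "atlas M \<longleftrightarrow> carrier M = (\<Union>(U,\<phi>)\<in>charts M. U) \<and>
     (\<forall>(U,\<phi>)\<in>charts M. openin (mtop M) U \<and> open (\<phi> ` U) \<and>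
        homeomorphic_map (subtopology (mtop M) U) (top_of_set (\<phi> ` U)) \<phi>) \<and>
     (\<forall>(U,\<phi>)\<in>charts M. \<forall>(V,\<psi>)\<in>charts M.
        holo_map_on (\<psi> \<circ> inv_into U \<phi>) (\<phi> ` (U \<inter> V)))"

lemma complex_manifold_atlas: "complex_manifold M \<Longrightarrow> atlas M"
  unfolding complex_manifold_def atlas_def by blast

text \<open>Replaces the homeomorphism of subspaces by injectivity and a comparison of open sets in
  the ambient space, the form in which charts are verified and used.\<close>

lemma chart_homeo_iff:
  assumes "openin X U" "open (\<phi> ` U)"
  shows "homeomorphic_map (subtopology X U) (top_of_set (\<phi> ` U)) \<phi> \<longleftrightarrow>
    inj_on \<phi> U \<and> (\<forall>V. V \<subseteq> U \<longrightarrow> openin X V = open (\<phi> ` V))"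
proof
  assume h: "homeomorphic_map (subtopology X U) (top_of_set (\<phi> ` U)) \<phi>"
  have U: "topspace (subtopology X U) = U" using openin_subset[OF assms(1)] by auto
  have "inj_on \<phi> U" using homeomorphic_imp_injective_map[OF h] U by simp
  moreover have "openin X V = open (\<phi> ` V)" if "V \<subseteq> U" for V
  proof -
    have "openin (top_of_set (\<phi> ` U)) (\<phi> ` V) = openin (subtopology X U) V"
      by (rule homeomorphic_map_openness[OF h]) (simp only: U that)
    then show ?thesis
      using assms that by (auto simp: openin_open_subtopology openin_open_eq image_mono)
  qed
  ultimately show "inj_on \<phi> U \<and> (\<forall>V. V \<subseteq> U \<longrightarrow> openin X V = open (\<phi> ` V))" by blast
next
  assume h: "inj_on \<phi> U \<and> (\<forall>V. V \<subseteq> U \<longrightarrow> openin X V = open (\<phi> ` V))"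
  have U: "topspace (subtopology X U) = U" using openin_subset[OF assms(1)] by auto
  have "openin (subtopology X U) {x \<in> U. \<phi> x \<in> W}" if "openin (top_of_set (\<phi> ` U)) W" for W
  proof -
    have "\<phi> ` {x \<in> U. \<phi> x \<in> W} = W" using openin_subset[OF that] by auto
    moreover have "open W" using that assms(2) by (simp add: openin_open_eq)
    ultimately have "openin X {x \<in> U. \<phi> x \<in> W}" using h by (metis (no_types, lifting) mem_Collect_eq subsetI)
    then show ?thesis using assms(1) by (auto simp: openin_open_subtopology)
  qed
  then have "continuous_map (subtopology X U) (top_of_set (\<phi> ` U)) \<phi>"
    unfolding continuous_map using U by simp
  moreover have "open_map (subtopology X U) (top_of_set (\<phi> ` U)) \<phi>"
    unfolding open_map_def using h assms
    by (auto simp: openin_open_subtopology openin_open_eq image_mono)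
  ultimately show "homeomorphic_map (subtopology X U) (top_of_set (\<phi> ` U)) \<phi>"
    using h U by (intro bijective_open_imp_homeomorphic_map) auto
qed

lemma atlasD:
  assumes "atlas M"
  shows "x \<in> carrier M \<Longrightarrow> \<exists>(U, \<phi>)\<in>charts M. x \<in> U"
    and "(U, \<phi>) \<in> charts M \<Longrightarrow> openin (mtop M) U"
    and "(U, \<phi>) \<in> charts M \<Longrightarrow> open (\<phi> ` U)"
    and "(U, \<phi>) \<in> charts M \<Longrightarrow> inj_on \<phi> U"
    and "(U, \<phi>) \<in> charts M \<Longrightarrow> W \<subseteq> U \<Longrightarrow> openin (mtop M) W = open (\<phi> ` W)"
    and "(U, \<phi>) \<in> charts M \<Longrightarrow> (V, \<psi>) \<in> charts M \<Longrightarrow> x \<in> U \<Longrightarrow> x \<in> V \<Longrightarrow>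
      cdiffv (\<psi> \<circ> inv_into U \<phi>) (\<phi> x)"
proof -
  show "x \<in> carrier M \<Longrightarrow> \<exists>(U, \<phi>)\<in>charts M. x \<in> U"
    using assms unfolding atlas_def by (elim conjE) (simp, blast)
  assume c: "(U, \<phi>) \<in> charts M"
  then have h: "openin (mtop M) U" "open (\<phi> ` U)"
     "homeomorphic_map (subtopology (mtop M) U) (top_of_set (\<phi> ` U)) \<phi>"
    using assms unfolding atlas_def by blast+
  then show "openin (mtop M) U" "open (\<phi> ` U)" by blast+
  show "inj_on \<phi> U" "W \<subseteq> U \<Longrightarrow> openin (mtop M) W = open (\<phi> ` W)"
    using chart_homeo_iff[OF h(1,2)] h(3) by blast+
  show "cdiffv (\<psi> \<circ> inv_into U \<phi>) (\<phi> x)" if "(V, \<psi>) \<in> charts M" "x \<in> U" "x \<in> V"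
    using that c assms unfolding atlas_def holo_map_on_cdiffv by blast
qed

lemma atlasI:
  assumes "carrier M = (\<Union>(U,\<phi>)\<in>charts M. U)"
    and "\<And>U \<phi>. (U, \<phi>) \<in> charts M \<Longrightarrow> openin (mtop M) U \<and> open (\<phi> ` U) \<and> inj_on \<phi> U"
    and "\<And>U \<phi> W. (U, \<phi>) \<in> charts M \<Longrightarrow> W \<subseteq> U \<Longrightarrow> openin (mtop M) W = open (\<phi> ` W)"
    and "\<And>U \<phi> V \<psi> x. (U, \<phi>) \<in> charts M \<Longrightarrow> (V, \<psi>) \<in> charts M \<Longrightarrow> x \<in> U \<Longrightarrow> x \<in> V \<Longrightarrow>
      cdiffv (\<psi> \<circ> inv_into U \<phi>) (\<phi> x)"
  shows "atlas M"
  unfolding atlas_def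
proof (intro conjI)
  show "\<forall>(U, \<phi>)\<in>charts M. openin (mtop M) U \<and> open (\<phi> ` U) \<and>
      homeomorphic_map (subtopology (mtop M) U) (top_of_set (\<phi> ` U)) \<phi>"
  proof clarify
    fix U \<phi> assume c: "(U, \<phi>) \<in> charts M"
    show "openin (mtop M) U \<and> open (\<phi> ` U) \<and>
      homeomorphic_map (subtopology (mtop M) U) (top_of_set (\<phi> ` U)) \<phi>"
      using assms(2,3)[OF c] chart_homeo_iff[of "mtop M" U \<phi>] by blast
  qed
  show "\<forall>(U, \<phi>)\<in>charts M. \<forall>(V, \<psi>)\<in>charts M. holo_map_on (\<psi> \<circ> inv_into U \<phi>) (\<phi> ` (U \<inter> V))"
    unfolding holo_map_on_cdiffv using assms(4) by (intro ballI case_prodI2 allI impI) auto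
qed (rule assms(1))

text \<open>Pointwise counterpart of \<open>holo_fun\<close>: rules of calculus and changes of chart
  act at one point, and openness of the domain joins only in \<open>holo_fun_iff\<close>.\<close>

definition holo_at :: "('a, 'n::finite) cmanifold \<Rightarrow> ('a \<Rightarrow> complex) \<Rightarrow> 'a \<Rightarrow> bool" where
  "holo_at M f x \<longleftrightarrow> (\<forall>(U, \<phi>)\<in>charts M. x \<in> U \<longrightarrow> cdiff (f \<circ> inv_into U \<phi>) (\<phi> x))"

definition hmap_at ::
  "('a, 'n::finite) cmanifold \<Rightarrow> ('b, 'm::finite) cmanifold \<Rightarrow> ('a \<Rightarrow> 'b) \<Rightarrow> 'a \<Rightarrow> bool" where
  "hmap_at M N f x \<longleftrightarrow> (\<forall>(U, \<phi>)\<in>charts M. \<forall>(V, \<psi>)\<in>charts N. x \<in> U \<longrightarrow> f x \<in> V \<longrightarrow>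
     cdiffv (\<psi> \<circ> f \<circ> inv_into U \<phi>) (\<phi> x))"

lemma holo_fun_iff: "holo_fun M U f \<longleftrightarrow> openin (mtop M) U \<and> (\<forall>x\<in>U. holo_at M f x)"
  unfolding holo_fun_def holo_at_def holo_fun_on_cdiff by fast

lemma holo_map_hmap_at:
  "holo_map M N f \<longleftrightarrow> continuous_map (mtop M) (mtop N) f \<and> (\<forall>x. hmap_at M N f x)"
  unfolding holo_map_def hmap_at_def holo_map_on_cdiffv by fast

lemma atlas_chart:
  assumes "atlas M" "x \<in> carrier M"
  obtains U \<phi> where "(U, \<phi>) \<in> charts M" "x \<in> U"
  using atlasD(1)[OF assms] by (auto split: prod.splits)

text \<open>One chart decides, because transition maps are holomorphic.\<close>

lemma holo_at_chart:
  assumes M: "atlas M" and c: "(U, \<phi>) \<in> charts M" "x \<in> U" and d: "cdiff (f \<circ> inv_into U \<phi>) (\<phi> x)"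
  shows "holo_at M f x"
  unfolding holo_at_def
proof clarify
  fix V \<psi> assume V: "(V, \<psi>) \<in> charts M" "x \<in> V"
  have i: "inj_on \<phi> U" "inj_on \<psi> V" using atlasD(4)[OF M] c V by blast+
  have t: "cdiffv (\<phi> \<circ> inv_into V \<psi>) (\<psi> x)" using atlasD(6)[OF M V(1) c(1)] c V by blast
  have "(\<phi> \<circ> inv_into V \<psi>) (\<psi> x) = \<phi> x" using i V by simp
  then have "cdiff (\<lambda>w. (f \<circ> inv_into U \<phi>) ((\<phi> \<circ> inv_into V \<psi>) w)) (\<psi> x)"
    by (intro cdiff_compose[OF t]) (simp only: d)
  moreover have "open (\<psi> ` (U \<inter> V))"
    using atlasD(5)[OF M V(1), of "U \<inter> V"] atlasD(2)[OF M] c V by blast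
  ultimately show "cdiff (f \<circ> inv_into V \<psi>) (\<psi> x)"
    by (rule cdiff_cong_open) (use c V i in auto)
qed

lemma holo_atD: "holo_at M f x \<Longrightarrow> (U, \<phi>) \<in> charts M \<Longrightarrow> x \<in> U \<Longrightarrow> cdiff (f \<circ> inv_into U \<phi>) (\<phi> x)"
  unfolding holo_at_def by fast

lemma holo_at_const: "holo_at M (\<lambda>_. c) x"
  unfolding holo_at_def o_def by simp

lemma holo_at_mult: "holo_at M f x \<Longrightarrow> holo_at M g x \<Longrightarrow> holo_at M (\<lambda>x. f x * g x) x"
  unfolding holo_at_def o_def by (fast intro: cdiff_mult)

lemma holo_at_power: "holo_at M f x \<Longrightarrow> holo_at M (\<lambda>x. f x ^ k) x"
  unfolding holo_at_def o_def by (fast intro: cdiff_power)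

lemma holo_at_prod: "(\<And>i. i \<in> I \<Longrightarrow> holo_at M (f i) x) \<Longrightarrow> holo_at M (\<lambda>x. \<Prod>i\<in>I. f i x) x"
  by (induction I rule: infinite_finite_induct) (auto intro: holo_at_const holo_at_mult)

lemma holo_at_inverse: "atlas M \<Longrightarrow> holo_at M f x \<Longrightarrow> f x \<noteq> 0 \<Longrightarrow> holo_at M (\<lambda>x. inverse (f x)) x"
  unfolding holo_at_def
proof clarify
  fix U \<phi> assume M: "atlas M" "f x \<noteq> 0" and f: "\<forall>(U, \<phi>)\<in>charts M. x \<in> U \<longrightarrow> cdiff (f \<circ> inv_into U \<phi>) (\<phi> x)"
    and c: "(U, \<phi>) \<in> charts M" "x \<in> U"
  have "inj_on \<phi> U" using atlasD(4)[OF M(1) c(1)] .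
  then have nz: "(f \<circ> inv_into U \<phi>) (\<phi> x) \<noteq> 0" using M c by simp
  have "cdiff (f \<circ> inv_into U \<phi>) (\<phi> x)" using f c by blast
  from cdiff_inverse[OF this nz]
  show "cdiff ((\<lambda>x. inverse (f x)) \<circ> inv_into U \<phi>) (\<phi> x)" by (simp add: o_def)
qed

lemma holo_at_cong:
  assumes M: "atlas M" and f: "holo_at M f x" and N: "openin (mtop M) N" "x \<in> N" "\<And>y. y \<in> N \<Longrightarrow> f y = g y"
  shows "holo_at M g x"
  unfolding holo_at_def
proof clarify
  fix U \<phi> assume c: "(U, \<phi>) \<in> charts M" "x \<in> U"
  have i: "inj_on \<phi> U" using atlasD(4)[OF M c(1)] .
  have o: "open (\<phi> ` (U \<inter> N))"
    using atlasD(5)[OF M c(1), of "U \<inter> N"] atlasD(2)[OF M c(1)] N by blast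
  show "cdiff (g \<circ> inv_into U \<phi>) (\<phi> x)"
    by (rule cdiff_cong_open[OF holo_atD[OF f c] o]) (use c N i in auto)
qed

lemma holo_fun_subset: "holo_fun M U f \<Longrightarrow> openin (mtop M) V \<Longrightarrow> V \<subseteq> U \<Longrightarrow> holo_fun M V f"
  unfolding holo_fun_iff by blast

lemma holo_fun_preimage:
  assumes M: "atlas M" and f: "holo_fun M U f" and S: "open S"
  shows "openin (mtop M) {x\<in>U. f x \<in> S}"
proof (subst openin_subopen, clarify)
  fix x assume x: "x \<in> U" "f x \<in> S"
  have oU: "openin (mtop M) U" using f by (simp add: holo_fun_iff)
  then obtain V \<phi> where c: "(V, \<phi>) \<in> charts M" "x \<in> V"
    using atlas_chart[OF M, of x] openin_subset[OF oU] x by blast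
  have i: "inj_on \<phi> V" using atlasD(4)[OF M c(1)] .
  have o: "open (\<phi> ` (U \<inter> V))"
    using atlasD(5)[OF M c(1), of "U \<inter> V"] atlasD(2)[OF M c(1)] oU by blast
  have "continuous_on (\<phi> ` (U \<inter> V)) (f \<circ> inv_into V \<phi>)"
    by (rule cdiff_continuous_on) (use f c in \<open>auto simp: holo_fun_iff intro: holo_atD\<close>)
  then have "open ((f \<circ> inv_into V \<phi>) -` S \<inter> \<phi> ` (U \<inter> V))"
    using continuous_open_preimage[OF _ o S] by (subst Int_commute)
  moreover have "(f \<circ> inv_into V \<phi>) -` S \<inter> \<phi> ` (U \<inter> V) = \<phi> ` {x\<in>U \<inter> V. f x \<in> S}"
    using i by (auto simp: image_iff)
  ultimately have "openin (mtop M) {x\<in>U \<inter> V. f x \<in> S}"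
    using atlasD(5)[OF M c(1), of "{x\<in>U \<inter> V. f x \<in> S}"] by auto
  then show "\<exists>T. openin (mtop M) T \<and> x \<in> T \<and> T \<subseteq> {x \<in> U. f x \<in> S}"
    using x c by (intro exI[of _ "{x\<in>U \<inter> V. f x \<in> S}"]) auto
qed

lemma holo_fun_neq:
  assumes M: "atlas M" and f: "holo_fun M U f" and g: "holo_fun M U g"
  shows "openin (mtop M) {x\<in>U. f x \<noteq> g x}"
proof -
  have "holo_fun M U (\<lambda>x. f x + (-1) * g x)"
    using f g unfolding holo_fun_iff holo_at_def o_def
    by (fast intro: cdiff_add cdiff_mult cdiff_const)
  moreover have "open (- {0::complex})" by (simp add: open_Compl)
  ultimately have "openin (mtop M) {x\<in>U. f x + (-1) * g x \<in> - {0}}" by (rule holo_fun_preimage[OF M])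
  then show ?thesis by simp
qed

text \<open>The set where \<open>f\<close> and \<open>g\<close> differ is open. This is the identity
  principle of the whole proof, with density in the place of connectedness.\<close>

lemma holo_fun_eq_dense:
  assumes M: "atlas M" and f: "holo_fun M U f" and g: "holo_fun M U g"
    and eq: "\<And>V. openin (mtop M) V \<Longrightarrow> V \<subseteq> U \<Longrightarrow> V \<noteq> {} \<Longrightarrow> \<exists>x\<in>V. f x = g x" and x: "x \<in> U"
  shows "f x = g x"
proof (rule ccontr)
  assume "f x \<noteq> g x"
  then have "\<exists>y\<in>{x\<in>U. f x \<noteq> g x}. f y = g y"
    by (intro eq[OF holo_fun_neq[OF M f g]]) (use x in auto)
  then show False by blast
qed

lemma regular_fun_subset:
  "regular_fun M U f \<Longrightarrow> openin (mtop M) V \<Longrightarrow> V \<subseteq> U \<Longrightarrow> regular_fun M V f"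
  unfolding regular_fun_def using holo_fun_subset by (metis (no_types, lifting) subset_trans)

lemma regular_fun_mult:
  assumes M: "atlas M" and f: "regular_fun M U f" and g: "regular_fun M U g"
  shows "regular_fun M U (\<lambda>x. f x * g x)"
  unfolding regular_fun_def
proof (intro conjI allI impI)
  have hf: "holo_fun M U f" and hg: "holo_fun M U g" using f g by (auto simp: regular_fun_def)
  then show "holo_fun M U (\<lambda>x. f x * g x)" by (auto simp: holo_fun_iff holo_at_mult)
  fix V assume V: "openin (mtop M) V \<and> V \<subseteq> U \<and> V \<noteq> {}"
  let ?W = "{x\<in>V. f x \<noteq> 0}"
  have "open (- {0::complex})" by (simp add: open_Compl)
  then have "openin (mtop M) ?W"
    using holo_fun_preimage[OF M holo_fun_subset[OF hf], of V "-{0}"] V by simp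
  moreover have "?W \<noteq> {}" using f V unfolding regular_fun_def by fast
  ultimately have "\<exists>x\<in>?W. g x \<noteq> 0" using g V unfolding regular_fun_def by (metis (no_types, lifting) mem_Collect_eq subset_eq)
  then show "\<exists>x\<in>V. f x * g x \<noteq> 0" by auto
qed

text \<open>The nonzero locus of a regular function is dense, so it can be cancelled there and the
  identity extends by continuity.\<close>

lemma regular_fun_cancel:
  assumes M: "atlas M" and f: "regular_fun M U f" and a: "holo_fun M U a" and b: "holo_fun M U b"
    and eq: "\<And>x. x \<in> U \<Longrightarrow> a x * f x = b x * f x" and x: "x \<in> U"
  shows "a x = b x"
proof (rule holo_fun_eq_dense[OF M a b _ x])
  fix V assume "openin (mtop M) V" "V \<subseteq> U" "V \<noteq> {}"
  then obtain y where "y \<in> V" "f y \<noteq> 0" using f unfolding regular_fun_def by blast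
  then show "\<exists>x\<in>V. a x = b x" using eq[of y] \<open>V \<subseteq> U\<close> by auto
qed

text \<open>The local quotients of \<open>w\<close> by \<open>f\<close> are unique since
  \<open>f\<close> can be cancelled; so they agree on overlaps and form one unit.\<close>

lemma unit_fun_glue:
  assumes M: "atlas M" and f: "regular_fun M W f"
    and loc: "\<And>x. x \<in> W \<Longrightarrow> \<exists>N u. openin (mtop M) N \<and> x \<in> N \<and> N \<subseteq> W \<and> unit_fun M N u \<and> (\<forall>y\<in>N. u y * f y = w y)"
  shows "\<exists>u. unit_fun M W u \<and> (\<forall>y\<in>W. u y * f y = w y)"
proof -
  obtain N u where N: "\<And>x. x \<in> W \<Longrightarrow> openin (mtop M) (N x) \<and> x \<in> N x \<and> N x \<subseteq> W \<and>
      unit_fun M (N x) (u x) \<and> (\<forall>y\<in>N x. u x y * f y = w y)"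
    using loc by metis
  \<comment> \<open>Agreement is stated with the quotient chosen at the point \<open>y\<close>
    itself, since the glued function is the diagonal \<open>u y y\<close>.\<close>
  have eq: "u x y = u y y" if x: "x \<in> W" and y: "y \<in> N x" for x y
  proof -
    have yW: "y \<in> W" using N[OF x] y by blast
    let ?I = "N x \<inter> N y"
    have I: "openin (mtop M) ?I" "?I \<subseteq> W" using N[OF x] N[OF yW] by auto
    show ?thesis
    proof (rule regular_fun_cancel[OF M regular_fun_subset[OF f I], where a="u x" and b="u y"])
      show "holo_fun M ?I (u x)" "holo_fun M ?I (u y)"
        using N[OF x] N[OF yW] I holo_fun_subset unfolding unit_fun_def by blast+
    qed (use N[OF x] N[OF yW] y in auto)
  qed
  have "holo_fun M W (\<lambda>x. u x x)" unfolding holo_fun_iff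
  proof (intro conjI ballI)
    show "openin (mtop M) W" using f by (simp add: regular_fun_def holo_fun_iff)
    fix x assume x: "x \<in> W"
    show "holo_at M (\<lambda>x. u x x) x"
      by (rule holo_at_cong[OF M, of "u x" x "N x"]) (use N[OF x] eq[OF x] in \<open>auto simp: unit_fun_def holo_fun_iff\<close>)
  qed
  moreover have "u x x \<noteq> 0" if "x \<in> W" for x using N[OF that] by (auto simp: unit_fun_def)
  ultimately have "unit_fun M W (\<lambda>x. u x x) \<and> (\<forall>y\<in>W. u y y * f y = w y)"
    using N by (auto simp: unit_fun_def)
  then show ?thesis by blast
qed

lemma unit_fun_mult: "unit_fun M U f \<Longrightarrow> unit_fun M U g \<Longrightarrow> unit_fun M U (\<lambda>x. f x * g x)"
  by (auto simp: unit_fun_def holo_fun_iff holo_at_mult)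

lemma unit_fun_prod:
  "openin (mtop M) U \<Longrightarrow> (\<And>i. i \<in> I \<Longrightarrow> unit_fun M U (f i)) \<Longrightarrow> unit_fun M U (\<lambda>x. \<Prod>i\<in>I. f i x)"
  by (induction I rule: infinite_finite_induct)
    (auto simp: unit_fun_def holo_fun_iff intro: holo_at_mult holo_at_const)

lemma unit_fun_inverse: "atlas M \<Longrightarrow> unit_fun M U f \<Longrightarrow> unit_fun M U (\<lambda>x. inverse (f x))"
  by (auto simp: unit_fun_def holo_fun_iff intro: holo_at_inverse)

lemma unit_fun_subset: "unit_fun M U f \<Longrightarrow> openin (mtop M) V \<Longrightarrow> V \<subseteq> U \<Longrightarrow> unit_fun M V f"
  unfolding unit_fun_def using holo_fun_subset by blast

subsection \<open>Local biholomorphisms\<close>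

text \<open>For open \<open>V\<close> this is continuity on \<open>V\<close>, stated with open sets
  of the ambient spaces so that no subspace topologies accumulate.\<close>

definition cont_on_open :: "'a topology \<Rightarrow> 'a set \<Rightarrow> 'b topology \<Rightarrow> ('a \<Rightarrow> 'b) \<Rightarrow> bool" where
  "cont_on_open S V T f \<longleftrightarrow> (\<forall>W. openin T W \<longrightarrow> openin S {x\<in>V. f x \<in> W})"

text \<open>The Jacobian of \<open>f\<close> read in two charts. For the identity map it is the
  transition function of the canonical bundle (\<open>canonical_bundle_trans\<close>).\<close>

definition cjac :: "'a set \<Rightarrow> ('a \<Rightarrow> complex^'n) \<Rightarrow> ('a \<Rightarrow> 'b) \<Rightarrow> ('b \<Rightarrow> complex^'n) \<Rightarrow> 'a \<Rightarrow> complex" where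
  "cjac U \<phi> f \<psi> x = jac (\<psi> \<circ> f \<circ> inv_into U \<phi>) (\<phi> x)"

lemma hmap_atD:
  "hmap_at M N f x \<Longrightarrow> (U, \<phi>) \<in> charts M \<Longrightarrow> (V, \<psi>) \<in> charts N \<Longrightarrow> x \<in> U \<Longrightarrow> f x \<in> V \<Longrightarrow>
    cdiffv (\<psi> \<circ> f \<circ> inv_into U \<phi>) (\<phi> x)"
  unfolding hmap_at_def by fast

lemma hmap_at_id: "atlas M \<Longrightarrow> hmap_at M M (\<lambda>x. x) x"
  unfolding hmap_at_def using atlasD(6)[of M] by (fastforce simp: o_def)

lemma chart_preimage_open:
  assumes M: "atlas M" and c: "(U, \<phi>) \<in> charts M" and f: "cont_on_open (mtop M) O1 T f" and W: "openin T W"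
  shows "open (\<phi> ` {x\<in>U \<inter> O1. f x \<in> W})" "openin (mtop M) {x\<in>U \<inter> O1. f x \<in> W}"
proof -
  have "{x\<in>U \<inter> O1. f x \<in> W} = U \<inter> {x\<in>O1. f x \<in> W}" by blast
  then show o: "openin (mtop M) {x\<in>U \<inter> O1. f x \<in> W}"
    using f W atlasD(2)[OF M c] by (auto simp: cont_on_open_def)
  then show "open (\<phi> ` {x\<in>U \<inter> O1. f x \<in> W})"
    using atlasD(5)[OF M c, of "{x\<in>U \<inter> O1. f x \<in> W}"] by auto
qed

lemma holo_at_compose:
  assumes M: "atlas M" and N: "atlas N" and O1: "x \<in> O1" "O1 \<subseteq> carrier M" and cf: "cont_on_open (mtop M) O1 (mtop N) f"
    and f: "hmap_at M N f x" and g: "holo_at N g (f x)" and fx: "f x \<in> carrier N"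
  shows "holo_at M (\<lambda>x. g (f x)) x"
proof -
  obtain U \<phi> where U: "(U, \<phi>) \<in> charts M" "x \<in> U" using atlas_chart[OF M, of x] O1 by blast
  obtain V \<psi> where V: "(V, \<psi>) \<in> charts N" "f x \<in> V" using atlas_chart[OF N fx] by blast
  have i: "inj_on \<phi> U" "inj_on \<psi> V" using atlasD(4)[OF M U(1)] atlasD(4)[OF N V(1)] by auto
  have e: "(\<psi> \<circ> f \<circ> inv_into U \<phi>) (\<phi> x) = \<psi> (f x)" using i U by simp
  have "cdiff (\<lambda>w. (g \<circ> inv_into V \<psi>) ((\<psi> \<circ> f \<circ> inv_into U \<phi>) w)) (\<phi> x)"
    by (rule cdiff_compose[OF hmap_atD[OF f U(1) V(1) U(2) V(2)]]) (unfold e, rule holo_atD[OF g V])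
  then have "cdiff ((\<lambda>x. g (f x)) \<circ> inv_into U \<phi>) (\<phi> x)"
    by (rule cdiff_cong_open[OF _ chart_preimage_open(1)[OF M U(1) cf atlasD(2)[OF N V(1)]]])
      (use U V O1 i in auto)
  then show ?thesis by (rule holo_at_chart[OF M U])
qed

lemma hmap_at_compose:
  assumes M: "atlas M" and N: "atlas N" and O1: "x \<in> O1" and cf: "cont_on_open (mtop M) O1 (mtop N) f"
    and f: "hmap_at M N f x" and g: "hmap_at N P g (f x)" and fx: "f x \<in> carrier N"
  shows "hmap_at M P (\<lambda>x. g (f x)) x"
  unfolding hmap_at_def
proof clarify
  fix U \<phi> V' \<xi> assume U: "(U, \<phi>) \<in> charts M" "x \<in> U" and V': "(V', \<xi>) \<in> charts P" "g (f x) \<in> V'"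
  obtain V \<psi> where V: "(V, \<psi>) \<in> charts N" "f x \<in> V" using atlas_chart[OF N fx] by blast
  have i: "inj_on \<phi> U" "inj_on \<psi> V" using atlasD(4)[OF M U(1)] atlasD(4)[OF N V(1)] by auto
  have e: "(\<psi> \<circ> f \<circ> inv_into U \<phi>) (\<phi> x) = \<psi> (f x)" using i U by simp
  have "cdiffv (\<lambda>w. (\<xi> \<circ> g \<circ> inv_into V \<psi>) ((\<psi> \<circ> f \<circ> inv_into U \<phi>) w)) (\<phi> x)"
    by (rule cdiffv_compose[OF hmap_atD[OF f U(1) V(1) U(2) V(2)]])
      (unfold e, rule hmap_atD[OF g V(1) V'(1) V(2) V'(2)])
  then show "cdiffv (\<xi> \<circ> (\<lambda>x. g (f x)) \<circ> inv_into U \<phi>) (\<phi> x)"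
    by (rule cdiffv_cong_open[OF _ chart_preimage_open(1)[OF M U(1) cf atlasD(2)[OF N V(1)]]])
      (use U V O1 i in auto)
qed

text \<open>The chain rule. With identity maps it is the cocycle condition of the canonical bundle;
  with the covering map it describes how \<open>logjac\<close> changes with the chart.\<close>

lemma cjac_compose:
  assumes M: "atlas M" and N: "atlas N" and O1: "x \<in> O1" and cf: "cont_on_open (mtop M) O1 (mtop N) f"
    and f: "hmap_at M N f x" and g: "hmap_at N P g (f x)"
    and U: "(U, \<phi>) \<in> charts M" "x \<in> U" and V: "(V, \<psi>) \<in> charts N" "f x \<in> V"
    and V': "(V', \<xi>) \<in> charts P" "g (f x) \<in> V'"
  shows "cjac U \<phi> (\<lambda>x. g (f x)) \<xi> x = cjac V \<psi> g \<xi> (f x) * cjac U \<phi> f \<psi> x"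
proof -
  have i: "inj_on \<phi> U" "inj_on \<psi> V" using atlasD(4)[OF M U(1)] atlasD(4)[OF N V(1)] by auto
  let ?F = "\<psi> \<circ> f \<circ> inv_into U \<phi>" and ?G = "\<xi> \<circ> g \<circ> inv_into V \<psi>"
  have F: "cdiffv ?F (\<phi> x)" by (rule hmap_atD[OF f U(1) V(1) U(2) V(2)])
  have e: "?F (\<phi> x) = \<psi> (f x)" using i U by simp
  have G: "cdiffv ?G (?F (\<phi> x))" unfolding e by (rule hmap_atD[OF g V(1) V'(1) V(2) V'(2)])
  have "jac (\<lambda>w. ?G (?F w)) (\<phi> x) = jac ?G (\<psi> (f x)) * jac ?F (\<phi> x)"
    using jac_compose[OF F G] unfolding e .
  moreover have "jac (\<xi> \<circ> (\<lambda>x. g (f x)) \<circ> inv_into U \<phi>) (\<phi> x) = jac (\<lambda>w. ?G (?F w)) (\<phi> x)"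
    by (rule jac_cong_open[OF cdiffv_compose[OF F G] chart_preimage_open(1)[OF M U(1) cf atlasD(2)[OF N V(1)]]])
      (use U V O1 i in auto)
  ultimately show ?thesis by (simp add: cjac_def)
qed

lemma cjac_id:
  assumes M: "atlas M" and U: "(U, \<phi>) \<in> charts M" "x \<in> U"
  shows "cjac U \<phi> (\<lambda>x. x) \<phi> x = 1"
proof -
  have i: "inj_on \<phi> U" using atlasD(4)[OF M U(1)] .
  have "jac (\<phi> \<circ> (\<lambda>x. x) \<circ> inv_into U \<phi>) (\<phi> x) = jac (\<lambda>w. w) (\<phi> x)"
    by (rule jac_cong_open[OF cdiffv_id atlasD(3)[OF M U(1)]]) (use i U in \<open>auto simp: f_inv_into_f\<close>)
  then show ?thesis by (simp add: cjac_def jac_id)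
qed

lemma cjac_cong:
  fixes f :: "'a \<Rightarrow> 'b" and \<psi> :: "'b \<Rightarrow> complex^'n::finite"
  assumes M: "atlas M" and U: "(U, \<phi>) \<in> charts M" "x \<in> U" and V: "(V, \<psi>) \<in> charts N" "f x \<in> V"
    and f: "hmap_at M N f x" and W: "openin (mtop M) W" "x \<in> W" "\<And>y. y \<in> W \<Longrightarrow> f y = g y"
  shows "cjac U \<phi> g \<psi> x = cjac U \<phi> f \<psi> x" "hmap_at M N g x"
proof -
  have cong: "\<forall>\<^sub>F w in nhds (\<phi>' x). (\<psi>' \<circ> f \<circ> inv_into U' \<phi>') w = (\<psi>' \<circ> g \<circ> inv_into U' \<phi>') w"
    if c: "(U', \<phi>') \<in> charts M" "x \<in> U'" for U' \<phi>' and \<psi>' :: "'b \<Rightarrow> complex^'n"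
  proof -
    have o: "open (\<phi>' ` (U' \<inter> W))"
      using atlasD(5)[OF M c(1), of "U' \<inter> W"] atlasD(2)[OF M c(1)] W by blast
    show ?thesis unfolding eventually_nhds
      by (rule exI[of _ "\<phi>' ` (U' \<inter> W)"]) (use o c W atlasD(4)[OF M c(1)] in auto)
  qed
  show "cjac U \<phi> g \<psi> x = cjac U \<phi> f \<psi> x"
    unfolding cjac_def by (rule jac_cong_ev[OF hmap_atD[OF f U(1) V(1) U(2) V(2)] cong[OF U]])
  show "hmap_at M N g x" unfolding hmap_at_def
  proof clarify
    fix U' \<phi>' V' \<psi>' assume c: "(U', \<phi>') \<in> charts M" "x \<in> U'" "(V', \<psi>') \<in> charts N" "g x \<in> V'"
    then have "f x \<in> V'" using W by simp
    from cdiffv_cong_ev[OF hmap_atD[OF f c(1,3,2) this] cong[OF c(1,2)]]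
    show "cdiffv (\<psi>' \<circ> g \<circ> inv_into U' \<phi>') (\<phi>' x)" .
  qed
qed

lemma cjac_holo_at:
  assumes M: "atlas M" and N: "atlas N" and O1: "openin (mtop M) O1" and cf: "cont_on_open (mtop M) O1 (mtop N) f"
    and f: "\<And>x. x \<in> O1 \<Longrightarrow> hmap_at M N f x"
    and U: "(U, \<phi>) \<in> charts M" "x \<in> U" and V: "(V, \<psi>) \<in> charts N" "f x \<in> V" and x: "x \<in> O1"
  shows "holo_at M (cjac U \<phi> f \<psi>) x"
proof (rule holo_at_chart[OF M U])
  have i: "inj_on \<phi> U" using atlasD(4)[OF M U(1)] .
  let ?F = "\<psi> \<circ> f \<circ> inv_into U \<phi>" let ?S = "\<phi> ` {x\<in>U \<inter> O1. f x \<in> V}"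
  have S: "open ?S" by (rule chart_preimage_open(1)[OF M U(1) cf atlasD(2)[OF N V(1)]])
  have xS: "\<phi> x \<in> ?S" using U V x by blast
  have "cdiffv ?F w" if "w \<in> ?S" for w
    using that hmap_atD[OF f U(1) V(1)] by auto
  from cdiff_jac[OF S this xS] have "cdiff (jac ?F) (\<phi> x)" by blast
  then show "cdiff (cjac U \<phi> f \<psi> \<circ> inv_into U \<phi>) (\<phi> x)"
    by (rule cdiff_cong_open[OF _ S xS]) (use i in \<open>auto simp: cjac_def\<close>)
qed

lemma openin_open_sub:
  "openin (mtop M) U \<Longrightarrow> openin (mtop (open_sub M U)) V \<longleftrightarrow> openin (mtop M) V \<and> V \<subseteq> U"
  by (simp add: open_sub_def openin_open_subtopology)

lemma carrier_open_sub: "openin (mtop M) U \<Longrightarrow> carrier (open_sub M U) = U"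
  using openin_subset by (fastforce simp: open_sub_def)

lemma charts_open_sub: "(V, \<phi>) \<in> charts (open_sub M U) \<longleftrightarrow> (\<exists>V'. (V', \<phi>) \<in> charts M \<and> V = V' \<inter> U)"
  by (force simp: open_sub_def image_iff)

lemma ball_charts_open_sub:
  "(\<forall>(V, \<phi>)\<in>charts (open_sub M U). P V \<phi>) \<longleftrightarrow> (\<forall>(V, \<phi>)\<in>charts M. P (V \<inter> U) \<phi>)"
  by (simp add: open_sub_def case_prod_unfold)

lemma inv_into_chart_Int:
  assumes "inj_on \<phi> V" "w \<in> \<phi> ` (V \<inter> U)"
  shows "inv_into (V \<inter> U) \<phi> w = inv_into V \<phi> w"
proof -
  obtain y where y: "y \<in> V \<inter> U" "w = \<phi> y" using assms(2) by blast
  have "inj_on \<phi> (V \<inter> U)" using assms(1) by (rule inj_on_subset) blast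
  then show ?thesis using y assms(1) by (simp add: inv_into_f_f)
qed

lemma chart_Int_open:
  assumes "atlas M" "(V, \<phi>) \<in> charts M" "openin (mtop M) U"
  shows "open (\<phi> ` (V \<inter> U))"
  using atlasD(5)[OF assms(1,2), of "V \<inter> U"] openin_Int[OF atlasD(2)[OF assms(1,2)] assms(3)]
  by blast

lemma hmap_at_open_sub:
  fixes N :: "('b, 'd::finite) cmanifold"
  assumes M: "atlas M" and U: "openin (mtop M) U" and x: "x \<in> U" and fx: "f x \<in> U'"
  shows "hmap_at (open_sub M U) (open_sub N U') f x \<longleftrightarrow> hmap_at M N f x"
proof -
  have "cdiffv (\<psi> \<circ> f \<circ> inv_into (V \<inter> U) \<phi>) (\<phi> x) \<longleftrightarrow> cdiffv (\<psi> \<circ> f \<circ> inv_into V \<phi>) (\<phi> x)"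
    if c: "(V, \<phi>) \<in> charts M" "x \<in> V" for V \<phi> and \<psi> :: "'b \<Rightarrow> complex^'d"
  proof -
    have x': "\<phi> x \<in> \<phi> ` (V \<inter> U)" using c x by blast
    note e = inv_into_chart_Int[OF atlasD(4)[OF M c(1)], of _ U]
    show ?thesis
      by (rule iffI; erule cdiffv_cong_open[OF _ chart_Int_open[OF M c(1) U] x']; simp add: e)
  qed
  then show ?thesis unfolding hmap_at_def ball_charts_open_sub
    by (intro ball_cong refl) (clarsimp simp: x fx)
qed

lemma atlas_open_sub:
  assumes M: "atlas M" and U: "openin (mtop M) U" shows "atlas (open_sub M U)"
proof (rule atlasI)
  show "carrier (open_sub M U) = (\<Union>(V, \<phi>)\<in>charts (open_sub M U). V)" (is "_ = ?R")
  proof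
    show "carrier (open_sub M U) \<subseteq> ?R"
    proof
      fix x assume "x \<in> carrier (open_sub M U)"
      then have x: "x \<in> U" "x \<in> carrier M" using U openin_subset by (auto simp: carrier_open_sub)
      obtain V \<phi> where "(V, \<phi>) \<in> charts M" "x \<in> V" using atlas_chart[OF M x(2)] .
      then have "(V \<inter> U, \<phi>) \<in> charts (open_sub M U)" "x \<in> V \<inter> U" using x by (auto simp: charts_open_sub)
      then show "x \<in> ?R" by blast
    qed
    show "?R \<subseteq> carrier (open_sub M U)"
      unfolding carrier_open_sub[OF U] by (auto simp: charts_open_sub)
  qed
  fix V \<phi> assume "(V, \<phi>) \<in> charts (open_sub M U)"
  then obtain V' where V': "(V', \<phi>) \<in> charts M" "V = V' \<inter> U" by (auto simp: charts_open_sub)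
  have i: "inj_on \<phi> V'" using atlasD(4)[OF M V'(1)] .
  show "openin (mtop (open_sub M U)) V \<and> open (\<phi> ` V) \<and> inj_on \<phi> V"
    using chart_Int_open[OF M V'(1) U] i atlasD(2)[OF M V'(1)] U
    by (auto simp: openin_open_sub[OF U] V'(2) inj_on_Int)
  show "openin (mtop (open_sub M U)) W = open (\<phi> ` W)" if "W \<subseteq> V" for W
    using atlasD(5)[OF M V'(1), of W] that V'(2) by (auto simp: openin_open_sub[OF U])
  fix V2 \<psi> x assume "(V2, \<psi>) \<in> charts (open_sub M U)" and x: "x \<in> V" "x \<in> V2"
  then obtain V2' where V2': "(V2', \<psi>) \<in> charts M" "V2 = V2' \<inter> U" by (auto simp: charts_open_sub)
  show "cdiffv (\<psi> \<circ> inv_into V \<phi>) (\<phi> x)"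
    by (rule cdiffv_cong_open[OF atlasD(6)[OF M V'(1) V2'(1)] chart_Int_open[OF M V'(1) U]])
      (use x V' V2' i inv_into_chart_Int[OF i, of _ U] in auto)
qed

lemma mtop_Cn: "mtop Cn = euclidean" by (simp add: Cn_def)

lemma atlas_Cn: "atlas (Cn :: (complex^'n, 'n) cmanifold)"
proof (rule atlasI)
  fix U V :: "(complex^'n) set" and \<phi> \<psi> :: "complex^'n \<Rightarrow> complex^'n" and x
  assume "(U, \<phi>) \<in> charts Cn" "(V, \<psi>) \<in> charts Cn"
  then have "\<psi> \<circ> inv_into U \<phi> = (\<lambda>x. x)" by (auto simp: Cn_def inv_id[unfolded id_def] id_def o_def)
  then show "cdiffv (\<psi> \<circ> inv_into U \<phi>) (\<phi> x)" by (simp add: cdiffv_id)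
qed (auto simp: Cn_def)

text \<open>A biholomorphism between open subsets, with the inverse as an argument and everything
  stated in the ambient manifolds. Inversion is then a symmetry, and restriction and composition
  stay free of \<open>open_sub\<close>.\<close>

definition lbih :: "('a, 'n::finite) cmanifold \<Rightarrow> ('b, 'm::finite) cmanifold \<Rightarrow>
    'a set \<Rightarrow> 'b set \<Rightarrow> ('a \<Rightarrow> 'b) \<Rightarrow> ('b \<Rightarrow> 'a) \<Rightarrow> bool" where
  "lbih M N V U f g \<longleftrightarrow> openin (mtop M) V \<and> openin (mtop N) U \<and>
     (\<forall>x\<in>V. f x \<in> U \<and> g (f x) = x) \<and> (\<forall>y\<in>U. g y \<in> V \<and> f (g y) = y) \<and>
     cont_on_open (mtop M) V (mtop N) f \<and> cont_on_open (mtop N) U (mtop M) g \<and>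
     (\<forall>x\<in>V. hmap_at M N f x) \<and> (\<forall>y\<in>U. hmap_at N M g y)"

lemma lbihD:
  assumes "lbih M N V U f g" "x \<in> V"
  shows "g (f x) = x" "f x \<in> U" "hmap_at M N f x" "hmap_at N M g (f x)"
  using assms unfolding lbih_def by blast+

lemma lbih_cont:
  assumes "lbih M N V U f g"
  shows "openin (mtop M) V" "openin (mtop N) U" "cont_on_open (mtop M) V (mtop N) f" "cont_on_open (mtop N) U (mtop M) g"
  using assms unfolding lbih_def by blast+

lemma lbih_sym: "lbih M N V U f g \<Longrightarrow> lbih N M U V g f"
  unfolding lbih_def by blast

lemma cont_on_open_sub:
  assumes "continuous_map (subtopology S V) (subtopology T U) f" "openin S V" "openin T U"
  shows "cont_on_open S V T f"
  unfolding cont_on_open_def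
proof (intro allI impI)
  fix W assume "openin T W"
  then have "openin (subtopology T U) (W \<inter> U)"
    using assms(3) openin_Int[of T W U] by (simp add: openin_open_subtopology)
  from openin_continuous_map_preimage[OF assms(1) this]
  have "openin S {x \<in> topspace (subtopology S V). f x \<in> W \<inter> U}"
    using assms(2) by (simp add: openin_open_subtopology)
  moreover have "{x \<in> topspace (subtopology S V). f x \<in> W \<inter> U} = {x\<in>V. f x \<in> W}"
    using continuous_map_image_subset_topspace[OF assms(1)] openin_subset[OF assms(2)] by auto
  ultimately show "openin S {x\<in>V. f x \<in> W}" by simp
qed

lemma biholo_lbih:
  assumes M: "atlas M" and N: "atlas N" and V: "openin (mtop M) V" and U: "openin (mtop N) U"
    and b: "biholo (open_sub M V) (open_sub N U) f"
  obtains g where "lbih M N V U f g"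
proof -
  note c = carrier_open_sub[OF V] carrier_open_sub[OF U]
  obtain g where f: "holo_map (open_sub M V) (open_sub N U) f" and g: "holo_map (open_sub N U) (open_sub M V) g"
    and gf: "\<And>x. x \<in> V \<Longrightarrow> g (f x) = x" and fg: "\<And>y. y \<in> U \<Longrightarrow> f (g y) = y"
    using b unfolding biholo_def c by blast
  have cf: "continuous_map (subtopology (mtop M) V) (subtopology (mtop N) U) f"
    and cg: "continuous_map (subtopology (mtop N) U) (subtopology (mtop M) V) g"
    using f g by (simp_all add: holo_map_hmap_at open_sub_def)
  have "f x \<in> U" if "x \<in> V" for x
    using continuous_map_image_subset_topspace[OF cf] that openin_subset[OF V] by auto
  moreover have "g x \<in> V" if "x \<in> U" for x
    using continuous_map_image_subset_topspace[OF cg] that openin_subset[OF U] by auto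
  ultimately have "lbih M N V U f g"
    unfolding lbih_def using V U f g gf fg cont_on_open_sub[OF cf V U] cont_on_open_sub[OF cg U V]
      hmap_at_open_sub[OF M V, of _ f U N] hmap_at_open_sub[OF N U, of _ g V M]
    by (simp add: holo_map_hmap_at)
  then show ?thesis by (rule that)
qed

lemma open_sub_carrier_holo: 
  assumes "atlas M" "openin (mtop M) U" shows "biholo M M f \<Longrightarrow> \<exists>g. lbih M M (carrier M) (carrier M) f g"
proof -
  assume "biholo M M f"
  then obtain g where f: "holo_map M M f" and g: "holo_map M M g"
    and gf: "\<And>x. x \<in> carrier M \<Longrightarrow> g (f x) = x" and fg: "\<And>y. y \<in> carrier M \<Longrightarrow> f (g y) = y"
    unfolding biholo_def by blast
  have cf: "continuous_map (mtop M) (mtop M) f" and cg: "continuous_map (mtop M) (mtop M) g"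
    using f g by (simp_all add: holo_map_hmap_at)
  have "f x \<in> carrier M" "g x \<in> carrier M" if "x \<in> carrier M" for x
    using continuous_map_image_subset_topspace[OF cf] continuous_map_image_subset_topspace[OF cg] that by auto
  then have "lbih M M (carrier M) (carrier M) f g"
    unfolding lbih_def cont_on_open_def
    using f g gf fg openin_continuous_map_preimage[OF cf] openin_continuous_map_preimage[OF cg]
    by (auto simp: holo_map_hmap_at)
  then show ?thesis by blast
qed

lemma lbih_open_image:
  assumes "lbih M N V U f g" "openin (mtop M) W" "W \<subseteq> V" shows "openin (mtop N) (f ` W)"
proof -
  have "f ` W = {y\<in>U. g y \<in> W}" using assms(1,3) unfolding lbih_def by force
  then show ?thesis using assms(1,2) unfolding lbih_def cont_on_open_def by simp
qed

lemma cont_on_open_subset: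
  assumes "cont_on_open S V T f" "openin S W" "W \<subseteq> V" shows "cont_on_open S W T f"
  unfolding cont_on_open_def
proof (intro allI impI)
  fix X assume "openin T X"
  then have "openin S (W \<inter> {x\<in>V. f x \<in> X})" using assms unfolding cont_on_open_def by blast
  moreover have "W \<inter> {x\<in>V. f x \<in> X} = {x\<in>W. f x \<in> X}" using assms(3) by blast
  ultimately show "openin S {x\<in>W. f x \<in> X}" by simp
qed

lemma lbih_subset:
  assumes b: "lbih M N V U f g" and W: "openin (mtop M) W" "W \<subseteq> V" shows "lbih M N W (f ` W) f g"
proof -
  have o: "openin (mtop N) (f ` W)" by (rule lbih_open_image[OF b W])
  have s: "f ` W \<subseteq> U" using b W by (auto simp: lbih_def)
  have c1: "cont_on_open (mtop M) W (mtop N) f"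
    by (rule cont_on_open_subset[OF _ W]) (use b in \<open>simp add: lbih_def\<close>)
  have c2: "cont_on_open (mtop N) (f ` W) (mtop M) g"
    by (rule cont_on_open_subset[OF _ o s]) (use b in \<open>simp add: lbih_def\<close>)
  have 1: "g (f x) = x" "hmap_at M N f x" "hmap_at N M g (f x)" if "x \<in> W" for x
    using b W that unfolding lbih_def by blast+
  show ?thesis
    unfolding lbih_def using c1 c2 o W(1) 1 by simp
qed

lemma lbih_carrier: "lbih M N V U f g \<Longrightarrow> x \<in> V \<Longrightarrow> x \<in> carrier M \<and> f x \<in> carrier N"
  unfolding lbih_def using openin_subset[of "mtop M" V] openin_subset[of "mtop N" U] by blast

lemma lbih_holo_at:
  assumes M: "atlas M" and N: "atlas N" and b: "lbih M N V U f g" and x: "x \<in> V" and h: "holo_at N h (f x)"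
  shows "holo_at M (\<lambda>x. h (f x)) x"
proof (rule holo_at_compose[OF M N x, where g=h])
  show "cont_on_open (mtop M) V (mtop N) f" "hmap_at M N f x" using b x by (auto simp: lbih_def)
qed (use h x lbih_carrier[OF b] in auto)

lemma cont_on_open_id: "openin S V \<Longrightarrow> cont_on_open S V S (\<lambda>x. x)"
proof -
  assume "openin S V"
  then have "openin S (V \<inter> W)" if "openin S W" for W using that by (rule openin_Int)
  then show ?thesis by (simp add: cont_on_open_def Collect_conj_eq)
qed

text \<open>By the chain rule the Jacobians of \<open>f\<close> and of its inverse multiply to
  1.\<close>

lemma lbih_cjac_nonzero:
  assumes M: "atlas M" and N: "atlas N" and b: "lbih M N V U f g" and x: "x \<in> V"
    and c: "(W, \<phi>) \<in> charts M" "x \<in> W" "(W', \<psi>) \<in> charts N" "f x \<in> W'"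
  shows "cjac W \<phi> f \<psi> x \<noteq> 0"
proof -
  have 1: "cont_on_open (mtop M) V (mtop N) f" "hmap_at M N f x" "hmap_at N M g (f x)" "g (f x) = x"
    "openin (mtop M) V"
    using lbihD[OF b x] lbih_cont[OF b] by blast+
  then have gx: "g (f x) \<in> W" using c by simp
  have "cjac W \<phi> (\<lambda>x. g (f x)) \<phi> x = cjac W' \<psi> g \<phi> (f x) * cjac W \<phi> f \<psi> x"
    by (rule cjac_compose[OF M N x 1(1,2,3) c(1,2,3,4) c(1) gx])
  moreover have "cjac W \<phi> (\<lambda>x. g (f x)) \<phi> x = cjac W \<phi> (\<lambda>x. x) \<phi> x"
    by (rule cjac_cong(1)[OF M c(1,2) c(1,2) hmap_at_id[OF M] 1(5) x]) (simp add: lbihD(1)[OF b])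
  ultimately show ?thesis using cjac_id[OF M c(1,2)] by auto
qed

lemma lbih_id: "atlas M \<Longrightarrow> openin (mtop M) V \<Longrightarrow> lbih M M V V (\<lambda>x. x) (\<lambda>x. x)"
  by (simp add: lbih_def cont_on_open_id hmap_at_id)

section \<open>The canonical bundle\<close>

lemma canonical_bundle_trans:
  "lb_trans (canonical_bundle M) (U, \<phi>) (U', \<phi>') x = cjac U \<phi> (\<lambda>x. x) \<phi>' x"
  by (simp add: canonical_bundle_def cjac_def jac_def o_def)

lemma holo_line_bundle_canonical:
  assumes M: "atlas M" shows "holo_line_bundle M (canonical_bundle M)"
  unfolding holo_line_bundle_def
proof (intro conjI ballI)
  have idx: "lb_index (canonical_bundle M) = charts M" "lb_open (canonical_bundle M) = fst"
    by (auto simp: canonical_bundle_def)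
  show "carrier M = (\<Union>i\<in>lb_index (canonical_bundle M). lb_open (canonical_bundle M) i)"
    using M unfolding idx atlas_def by (simp add: case_prod_unfold)
  fix i assume "i \<in> lb_index (canonical_bundle M)"
  then obtain U \<phi> where i: "i = (U, \<phi>)" "(U, \<phi>) \<in> charts M" unfolding idx by (cases i) auto
  have oU: "openin (mtop M) U" by (rule atlasD(2)[OF M i(2)])
  then show "openin (mtop M) (lb_open (canonical_bundle M) i)" by (simp add: idx i)
  fix j assume "j \<in> lb_index (canonical_bundle M)"
  then obtain V \<psi> where j: "j = (V, \<psi>)" "(V, \<psi>) \<in> charts M" unfolding idx by (cases j) auto
  have oV: "openin (mtop M) V" by (rule atlasD(2)[OF M j(2)])
  show "unit_fun M (lb_open (canonical_bundle M) i \<inter> lb_open (canonical_bundle M) j) (lb_trans (canonical_bundle M) i j)"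
    unfolding unit_fun_def holo_fun_iff idx i(1) j(1) fst_conv
  proof (intro conjI ballI)
    show "openin (mtop M) (U \<inter> V)" using oU oV by blast
    fix x assume x: "x \<in> U \<inter> V"
    have e: "lb_trans (canonical_bundle M) (U, \<phi>) (V, \<psi>) = cjac U \<phi> (\<lambda>x. x) \<psi>"
      by (rule ext) (rule canonical_bundle_trans)
    show "holo_at M (lb_trans (canonical_bundle M) (U, \<phi>) (V, \<psi>)) x"
      unfolding e
      by (rule cjac_holo_at[OF M M oU cont_on_open_id[OF oU] hmap_at_id[OF M] i(2) _ j(2)]) (use x in auto)
    show "lb_trans (canonical_bundle M) (U, \<phi>) (V, \<psi>) x \<noteq> 0"
      unfolding e by (rule lbih_cjac_nonzero[OF M M lbih_id[OF M oU] _ i(2) _ j(2)]) (use x in auto)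
  qed
  fix k x assume "k \<in> lb_index (canonical_bundle M)"
    and x: "x \<in> lb_open (canonical_bundle M) i \<inter> lb_open (canonical_bundle M) j \<inter> lb_open (canonical_bundle M) k"
  then obtain W \<xi> where k: "k = (W, \<xi>)" "(W, \<xi>) \<in> charts M" unfolding idx by (cases k) auto
  have x: "x \<in> U" "x \<in> V" "x \<in> W" using x by (auto simp: idx i j k)
  show "lb_trans (canonical_bundle M) i j x * lb_trans (canonical_bundle M) j k x = lb_trans (canonical_bundle M) i k x"
    unfolding i(1) j(1) k(1) canonical_bundle_trans
    using cjac_compose[OF M M x(1) cont_on_open_id[OF oU] hmap_at_id[OF M] hmap_at_id[OF M] i(2) x(1) j(2) x(2) k(2) x(3)]
    by (simp add: mult.commute)
qed

subsection \<open>Cones generated by part of a lattice basis\<close>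

text \<open>Keeping the whole basis \<open>B\<close> and varying the index set makes faces
  correspond to subsets of \<open>K\<close>.\<close>

definition lcone :: "int^'n^'n \<Rightarrow> 'n set \<Rightarrow> (real^'n) set" where
  "lcone B K = convex_cone hull (rvec ` (\<lambda>j. column j B) ` K)"

definition lpair :: "int^'n \<Rightarrow> int^'n^'n \<Rightarrow> 'n \<Rightarrow> int" where
  "lpair m B k = (\<Sum>i\<in>UNIV. m $ i * B $ i $ k)"

text \<open>The rows of \<open>C\<close> are then the basis dual to the columns of \<open>B\<close>;
  they are the characters that serve as coordinates of the chart.\<close>

definition mutual_inverse :: "int^'n^'n \<Rightarrow> int^'n^'n \<Rightarrow> bool" where
  "mutual_inverse B C \<longleftrightarrow> B ** C = mat 1 \<and> C ** B = mat 1"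

lemma inner_rvec_column: "rvec m \<bullet> rvec (column k B) = of_int (lpair m B k)"
  by (simp add: inner_vec_def rvec_def lpair_def column_def)

lemma lpair_row:
  assumes "mutual_inverse B C" shows "lpair (row i C) B k = (if i = k then 1 else 0)"
proof -
  have "lpair (row i C) B k = (C ** B) $ i $ k"
    by (simp add: lpair_def row_def matrix_matrix_mult_def)
  then show ?thesis using assms by (simp add: mutual_inverse_def mat_def)
qed

lemma lpair_expand:
  assumes "mutual_inverse B C" shows "m = (\<Sum>k\<in>UNIV. lpair m B k *s row k C)"
proof -
  have "(\<Sum>k\<in>UNIV. lpair m B k * C $ k $ i) = m $ i" for i
  proof -
    have "(\<Sum>k\<in>UNIV. lpair m B k * C $ k $ i) = (\<Sum>k\<in>UNIV. \<Sum>j\<in>UNIV. m $ j * (B $ j $ k * C $ k $ i))"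
      by (simp add: lpair_def sum_distrib_right mult.assoc)
    also have "\<dots> = (\<Sum>j\<in>UNIV. m $ j * (B ** C) $ j $ i)"
      by (subst sum.swap) (simp add: matrix_matrix_mult_def sum_distrib_left)
    also have "\<dots> = m $ i" using assms by (simp add: mutual_inverse_def mat_def if_distrib cong: if_cong)
    finally show ?thesis .
  qed
  then show ?thesis by (simp add: vec_eq_iff row_def)
qed

lemma lcone_expand:
  assumes "mutual_inverse B C" shows "v = (\<Sum>k\<in>UNIV. (rvec (row k C) \<bullet> v) *\<^sub>R rvec (column k B))"
proof -
  have "(\<Sum>k\<in>UNIV. (rvec (row k C) \<bullet> v) * of_int (B $ i $ k)) = v $ i" for i
  proof -
    have "(\<Sum>k\<in>UNIV. (rvec (row k C) \<bullet> v) * of_int (B $ i $ k))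
        = (\<Sum>k\<in>UNIV. \<Sum>j\<in>UNIV. v $ j * of_int (B $ i $ k * C $ k $ j))"
      by (simp add: inner_vec_def rvec_def row_def sum_distrib_right sum_distrib_left mult_ac)
    also have "\<dots> = (\<Sum>j\<in>UNIV. v $ j * of_int ((B ** C) $ i $ j))"
      by (subst sum.swap) (simp add: matrix_matrix_mult_def sum_distrib_left)
    also have "\<dots> = v $ i" using assms by (simp add: mutual_inverse_def mat_def if_distrib cong: if_cong)
    finally show ?thesis .
  qed
  then show ?thesis by (simp add: vec_eq_iff rvec_def column_def)
qed

lemma convex_cone_sum:
  assumes "convex_cone S" "\<And>i. i \<in> I \<Longrightarrow> 0 \<le> c i" "\<And>i. i \<in> I \<Longrightarrow> c i \<noteq> 0 \<Longrightarrow> x i \<in> S"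
  shows "(\<Sum>i\<in>I. c i *\<^sub>R x i) \<in> S"
proof -
  have S0: "0 \<in> S" using assms(1) by (rule convex_cone_contains_0)
  show ?thesis
    using assms(2,3)
  proof (induction I rule: infinite_finite_induct)
    case (insert i I)
    have "c i *\<^sub>R x i \<in> S"
      using insert.prems S0 convex_cone_scaleR[OF assms(1), of "c i" "x i"] by (cases "c i = 0") auto
    then show ?case using insert convex_cone_add[OF assms(1)] by simp
  qed (auto simp: S0)
qed

text \<open>The rows of \<open>C\<close> read off the coefficients of \<open>v\<close> in the basis
  of columns (\<open>lcone_expand\<close>). Questions about faces thereby become sign
  conditions.\<close>

lemma lcone_iff:
  assumes BC: "mutual_inverse B C"
  shows "v \<in> lcone B K \<longleftrightarrow> (\<forall>i. 0 \<le> rvec (row i C) \<bullet> v \<and> (i \<notin> K \<longrightarrow> rvec (row i C) \<bullet> v = 0))"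
proof -
  let ?P = "\<lambda>v. \<forall>i. 0 \<le> rvec (row i C) \<bullet> v \<and> (i \<notin> K \<longrightarrow> rvec (row i C) \<bullet> v = 0)"
  have cc: "convex_cone (lcone B K)" unfolding lcone_def by (rule convex_cone_convex_cone_hull)
  have "lcone B K \<subseteq> Collect ?P"
    unfolding lcone_def
  proof (rule hull_minimal)
    show "rvec ` (\<lambda>j. column j B) ` K \<subseteq> Collect ?P"
      by (auto simp: inner_rvec_column lpair_row[OF BC])
    show "convex_cone (Collect ?P)"
      unfolding convex_cone_iff by (auto simp: inner_add_right intro: exI[of _ 0])
  qed
  moreover have "v \<in> lcone B K" if "?P v"
  proof -
    have "(\<Sum>k\<in>UNIV. (rvec (row k C) \<bullet> v) *\<^sub>R rvec (column k B)) \<in> lcone B K"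
    proof (rule convex_cone_sum[OF cc])
      fix i assume "rvec (row i C) \<bullet> v \<noteq> 0"
      then have "i \<in> K" using that by blast
      then show "rvec (column i B) \<in> lcone B K" unfolding lcone_def by (intro hull_inc) blast
    qed (use that in auto)
    then show ?thesis using lcone_expand[OF BC, of v] by simp
  qed
  ultimately show ?thesis by blast
qed

lemma lcone_column:
  assumes BC: "mutual_inverse B C" shows "rvec (column k B) \<in> lcone B K \<longleftrightarrow> k \<in> K"
  unfolding lcone_iff[OF BC] inner_rvec_column lpair_row[OF BC] by auto

lemma lcone_inj: "mutual_inverse B C \<Longrightarrow> lcone B K = lcone B K' \<longleftrightarrow> K = K'"
  using lcone_column by blast

lemma lcone_nonempty: "mutual_inverse B C \<Longrightarrow> lcone B K \<noteq> {}"
  using lcone_iff[of B C 0 K] by auto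

lemma lcone_empty: "mutual_inverse B C \<Longrightarrow> lcone B {} = {0}"
  by (simp add: lcone_def convex_cone_hull_empty)

lemma lcone_convex: "convex (lcone B K)"
  unfolding lcone_def by (rule convex_convex_cone_hull)

text \<open>A row outside \<open>K\<close> vanishes at an inner point of the segment and is
  nonnegative at both ends, so it vanishes at both ends.\<close>

lemma lcone_face:
  assumes BC: "mutual_inverse B C" and "K \<subseteq> J"
  shows "lcone B K face_of lcone B J"
  unfolding face_of_def
proof (intro conjI ballI impI)
  show "lcone B K \<subseteq> lcone B J" using assms(2) unfolding lcone_iff[OF BC] subset_iff by blast
  show "convex (lcone B K)" by (rule lcone_convex)
  fix a b x assume a: "a \<in> lcone B J" and b: "b \<in> lcone B J" and x: "x \<in> lcone B K" and seg: "x \<in> open_segment a b"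
  obtain u where u: "0 < u" "u < 1" "x = (1 - u) *\<^sub>R a + u *\<^sub>R b" using seg by (auto simp: in_segment)
  have "rvec (row i C) \<bullet> a = 0 \<and> rvec (row i C) \<bullet> b = 0" if "i \<notin> K" for i
  proof -
    have "(1 - u) * (rvec (row i C) \<bullet> a) + u * (rvec (row i C) \<bullet> b) = 0"
      using x that u(3) by (simp add: lcone_iff[OF BC] inner_add_right)
    moreover have "0 \<le> rvec (row i C) \<bullet> a" "0 \<le> rvec (row i C) \<bullet> b" using a b by (auto simp: lcone_iff[OF BC])
    ultimately show ?thesis using u(1,2)
      by (smt (verit) mult_nonneg_nonneg mult_eq_0_iff)
  qed
  then show "a \<in> lcone B K" "b \<in> lcone B K" using a b by (auto simp: lcone_iff[OF BC])
qed

text \<open>A nonempty face is itself a cone, and with each of its points it contains every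
  generator that the point involves. So it is spanned by the generators it contains.\<close>

lemma face_of_lcone:
  assumes BC: "mutual_inverse B C" and F: "F face_of lcone B J" and ne: "F \<noteq> {}"
  shows "\<exists>K\<subseteq>J. F = lcone B K"
proof -
  have FJ: "F \<subseteq> lcone B J" using F by (rule face_of_imp_subset)
  have cc: "convex_cone (lcone B J)" unfolding lcone_def by (rule convex_cone_convex_cone_hull)
  have scale: "c *\<^sub>R x \<in> F" if x: "x \<in> F" and c: "0 \<le> c" for x c
  proof (cases "x = 0 \<or> c = 1")
    case True then show ?thesis using x by auto
  next
    case False
    have xJ: "x \<in> lcone B J" using x FJ by blast
    \<comment> \<open>Any factor exceeding both 1 and \<open>c\<close> serves: \<open>x\<close> lies
      strictly between 0 and its \<open>d\<close>-fold multiple, so the face contains both ends and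
      hence the \<open>c\<close>-fold multiple between them.\<close>
    define d where "d = max 2 (c + 1)"
    have 0: "0 \<in> lcone B J" "d *\<^sub>R x \<in> lcone B J"
      using xJ convex_cone_scaleR[OF cc] convex_cone_contains_0[OF cc] by (auto simp: d_def)
    have dd: "d > 1" "c < d" by (auto simp: d_def)
    have "x \<in> open_segment 0 (d *\<^sub>R x)"
      unfolding in_segment using False dd by (auto intro!: exI[of _ "1/d"])
    then have F0: "0 \<in> F" "d *\<^sub>R x \<in> F" using face_ofD[OF F] 0 x by blast+
    have "c *\<^sub>R x = (1 - c/d) *\<^sub>R 0 + (c/d) *\<^sub>R (d *\<^sub>R x)" using dd by simp
    moreover have "0 \<le> c/d" "c/d \<le> 1" using c dd by auto
    ultimately show ?thesis
      using convexD_alt[OF face_of_imp_convex[OF F] F0, of "c/d"] by (simp only:)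
  qed
  then have "conic F" by (auto simp: conic_def)
  then have ccF: "convex_cone F"
    using face_of_imp_convex[OF F] ne by (simp add: convex_cone_def)
  define K where "K = {i. rvec (column i B) \<in> F}"
  have col: "rvec (column i B) \<in> F" if w: "w \<in> F" and i: "rvec (row i C) \<bullet> w \<noteq> 0" for w i
  proof -
    let ?c = "rvec (row i C) \<bullet> w" let ?e = "rvec (column i B)"
    have wJ: "w \<in> lcone B J" using w FJ by blast
    then have c: "?c > 0" using i by (auto simp: lcone_iff[OF BC] order_less_le)
    have iJ: "i \<in> J" using wJ i by (auto simp: lcone_iff[OF BC])
    \<comment> \<open>\<open>w\<close> is the midpoint of these two points of the cone: twice its
      component along the generator \<open>i\<close>, and twice the rest.\<close>
    let ?a = "(2 * ?c) *\<^sub>R ?e" let ?b = "2 *\<^sub>R (w - ?c *\<^sub>R ?e)"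
    have e: "rvec (row k C) \<bullet> ?e = (if k = i then 1 else 0)" for k
      by (simp add: inner_rvec_column lpair_row[OF BC])
    have a: "?a \<in> lcone B J" using c iJ by (auto simp: lcone_iff[OF BC] e)
    have b: "?b \<in> lcone B J" using wJ iJ by (auto simp: lcone_iff[OF BC] inner_diff_right e)
    have "?a \<in> F"
    \<comment> \<open>The open segment between equal points is empty and the face property is
      silent; but then \<open>w\<close> equals \<open>?a\<close>.\<close>
    proof (cases "?a = ?b")
      case True
      have "w = (1/2) *\<^sub>R ?a + (1/2) *\<^sub>R ?b" by (simp add: algebra_simps)
      also have "\<dots> = ?a" unfolding True[symmetric] by (simp flip: scaleR_add_left)
      finally show ?thesis using w by simp
    next
      case False
      have "w \<in> open_segment ?a ?b"
        unfolding in_segment using False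
        by (intro conjI exI[of _ "1/2"]) (auto simp: algebra_simps)
      then show ?thesis using face_ofD[OF F] a b w by blast
    qed
    moreover have "0 \<le> 1 / (2 * ?c)" using c by simp
    ultimately have "(1 / (2 * ?c)) *\<^sub>R ?a \<in> F" by (rule scale)
    then show ?thesis using c by simp
  qed
  have "F = lcone B K"
  proof
    show "F \<subseteq> lcone B K"
    proof
      fix w assume w: "w \<in> F"
      then have "w \<in> lcone B J" using FJ by blast
      then show "w \<in> lcone B K" using col[OF w] by (auto simp: lcone_iff[OF BC] K_def)
    qed
    show "lcone B K \<subseteq> F"
      unfolding lcone_def by (rule hull_minimal) (use ccF in \<open>auto simp: K_def\<close>)
  qed
  moreover have "K \<subseteq> J" using FJ by (auto simp: K_def lcone_column[OF BC])
  ultimately show ?thesis by blast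
qed

lemma mutual_inverse_rmat:
  assumes "mutual_inverse B C" shows "rmat B ** rmat C = mat 1" "rmat C ** rmat B = mat 1"
proof -
  have m: "rmat P ** rmat Q = rmat (P ** Q)" for P Q :: "int^'n^'n"
    by (simp add: rmat_def matrix_matrix_mult_def vec_eq_iff)
  have "rmat (mat 1 :: int^'n^'n) = mat 1" by (simp add: rmat_def mat_def vec_eq_iff)
  then show "rmat B ** rmat C = mat 1" "rmat C ** rmat B = mat 1"
    using assms by (simp_all add: m mutual_inverse_def)
qed

lemma rvec_column: "rvec (column j B) = rmat B *v axis j 1"
  by (simp add: vec_eq_iff rvec_def rmat_def column_def matrix_vector_mult_def axis_def if_distrib cong: if_cong)

text \<open>Recognises rays as the cones with a single generator, and shows that a proper face
  cannot be full-dimensional.\<close>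

lemma dim_lcone:
  fixes B :: "int^'n^'n"
  assumes BC: "mutual_inverse B C" shows "dim (lcone B K) = card K"
proof -
  let ?A = "(\<lambda>j. axis j (1::real)) ` K :: (real^'n) set"
  have e: "rvec ` (\<lambda>j. column j B) ` K = (*v) (rmat B) ` ?A" by (auto simp: rvec_column image_image)
  have "span (lcone B K) = span ((*v) (rmat B) ` ?A)"
  proof (rule antisym)
    have "lcone B K \<subseteq> span ((*v) (rmat B) ` ?A)"
    proof
      fix v assume v: "v \<in> lcone B K"
      have "(\<Sum>k\<in>UNIV. (rvec (row k C) \<bullet> v) *\<^sub>R rvec (column k B)) \<in> span ((*v) (rmat B) ` ?A)"
      proof (rule span_sum)
        fix k show "(rvec (row k C) \<bullet> v) *\<^sub>R rvec (column k B) \<in> span ((*v) (rmat B) ` ?A)"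
        proof (cases "k \<in> K")
          case True then show ?thesis unfolding e[symmetric] by (intro span_scale span_base) blast
        next
          case False then show ?thesis using v by (simp add: lcone_iff[OF BC] span_zero)
        qed
      qed
      then show "v \<in> span ((*v) (rmat B) ` ?A)" using lcone_expand[OF BC, of v] by simp
    qed
    then show "span (lcone B K) \<subseteq> span ((*v) (rmat B) ` ?A)" by (simp add: span_minimal)
    show "span ((*v) (rmat B) ` ?A) \<subseteq> span (lcone B K)"
      unfolding e[symmetric] lcone_def by (rule span_mono) (rule hull_subset)
  qed
  then have "dim (lcone B K) = dim ((*v) (rmat B) ` ?A)" by (metis dim_span)
  also have "\<dots> = dim ?A"
  proof (rule dim_image_eq)
    show "linear ((*v) (rmat B))" by simp
    show "inj_on ((*v) (rmat B)) (span ?A)"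
      using mutual_inverse_rmat(2)[OF BC] matrix_left_invertible_injective[of "rmat B"] inj_on_subset by blast
  qed
  also have "\<dots> = card ?A"
  proof (rule dim_eq_card_independent)
    show "independent ?A" by (rule independent_mono[OF independent_Basis]) (auto simp: Basis_vec_def)
  qed
  also have "\<dots> = card K" by (rule card_image) (auto simp: inj_on_def axis_eq_axis)
  finally show ?thesis .
qed

subsection \<open>Points of a toric variety in the coordinates of a cone\<close>

lemma perp_lcone:
  assumes BC: "mutual_inverse B C" shows "m \<in> perp (lcone B K) \<longleftrightarrow> (\<forall>k\<in>K. lpair m B k = 0)"
proof
  assume m: "m \<in> perp (lcone B K)"
  show "\<forall>k\<in>K. lpair m B k = 0"
  proof
    fix k assume "k \<in> K"
    then have "rvec (column k B) \<in> lcone B K" by (simp add: lcone_column[OF BC])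
    then show "lpair m B k = 0" using m inner_rvec_column[of m k B] by (simp add: perp_def)
  qed
next
  assume m: "\<forall>k\<in>K. lpair m B k = 0"
  show "m \<in> perp (lcone B K)"
    unfolding perp_def
  proof clarify
    fix v assume v: "v \<in> lcone B K"
    have "rvec m \<bullet> v = (\<Sum>k\<in>UNIV. (rvec (row k C) \<bullet> v) * of_int (lpair m B k))"
      by (subst lcone_expand[OF BC, of v]) (simp add: inner_sum_right inner_rvec_column)
    also have "\<dots> = 0"
    proof (rule sum.neutral, clarify)
      fix k show "(rvec (row k C) \<bullet> v) * of_int (lpair m B k) = 0"
        using m v by (cases "k \<in> K") (auto simp: lcone_iff[OF BC])
    qed
    finally show "rvec m \<bullet> v = 0" .
  qed
qed

lemma lpair_add: "lpair (m + m') B k = lpair m B k + lpair m' B k"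
  by (simp add: lpair_def algebra_simps sum.distrib)

text \<open>The point with coordinates \<open>z\<close> with respect to the lattice basis \<open>B\<close>.\<close>

definition tpt :: "int^'n^'n \<Rightarrow> complex^'n \<Rightarrow> 'n tpoint" where
  "tpt B z = (lcone B {k. z $ k = 0},
     \<lambda>m. if \<forall>k. z $ k = 0 \<longrightarrow> lpair m B k = 0 then \<Prod>k\<in>UNIV. z $ k powi lpair m B k else 0)"

definition tcoord :: "int^'n^'n \<Rightarrow> 'n tpoint \<Rightarrow> complex^'n" where
  "tcoord C x = (\<chi> i. snd x (row i C))"

lemma tcoord_tpt:
  assumes BC: "mutual_inverse B C" shows "tcoord C (tpt B z) = z"
proof -
  have "snd (tpt B z) (row i C) = z $ i" for i
  proof (cases "z $ i = 0")
    case True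
    then show ?thesis by (auto simp: tpt_def lpair_row[OF BC])
  next
    case False
    then have "snd (tpt B z) (row i C) = (\<Prod>k\<in>UNIV. z $ k powi (if i = k then 1 else 0))"
      by (auto simp: tpt_def lpair_row[OF BC])
    also have "\<dots> = (\<Prod>k\<in>UNIV. if k = i then z $ k else 1)" by (rule prod.cong) auto
    also have "\<dots> = z $ i" by simp
    finally show ?thesis .
  qed
  then show ?thesis by (simp add: tcoord_def vec_eq_iff)
qed

lemma tpt_orb:
  assumes BC: "mutual_inverse B C" shows "tpt B z \<in> orb (lcone B {k. z $ k = 0})"
proof -
  let ?K = "{k. z $ k = 0}" let ?f = "\<lambda>m. \<Prod>k\<in>UNIV. z $ k powi lpair m B k"
  have nz: "z $ k powi lpair m B k \<noteq> 0" if "m \<in> perp (lcone B ?K)" for m k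
    using that by (cases "z $ k = 0") (auto simp: perp_lcone[OF BC])
  have t: "tpt B z = (lcone B ?K, \<lambda>m. if m \<in> perp (lcone B ?K) then ?f m else 0)"
    by (simp add: tpt_def perp_lcone[OF BC])
  have add: "m + m' \<in> perp (lcone B ?K)" "?f (m + m') = ?f m * ?f m'"
    if m: "m \<in> perp (lcone B ?K)" "m' \<in> perp (lcone B ?K)" for m m'
  proof -
    show "m + m' \<in> perp (lcone B ?K)" using m by (simp add: perp_lcone[OF BC] lpair_add)
    have "z $ k powi lpair (m + m') B k = z $ k powi lpair m B k * z $ k powi lpair m' B k" for k
      using m by (cases "z $ k = 0") (auto simp: lpair_add power_int_add perp_lcone[OF BC])
    then show "?f (m + m') = ?f m * ?f m'" by (simp add: prod.distrib)
  qed
  show ?thesis unfolding t orb_def using nz add by simp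
qed

text \<open>Extends the homomorphism property to integer multiples and finite sums, so that a point
  of an orbit is determined by its values on a basis.\<close>

lemma orb_hom:
  assumes f: "(\<tau>, f) \<in> orb \<tau>"
  shows "f 0 = 1" "m \<in> perp \<tau> \<Longrightarrow> f (n *s m) = f m powi n"
    "finite I \<Longrightarrow> (\<And>k. k \<in> I \<Longrightarrow> g k \<in> perp \<tau>) \<Longrightarrow> f (\<Sum>k\<in>I. g k) = (\<Prod>k\<in>I. f (g k))"
proof -
  have p0: "0 \<in> perp \<tau>" by (simp add: perp_def rvec_def inner_vec_def)
  have padd: "m + m' \<in> perp \<tau>" if "m \<in> perp \<tau>" "m' \<in> perp \<tau>" for m m'
  proof -
    have "rvec (m + m') = rvec m + rvec m'" by (simp add: rvec_def vec_eq_iff)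
    then show ?thesis using that by (simp add: perp_def inner_add_left)
  qed
  have pneg: "- m \<in> perp \<tau>" if "m \<in> perp \<tau>" for m
  proof -
    have "rvec (- m) = - rvec m" by (simp add: rvec_def vec_eq_iff)
    then show ?thesis using that by (simp add: perp_def)
  qed
  have nz: "f m \<noteq> 0" if "m \<in> perp \<tau>" for m using f that by (simp add: orb_def)
  have hom: "f (m + m') = f m * f m'" if "m \<in> perp \<tau>" "m' \<in> perp \<tau>" for m m' using f that by (simp add: orb_def)
  show f0: "f 0 = 1" using hom[OF p0 p0] nz[OF p0] by simp
  have nat: "of_nat k *s m \<in> perp \<tau> \<and> f (of_nat k *s m) = f m ^ k" if m: "m \<in> perp \<tau>" for k m
  proof (induction k)
    case 0 then show ?case using p0 f0 by simp
  next
    case (Suc k)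
    have "of_nat (Suc k) *s m = m + of_nat k *s m" by (simp add: vec_eq_iff algebra_simps)
    then show ?case using Suc hom[OF m] padd[OF m] by (simp del: of_nat_Suc)
  qed
  show "f (n *s m) = f m powi n" if m: "m \<in> perp \<tau>"
  proof (cases "n \<ge> 0")
    case True
    then show ?thesis using nat[OF m, of "nat n"] by (simp add: power_int_def)
  next
    case False
    have e: "n *s m = of_nat (nat (- n)) *s (- m)" using False by (simp add: vec_eq_iff)
    have "f m * f (- m) = 1" using hom[OF m pneg[OF m]] f0 by simp
    then have "f (- m) = inverse (f m)" by (simp add: inverse_unique)
    then show ?thesis using nat[OF pneg[OF m], of "nat (- n)"] False unfolding e
      by (simp add: power_int_def)
  qed
  show "f (\<Sum>k\<in>I. g k) = (\<Prod>k\<in>I. f (g k))" if "finite I" "\<And>k. k \<in> I \<Longrightarrow> g k \<in> perp \<tau>"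
  proof -
    have "(\<Sum>k\<in>I. g k) \<in> perp \<tau> \<and> f (\<Sum>k\<in>I. g k) = (\<Prod>k\<in>I. f (g k))"
      using that by (induction I rule: finite_induct) (auto simp: p0 f0 padd hom)
    then show ?thesis by blast
  qed
qed

text \<open>Expanding \<open>m\<close> in the rows of \<open>C\<close> recovers the homomorphism
  from its values on those rows; rows with index in \<open>K\<close> are not in \<open>perp\<close>
  and have the value 0.\<close>

lemma orb_tcoord:
  assumes BC: "mutual_inverse B C" and x: "x \<in> orb (lcone B K)"
  shows "{k. tcoord C x $ k = 0} = K" "tpt B (tcoord C x) = x"
proof -
  let ?\<tau> = "lcone B K"
  obtain f where f: "x = (?\<tau>, f)" using x by (auto simp: orb_def)
  have fo: "(?\<tau>, f) \<in> orb ?\<tau>" using x f by simp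
  have nz: "f m \<noteq> 0 \<longleftrightarrow> m \<in> perp ?\<tau>" for m using fo by (simp add: orb_def)
  have "tcoord C x $ k = f (row k C)" for k by (simp add: tcoord_def f)
  then have tc: "tcoord C x $ k = 0 \<longleftrightarrow> k \<in> K" "tcoord C x $ k = f (row k C)" for k
    using nz[of "row k C"] by (auto simp: perp_lcone[OF BC] lpair_row[OF BC] split: if_splits)
  show K: "{k. tcoord C x $ k = 0} = K" using tc by blast
  have "f m = (if \<forall>k\<in>K. lpair m B k = 0 then \<Prod>k\<in>UNIV. tcoord C x $ k powi lpair m B k else 0)" for m
  proof (cases "m \<in> perp ?\<tau>")
    case True
    then have mK: "\<forall>k\<in>K. lpair m B k = 0" by (simp add: perp_lcone[OF BC])
    \<comment> \<open>For \<open>k\<close> in \<open>K\<close> the value on the row is 0 but so is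
      the exponent, and 0 to the power 0 is 1, the value at the zero character.\<close>
    have "f (lpair m B k *s row k C) = f (row k C) powi lpair m B k \<and> lpair m B k *s row k C \<in> perp ?\<tau>" for k
    proof (cases "k \<in> K")
      case True
      then show ?thesis using mK orb_hom(1)[OF fo] nz[of 0] by simp
    next
      case False
      then have "row k C \<in> perp ?\<tau>" using nz tc by metis
      moreover from orb_hom(2)[OF fo this] have "f (lpair m B k *s row k C) = f (row k C) powi lpair m B k" .
      ultimately show ?thesis using nz by (metis power_int_eq_0_iff)
    qed
    then have "f (\<Sum>k\<in>UNIV. lpair m B k *s row k C) = (\<Prod>k\<in>UNIV. f (row k C) powi lpair m B k)"
      using orb_hom(3)[OF fo, of UNIV "\<lambda>k. lpair m B k *s row k C"] by simp
    then show ?thesis using mK lpair_expand[OF BC, of m] by (simp add: tc(2))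
  next
    case False
    then show ?thesis using nz[of m] by (auto simp: perp_lcone[OF BC])
  qed
  then have "f = (\<lambda>m. if \<forall>k. tcoord C x $ k = 0 \<longrightarrow> lpair m B k = 0 then \<Prod>k\<in>UNIV. tcoord C x $ k powi lpair m B k else 0)"
    by (simp add: fun_eq_iff tc(1) Ball_def)
  then have "tpt B (tcoord C x) = (?\<tau>, f)" unfolding tpt_def K by simp
  then show "tpt B (tcoord C x) = x" by (simp only: f)
qed

subsection \<open>The atlas of a toric variety\<close>

text \<open>The topology is the one defined by the charts themselves, so it must be shown that every
  chart is a homeomorphism for it. This uses that overlaps are open and transition maps
  continuous.\<close>

lemma atlas_from_charts:
  fixes Ch :: "('a set \<times> ('a \<Rightarrow> complex^'n::finite)) set"
  assumes P: "P = (\<Union>(U, \<phi>)\<in>Ch. U)"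
    and inj: "\<And>U \<phi>. (U, \<phi>) \<in> Ch \<Longrightarrow> inj_on \<phi> U"
    and opn: "\<And>U \<phi> V \<psi>. (U, \<phi>) \<in> Ch \<Longrightarrow> (V, \<psi>) \<in> Ch \<Longrightarrow> open (\<phi> ` (U \<inter> V))"
    and trans: "\<And>U \<phi> V \<psi> x. (U, \<phi>) \<in> Ch \<Longrightarrow> (V, \<psi>) \<in> Ch \<Longrightarrow> x \<in> U \<Longrightarrow> x \<in> V \<Longrightarrow> cdiffv (\<psi> \<circ> inv_into U \<phi>) (\<phi> x)"
    and M: "M = \<lparr>mtop = topology (\<lambda>V. V \<subseteq> P \<and> (\<forall>(U,\<phi>)\<in>Ch. open (\<phi> ` (V \<inter> U)))), charts = Ch\<rparr>"
  shows "atlas M" "carrier M = P"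
proof -
  let ?P = "\<lambda>V. V \<subseteq> P \<and> (\<forall>(U,\<phi>)\<in>Ch. open (\<phi> ` (V \<inter> U)))"
  have "istopology ?P"
    unfolding istopology_def
  proof (intro conjI allI impI)
    fix S T assume S: "?P S" and T: "?P T"
    show "S \<inter> T \<subseteq> P" using S by blast
    show "\<forall>(U,\<phi>)\<in>Ch. open (\<phi> ` (S \<inter> T \<inter> U))"
    proof clarify
      fix U \<phi> assume c: "(U, \<phi>) \<in> Ch"
      have "\<phi> ` (S \<inter> T \<inter> U) = \<phi> ` (S \<inter> U) \<inter> \<phi> ` (T \<inter> U)"
        using inj_on_image_Int[OF inj[OF c], of "S \<inter> U" "T \<inter> U"] by (simp add: Int_ac)
      then show "open (\<phi> ` (S \<inter> T \<inter> U))" using S T c by auto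
    qed
  next
    fix \<K> assume K: "\<forall>K\<in>\<K>. ?P K"
    show "\<Union>\<K> \<subseteq> P" using K by blast
    show "\<forall>(U,\<phi>)\<in>Ch. open (\<phi> ` (\<Union>\<K> \<inter> U))"
    proof clarify
      fix U \<phi> assume c: "(U, \<phi>) \<in> Ch"
      have "\<phi> ` (\<Union>\<K> \<inter> U) = (\<Union>K\<in>\<K>. \<phi> ` (K \<inter> U))" by blast
      moreover have "open (\<Union>K\<in>\<K>. \<phi> ` (K \<inter> U))" using K c by (intro open_UN) auto
      ultimately show "open (\<phi> ` (\<Union>\<K> \<inter> U))" by simp
    qed
  qed
  then have opM: "openin (mtop M) V = ?P V" for V unfolding M by simp
  have chM: "charts M = Ch" by (simp add: M)
  \<comment> \<open>Openness of \<open>W\<close> refers to all charts; pulling back along the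
    transition maps reduces it to the one chart containing \<open>W\<close>.\<close>
  have opn2: "openin (mtop M) W = open (\<phi> ` W)" if c: "(U, \<phi>) \<in> Ch" and W: "W \<subseteq> U" for U \<phi> W
  proof
    assume "openin (mtop M) W"
    then have "open (\<phi> ` (W \<inter> U))" unfolding opM using c by auto
    then show "open (\<phi> ` W)" using W by (simp add: Int_absorb2)
  next
    assume W': "open (\<phi> ` W)"
    have "open (\<psi> ` (W \<inter> V))" if d: "(V, \<psi>) \<in> Ch" for V \<psi>
    proof -
      have "continuous_on (\<psi> ` (V \<inter> U)) (\<phi> \<circ> inv_into V \<psi>)"
        by (rule continuous_at_imp_continuous_on) (use trans[OF d c] cdiffv_isCont in blast)
      from continuous_open_preimage[OF this opn[OF d c] W']
      have "open (\<psi> ` (V \<inter> U) \<inter> (\<phi> \<circ> inv_into V \<psi>) -` (\<phi> ` W))" .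
      moreover have "\<psi> ` (V \<inter> U) \<inter> (\<phi> \<circ> inv_into V \<psi>) -` (\<phi> ` W) = \<psi> ` (W \<inter> V)"
      proof -
        have "\<phi> x \<in> \<phi> ` W \<longleftrightarrow> x \<in> W" if "x \<in> U" for x
          using inj_on_image_mem_iff[OF inj[OF c] that W] .
        then have "V \<inter> U \<inter> {x. \<phi> x \<in> \<phi> ` W} = W \<inter> V" using W by blast
        moreover have "\<psi> ` (V \<inter> U) \<inter> (\<phi> \<circ> inv_into V \<psi>) -` (\<phi> ` W) = \<psi> ` (V \<inter> U \<inter> {x. \<phi> x \<in> \<phi> ` W})"
          using inj[OF d] by auto
        ultimately show ?thesis by simp
      qed
      ultimately show ?thesis by simp
    qed
    moreover have "W \<subseteq> P" using W c P by blast
    ultimately show "openin (mtop M) W" unfolding opM by auto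
  qed
  have opU: "openin (mtop M) U" if c: "(U, \<phi>) \<in> Ch" for U \<phi>
    using opn2[OF c, of U] opn[OF c c] by simp
  show cM: "carrier M = P"
  proof
    show "carrier M \<subseteq> P" unfolding topspace_def opM by blast
    show "P \<subseteq> carrier M" unfolding P using opU openin_subset by fast
  qed
  show "atlas M"
  proof (rule atlasI)
    show "carrier M = (\<Union>(U, \<phi>)\<in>charts M. U)" unfolding cM chM by (rule P)
  next
    fix U \<phi> assume "(U, \<phi>) \<in> charts M"
    then have c: "(U, \<phi>) \<in> Ch" by (simp add: chM)
    show "openin (mtop M) U \<and> open (\<phi> ` U) \<and> inj_on \<phi> U"
      using opU[OF c] opn[OF c c] inj[OF c] by simp
  qed (use opn2 trans chM in simp_all)
qed

text \<open>The part of \<open>smooth_fan\<close> that speaks of single cones. It yields the atlas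
  of the toric variety and is inherited by \<open>cover_fan\<close>.\<close>

definition face_closed :: "(real^'n) set set \<Rightarrow> bool" where
  "face_closed \<Sigma> \<longleftrightarrow> (\<forall>\<tau>\<in>\<Sigma>. smooth_cone \<tau>) \<and> (\<forall>\<tau>\<in>\<Sigma>. \<forall>\<rho>. \<rho> face_of \<tau> \<and> \<rho> \<noteq> {} \<longrightarrow> \<rho> \<in> \<Sigma>)"

definition tchart :: "(real^'n) set set \<Rightarrow> int^'n^'n \<Rightarrow> int^'n^'n \<Rightarrow> 'n set \<Rightarrow> bool" where
  "tchart \<Sigma> B C J \<longleftrightarrow> mutual_inverse B C \<and> lcone B J \<in> \<Sigma>"

lemma toric_charts_iff:
  "toric_charts \<Sigma> = {(affine_piece \<Sigma> (lcone B J), tcoord C) | B C J. tchart \<Sigma> B C J}"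
  unfolding toric_charts_def tchart_def mutual_inverse_def lcone_def tcoord_def[abs_def] by blast

lemma smooth_cone_lcone: "smooth_cone \<tau> \<longleftrightarrow> (\<exists>B C J. mutual_inverse B C \<and> \<tau> = lcone B J)"
  unfolding smooth_cone_def invertible_def mutual_inverse_def lcone_def by blast

text \<open>Faces of a smooth cone are spanned by subsets of its generators, so the orbits of the
  piece are indexed by the possible sets of vanishing coordinates.\<close>

lemma affine_piece_lcone:
  fixes \<Sigma> :: "(real^'n) set set"
  assumes "face_closed \<Sigma>" and c: "tchart \<Sigma> B C J"
  shows "x \<in> affine_piece \<Sigma> (lcone B J) \<longleftrightarrow> (\<exists>K\<subseteq>J. x \<in> orb (lcone B K))"
proof -
  have BC: "mutual_inverse B C" and S: "lcone B J \<in> \<Sigma>" using c by (auto simp: tchart_def)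
  show ?thesis
  proof
    assume "x \<in> affine_piece \<Sigma> (lcone B J)"
    then obtain \<tau> where t: "\<tau> \<in> \<Sigma>" "\<tau> face_of lcone B J" "x \<in> orb \<tau>" by (auto simp: affine_piece_def)
    have "smooth_cone \<tau>" using assms(1) t(1) by (simp add: face_closed_def)
    then obtain B' C' J' where t': "mutual_inverse B' C'" "\<tau> = lcone B' J'"
      unfolding smooth_cone_lcone by blast
    have "\<tau> \<noteq> {}" unfolding t'(2) by (rule lcone_nonempty[OF t'(1)])
    then show "\<exists>K\<subseteq>J. x \<in> orb (lcone B K)" using face_of_lcone[OF BC t(2)] t(3) by blast
  next
    assume "\<exists>K\<subseteq>J. x \<in> orb (lcone B K)"
    then obtain K where K: "K \<subseteq> J" "x \<in> orb (lcone B K)" by blast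
    have f: "lcone B K face_of lcone B J" by (rule lcone_face[OF BC K(1)])
    then have "lcone B K \<in> \<Sigma>" using assms(1) S lcone_nonempty[OF BC] unfolding face_closed_def by blast
    then show "x \<in> affine_piece \<Sigma> (lcone B J)" using f K unfolding affine_piece_def by blast
  qed
qed

lemma affine_piece_tpt:
  fixes z :: "complex^'n"
  assumes F: "face_closed \<Sigma>" and c: "tchart \<Sigma> B C J"
  shows "tpt B z \<in> affine_piece \<Sigma> (lcone B J) \<longleftrightarrow> {k. z $ k = 0} \<subseteq> J"
    and "x \<in> affine_piece \<Sigma> (lcone B J) \<Longrightarrow> tpt B (tcoord C x) = x \<and> {k. tcoord C x $ k = 0} \<subseteq> J"
    and "x \<in> affine_piece \<Sigma> (lcone B J) \<Longrightarrow> fst x = lcone B {k. tcoord C x $ k = 0}"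
proof -
  have BC: "mutual_inverse B C" using c by (auto simp: tchart_def)
  show *: "tpt B (tcoord C x) = x \<and> {k. tcoord C x $ k = 0} \<subseteq> J" if x: "x \<in> affine_piece \<Sigma> (lcone B J)" for x
  proof -
    obtain K where K: "K \<subseteq> J" "x \<in> orb (lcone B K)" using x unfolding affine_piece_lcone[OF F c] by blast
    show ?thesis using orb_tcoord[OF BC K(2)] K(1) by simp
  qed
  show "fst x = lcone B {k. tcoord C x $ k = 0}" if "x \<in> affine_piece \<Sigma> (lcone B J)" for x
  proof -
    have "fst (tpt B (tcoord C x)) = lcone B {k. tcoord C x $ k = 0}" by (simp add: tpt_def)
    then show ?thesis using *[OF that] by simp
  qed
  show "tpt B z \<in> affine_piece \<Sigma> (lcone B J) \<longleftrightarrow> {k. z $ k = 0} \<subseteq> J"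
  proof
    assume "tpt B z \<in> affine_piece \<Sigma> (lcone B J)"
    from *[OF this] show "{k. z $ k = 0} \<subseteq> J" by (simp add: tcoord_tpt[OF BC])
  next
    assume "{k. z $ k = 0} \<subseteq> J"
    then show "tpt B z \<in> affine_piece \<Sigma> (lcone B J)"
      unfolding affine_piece_lcone[OF F c] using tpt_orb[OF BC] by blast
  qed
qed

lemma tcoord_inj:
  fixes z :: "complex^'n"
  assumes F: "face_closed \<Sigma>" and c: "tchart \<Sigma> B C J"
  shows "inj_on (tcoord C) (affine_piece \<Sigma> (lcone B J))"
    and "tcoord C ` affine_piece \<Sigma> (lcone B J) = {z :: complex^'n. {k. z $ k = 0} \<subseteq> J}"
    and "{k. z $ k = 0} \<subseteq> J \<Longrightarrow> inv_into (affine_piece \<Sigma> (lcone B J)) (tcoord C) z = tpt B z"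
proof -
  have BC: "mutual_inverse B C" using c by (auto simp: tchart_def)
  note t = affine_piece_tpt(2)[OF F c]
  show i: "inj_on (tcoord C) (affine_piece \<Sigma> (lcone B J))"
    by (rule inj_on_inverseI[where g="tpt B"]) (use t in blast)
  show "tcoord C ` affine_piece \<Sigma> (lcone B J) = {z :: complex^'n. {k. z $ k = 0} \<subseteq> J}"
  proof
    show "tcoord C ` affine_piece \<Sigma> (lcone B J) \<subseteq> {z :: complex^'n. {k. z $ k = 0} \<subseteq> J}"
      using t by blast
    show "{z :: complex^'n. {k. z $ k = 0} \<subseteq> J} \<subseteq> tcoord C ` affine_piece \<Sigma> (lcone B J)"
    proof clarify
      fix z :: "complex^'n" assume "{k. z $ k = 0} \<subseteq> J"
      then have "tpt B z \<in> affine_piece \<Sigma> (lcone B J)" by (simp add: affine_piece_tpt(1)[OF F c])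
      from imageI[OF this, of "tcoord C"] show "z \<in> tcoord C ` affine_piece \<Sigma> (lcone B J)"
        by (simp add: tcoord_tpt[OF BC])
    qed
  qed
  show "inv_into (affine_piece \<Sigma> (lcone B J)) (tcoord C) z = tpt B z" if z: "{k. z $ k = 0} \<subseteq> J"
  proof -
    have "tpt B z \<in> affine_piece \<Sigma> (lcone B J)" using z by (simp add: affine_piece_tpt(1)[OF F c])
    from inv_into_f_f[OF i this] show ?thesis by (simp add: tcoord_tpt[OF BC])
  qed
qed

lemma open_zero_set: "open {w :: complex^'n. \<forall>k. k \<notin> K \<longrightarrow> w $ k \<noteq> 0}"
proof -
  have "{w :: complex^'n. \<forall>k. k \<notin> K \<longrightarrow> w $ k \<noteq> 0} = (\<Inter>k\<in>-K. (\<lambda>w. w $ k) -` (-{0}))" by auto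
  moreover have "open \<dots>"
    by (intro open_INT ballI open_vimage) (auto intro!: continuous_intros)
  ultimately show ?thesis by simp
qed

text \<open>Changes of coordinates are Laurent monomials. If the k-th coordinate vanishes at a
  common point, then column \<open>k\<close> of \<open>B\<close> lies in the second cone, so its
  exponents are nonnegative. The point \<open>w\<close> ranges over the neighbourhood of
  \<open>z\<close> in which no further coordinates vanish.\<close>

lemma tchart_transition:
  fixes z w :: "complex^'n"
  assumes F: "face_closed \<Sigma>" and c: "tchart \<Sigma> B C J" and d: "tchart \<Sigma> B' C' J'"
    and z: "{k. z $ k = 0} \<subseteq> J" and zd: "tpt B z \<in> affine_piece \<Sigma> (lcone B' J')"
    and w: "{k. w $ k = 0} \<subseteq> {k. z $ k = 0}"
  shows "tpt B w \<in> affine_piece \<Sigma> (lcone B' J')"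
    and "tcoord C' (tpt B w) $ i = (\<Prod>k\<in>UNIV. w $ k powi lpair (row i C') B k)"
    and "z $ k = 0 \<Longrightarrow> 0 \<le> lpair (row i C') B k"
proof -
  have BC: "mutual_inverse B C" and BC': "mutual_inverse B' C'" using c d by (auto simp: tchart_def)
  let ?K = "{k. z $ k = 0}" and ?L = "{k. w $ k = 0}"
  have f: "lcone B ?K face_of lcone B' J'" using zd by (auto simp: affine_piece_def tpt_def orb_def)
  have f2: "lcone B ?L face_of lcone B ?K" by (rule lcone_face[OF BC w])
  have "lcone B ?L face_of lcone B J" by (rule lcone_face[OF BC]) (use w z in blast)
  then have "lcone B ?L \<in> \<Sigma>"
    using F c lcone_nonempty[OF BC] unfolding face_closed_def tchart_def by blast
  then show "tpt B w \<in> affine_piece \<Sigma> (lcone B' J')"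
    unfolding affine_piece_def using face_of_trans[OF f2 f] tpt_orb[OF BC, of w] by blast
  show nn: "0 \<le> lpair (row i C') B k" if "z $ k = 0" for k
  proof -
    have "rvec (column k B) \<in> lcone B ?K" using that by (simp add: lcone_column[OF BC])
    then have "rvec (column k B) \<in> lcone B' J'" using face_of_imp_subset[OF f] by blast
    then have "0 \<le> rvec (row i C') \<bullet> rvec (column k B)" by (simp add: lcone_iff[OF BC'])
    then show ?thesis by (simp add: inner_rvec_column)
  qed
  show "tcoord C' (tpt B w) $ i = (\<Prod>k\<in>UNIV. w $ k powi lpair (row i C') B k)"
  proof (cases "\<forall>k. w $ k = 0 \<longrightarrow> lpair (row i C') B k = 0")
    case True then show ?thesis by (simp add: tcoord_def tpt_def)
  next
    case False
    then obtain k where k: "w $ k = 0" "lpair (row i C') B k \<noteq> 0" by blast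
    \<comment> \<open>A vanishing coordinate with nonzero exponent has a positive one, so the
      monomial is 0 and agrees with the default value in \<open>tpt\<close>.\<close>
    then have "lpair (row i C') B k > 0" using nn[of k] w by (auto simp: order_less_le)
    then have "w $ k powi lpair (row i C') B k = 0" using k by (simp add: power_int_def)
    then have "(\<Prod>k\<in>UNIV. w $ k powi lpair (row i C') B k) = 0" by (meson UNIV_I finite prod_zero)
    then show ?thesis using False by (simp add: tcoord_def tpt_def)
  qed
qed

lemma toric_chart_open:
  fixes B :: "int^'n^'n"
  assumes F: "face_closed \<Sigma>" and c: "tchart \<Sigma> B C J" and d: "tchart \<Sigma> B' C' J'"
  shows "open (tcoord C ` (affine_piece \<Sigma> (lcone B J) \<inter> affine_piece \<Sigma> (lcone B' J')))" (is "open ?S")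
proof (subst open_subopen, intro ballI)
  fix z assume "z \<in> ?S"
  then obtain x where x: "x \<in> affine_piece \<Sigma> (lcone B J)" "x \<in> affine_piece \<Sigma> (lcone B' J')" "z = tcoord C x" by blast
  have z: "{k. z $ k = 0} \<subseteq> J" "tpt B z \<in> affine_piece \<Sigma> (lcone B' J')"
    using affine_piece_tpt(2)[OF F c x(1)] x by auto
  let ?T = "{w :: complex^'n. \<forall>k. k \<notin> {k. z $ k = 0} \<longrightarrow> w $ k \<noteq> 0}"
  have "?T \<subseteq> ?S"
  proof
    fix w assume "w \<in> ?T"
    then have w: "{k. w $ k = 0} \<subseteq> {k. z $ k = 0}" by blast
    have "tpt B w \<in> affine_piece \<Sigma> (lcone B J)" unfolding affine_piece_tpt(1)[OF F c] using w z by blast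
    moreover have "tcoord C (tpt B w) = w" using c by (simp add: tchart_def tcoord_tpt)
    ultimately show "w \<in> ?S" using tchart_transition(1)[OF F c d z w] by (metis IntI imageI)
  qed
  moreover have "z \<in> ?T" by simp
  ultimately show "\<exists>T. open T \<and> z \<in> T \<and> T \<subseteq> ?S" using open_zero_set by blast
qed

text \<open>Near the point every coordinate either stays nonzero or occurs with nonnegative
  exponent, so the monomials are holomorphic there.\<close>

lemma toric_chart_trans:
  fixes B :: "int^'n^'n"
  assumes F: "face_closed \<Sigma>" and c: "tchart \<Sigma> B C J" and d: "tchart \<Sigma> B' C' J'"
    and x: "x \<in> affine_piece \<Sigma> (lcone B J)" "x \<in> affine_piece \<Sigma> (lcone B' J')"
  shows "cdiffv (tcoord C' \<circ> inv_into (affine_piece \<Sigma> (lcone B J)) (tcoord C)) (tcoord C x)"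
proof -
  let ?z = "tcoord C x"
  have z: "{k. ?z $ k = 0} \<subseteq> J" "tpt B ?z \<in> affine_piece \<Sigma> (lcone B' J')"
    using affine_piece_tpt(2)[OF F c x(1)] x by auto
  let ?T = "{w :: complex^'n. \<forall>k. k \<notin> {k. ?z $ k = 0} \<longrightarrow> w $ k \<noteq> 0}"
  have "cdiffv (\<lambda>w. \<chi> i. \<Prod>k\<in>UNIV. w $ k powi lpair (row i C') B k) ?z"
    unfolding cdiffv_iff using tchart_transition(3)[OF F c d z order_refl]
    by (auto intro!: cdiff_prod cdiff_powi cdiff_nth)
  then show ?thesis
  proof (rule cdiffv_cong_open[OF _ open_zero_set])
    show "?z \<in> ?T" by simp
    fix w assume "w \<in> ?T"
    then have w: "{k. w $ k = 0} \<subseteq> {k. ?z $ k = 0}" by blast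
    have "inv_into (affine_piece \<Sigma> (lcone B J)) (tcoord C) w = tpt B w"
      by (rule tcoord_inj(3)[OF F c]) (use w z in blast)
    then show "(\<chi> i. \<Prod>k\<in>UNIV. w $ k powi lpair (row i C') B k) =
       (tcoord C' \<circ> inv_into (affine_piece \<Sigma> (lcone B J)) (tcoord C)) w"
      using tchart_transition(2)[OF F c d z w] by (simp add: vec_eq_iff)
  qed
qed

lemma toric_atlas:
  assumes F: "face_closed \<Sigma>"
  shows "atlas (toric_variety \<Sigma>)" "carrier (toric_variety \<Sigma>) = toric_points \<Sigma>"
proof -
  have P: "toric_points \<Sigma> = (\<Union>(U, \<phi>)\<in>toric_charts \<Sigma>. U)"
  proof
    show "toric_points \<Sigma> \<subseteq> (\<Union>(U, \<phi>)\<in>toric_charts \<Sigma>. U)"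
    proof
      fix x assume "x \<in> toric_points \<Sigma>"
      then obtain \<tau> where t: "\<tau> \<in> \<Sigma>" "x \<in> orb \<tau>" by (auto simp: toric_points_def)
      then have "smooth_cone \<tau>" using F by (simp add: face_closed_def)
      then obtain B C J where c: "mutual_inverse B C" "\<tau> = lcone B J"
        unfolding smooth_cone_lcone by blast
      then have c: "tchart \<Sigma> B C J" "\<tau> = lcone B J" using t by (auto simp: tchart_def)
      then have "x \<in> affine_piece \<Sigma> (lcone B J)" unfolding affine_piece_lcone[OF F c(1)] using t by blast
      moreover have "(affine_piece \<Sigma> (lcone B J), tcoord C) \<in> toric_charts \<Sigma>"
        unfolding toric_charts_iff using c by blast
      ultimately show "x \<in> (\<Union>(U, \<phi>)\<in>toric_charts \<Sigma>. U)" by blast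
    qed
    show "(\<Union>(U, \<phi>)\<in>toric_charts \<Sigma>. U) \<subseteq> toric_points \<Sigma>"
      by (auto simp: toric_charts_iff affine_piece_def toric_points_def)
  qed
  have ch: "\<exists>B C J. tchart \<Sigma> B C J \<and> U = affine_piece \<Sigma> (lcone B J) \<and> \<phi> = tcoord C" if "(U, \<phi>) \<in> toric_charts \<Sigma>" for U \<phi>
    using that unfolding toric_charts_iff by blast
  have inj: "inj_on \<phi> U" if "(U, \<phi>) \<in> toric_charts \<Sigma>" for U \<phi>
    using ch[OF that] tcoord_inj(1)[OF F] by auto
  have opn: "open (\<phi> ` (U \<inter> V))"
    if U: "(U, \<phi>) \<in> toric_charts \<Sigma>" and V: "(V, \<psi>) \<in> toric_charts \<Sigma>" for U \<phi> V \<psi>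
    using ch[OF U] ch[OF V] toric_chart_open[OF F] by auto
  have trans: "cdiffv (\<psi> \<circ> inv_into U \<phi>) (\<phi> x)"
    if U: "(U, \<phi>) \<in> toric_charts \<Sigma>" and V: "(V, \<psi>) \<in> toric_charts \<Sigma>" and x: "x \<in> U" "x \<in> V" for U \<phi> V \<psi> x
  proof -
    obtain B C J where U': "tchart \<Sigma> B C J" "U = affine_piece \<Sigma> (lcone B J)" "\<phi> = tcoord C" using ch[OF U] by blast
    obtain B' C' J' where V': "tchart \<Sigma> B' C' J'" "V = affine_piece \<Sigma> (lcone B' J')" "\<psi> = tcoord C'" using ch[OF V] by blast
    show ?thesis unfolding U' V' by (rule toric_chart_trans[OF F U'(1) V'(1)]) (use x U' V' in auto)
  qed
  note * = atlas_from_charts[OF P inj opn trans toric_variety_def]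
  show "atlas (toric_variety \<Sigma>)" by (rule *(1))
  show "carrier (toric_variety \<Sigma>) = toric_points \<Sigma>" by (rule *(2))
qed

lemma mutual_inverse_mat1: "mutual_inverse (mat 1) (mat 1)"
  by (simp add: mutual_inverse_def)

text \<open>On the torus the coordinates of any chart form a monomial map, so
  \<open>monomial_map_jac\<close> governs the passage from torus coordinates to those of the
  chart.\<close>

lemma tcoord_torus_emb: "tcoord C (torus_emb t) = monomial_map 1 C t"
  by (simp add: tcoord_def torus_emb_def monomial_map_def character_def row_def vec_eq_iff)

lemma torus_emb_tpt:
  fixes t :: "complex^'n"
  assumes "t \<in> torus" shows "torus_emb t = tpt (mat 1) t"
proof -
  have "lpair m (mat 1) k = m $ k" for m :: "int^'n" and k
    by (simp add: lpair_def mat_def if_distrib cong: if_cong)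
  then show ?thesis using assms
    by (simp add: torus_emb_def tpt_def torus_def character_def lcone_empty[OF mutual_inverse_mat1])
qed

lemma orb_0: "orb {0} = (torus_emb ` torus :: 'n::finite tpoint set)" (is "?L = ?R")
proof
  show "?L \<subseteq> ?R"
  proof
    fix x :: "'n tpoint" assume x: "x \<in> ?L"
    then have "x \<in> orb (lcone (mat 1) {})" by (simp add: lcone_empty[OF mutual_inverse_mat1])
    note * = orb_tcoord[OF mutual_inverse_mat1 this]
    have "tcoord (mat 1) x \<in> torus" using *(1) by (auto simp: torus_def)
    then show "x \<in> ?R" using *(2) torus_emb_tpt by (metis image_eqI)
  qed
  show "?R \<subseteq> ?L"
  proof (rule image_subsetI)
    fix t :: "complex^'n" assume t: "t \<in> torus"
    then have "{k. t $ k = 0} = {}" by (auto simp: torus_def)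
    then show "torus_emb t \<in> ?L"
      using tpt_orb[OF mutual_inverse_mat1, of t] by (simp add: torus_emb_tpt[OF t] lcone_empty[OF mutual_inverse_mat1])
  qed
qed

lemma affine_pieceE:
  assumes "face_closed \<Sigma>" "tchart \<Sigma> B C J" "x \<in> affine_piece \<Sigma> (lcone B J)"
  obtains K where "K \<subseteq> J" "x \<in> orb (lcone B K)"
  using assms(3) unfolding affine_piece_lcone[OF assms(1,2)] by (elim exE conjE)

lemma orb_fst: "x \<in> orb \<tau> \<Longrightarrow> fst x = \<tau>"
  unfolding orb_def by (cases x) simp

lemma orb_unique:
  assumes "x \<in> orb \<tau>" shows "x \<in> orb \<tau>' \<longleftrightarrow> \<tau> = \<tau>'"
  using assms orb_fst[of x \<tau>] orb_fst[of x \<tau>'] by metis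

lemma orb_0_tcoord:
  assumes F: "face_closed \<Sigma>" and c: "tchart \<Sigma> B C J" and x: "x \<in> affine_piece \<Sigma> (lcone B J)"
  shows "x \<in> orb {0} \<longleftrightarrow> (\<forall>k. tcoord C x $ k \<noteq> 0)"
proof -
  have BC: "mutual_inverse B C" using c by (auto simp: tchart_def)
  obtain K where K: "x \<in> orb (lcone B K)" by (rule affine_pieceE[OF F c x])
  have "x \<in> orb {0} \<longleftrightarrow> lcone B K = {0}" by (rule orb_unique[OF K])
  also have "\<dots> \<longleftrightarrow> K = {}" using lcone_inj[OF BC, of K "{}"] lcone_empty[OF BC] by simp
  finally show ?thesis using orb_tcoord(1)[OF BC K] by auto
qed

lemma torus_emb_affine_piece:
  assumes F: "face_closed \<Sigma>" and c: "tchart \<Sigma> B C J" and t: "t \<in> torus"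
  shows "torus_emb t \<in> affine_piece \<Sigma> (lcone B J)"
proof -
  have BC: "mutual_inverse B C" using c by (auto simp: tchart_def)
  have "torus_emb t \<in> orb (lcone B {})" using t orb_0 lcone_empty[OF BC] by auto
  then show ?thesis unfolding affine_piece_lcone[OF F c] by blast
qed

text \<open>Replace the vanishing coordinates outside \<open>K\<close> by one small nonzero number.
  It yields density of the torus, and of a ray's orbit in its coordinate hyperplane.\<close>

lemma open_perturb:
  fixes S :: "(complex^'n) set"
  assumes "open S" "z \<in> S"
  obtains w :: "complex^'n" where "w \<in> S" "\<And>k. k \<in> K \<Longrightarrow> w $ k = z $ k" "\<And>k. k \<notin> K \<Longrightarrow> w $ k \<noteq> 0"
proof -
  define w where "w \<delta> = (\<chi> k. if k \<in> K \<or> z $ k \<noteq> 0 then z $ k else \<delta>)" for \<delta> :: complex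
  have "((\<lambda>\<delta>. w \<delta> $ k) \<longlongrightarrow> z $ k) (at 0)" for k
    by (cases "k \<in> K \<or> z $ k \<noteq> 0") (auto simp: w_def intro: tendsto_ident_at)
  then have "(w \<longlongrightarrow> z) (at 0)" by (rule vec_tendstoI)
  then have "\<forall>\<^sub>F \<delta> in at 0. w \<delta> \<in> S" using assms by (simp add: topological_tendstoD)
  moreover have "\<forall>\<^sub>F \<delta>::complex in at 0. \<delta> \<noteq> 0" by (simp add: eventually_at_filter)
  ultimately have "\<forall>\<^sub>F \<delta> in at 0. w \<delta> \<in> S \<and> \<delta> \<noteq> 0" by (rule eventually_conj)
  from eventually_happens'[OF _ this] obtain \<delta> where "\<delta> \<noteq> 0" "w \<delta> \<in> S" by auto
  then show ?thesis by (intro that[of "w \<delta>"]) (auto simp: w_def)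
qed

lemma toric_perturb:
  assumes F: "face_closed \<Sigma>" and c: "tchart \<Sigma> B C J" and x: "x \<in> affine_piece \<Sigma> (lcone B J)"
    and V: "openin (mtop (toric_variety \<Sigma>)) V" "x \<in> V"
  obtains y where "y \<in> V" "y \<in> affine_piece \<Sigma> (lcone B J)" "\<And>k. k \<in> K \<Longrightarrow> tcoord C y $ k = tcoord C x $ k"
    "\<And>k. k \<notin> K \<Longrightarrow> tcoord C y $ k \<noteq> 0"
proof -
  have ch: "(affine_piece \<Sigma> (lcone B J), tcoord C) \<in> charts (toric_variety \<Sigma>)"
    using c unfolding toric_variety_def toric_charts_iff by auto
  have o: "open (tcoord C ` (affine_piece \<Sigma> (lcone B J) \<inter> V))"
    by (rule chart_Int_open[OF toric_atlas(1)[OF F] ch V(1)])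
  have "tcoord C x \<in> tcoord C ` (affine_piece \<Sigma> (lcone B J) \<inter> V)" using x V by blast
  from open_perturb[OF o this, of K] obtain w where
    w: "w \<in> tcoord C ` (affine_piece \<Sigma> (lcone B J) \<inter> V)" "\<And>k. k \<in> K \<Longrightarrow> w $ k = tcoord C x $ k"
    "\<And>k. k \<notin> K \<Longrightarrow> w $ k \<noteq> 0" by metis
  then obtain y where "y \<in> affine_piece \<Sigma> (lcone B J)" "y \<in> V" "w = tcoord C y" by blast
  with w(2,3) show ?thesis by (intro that[of y]) simp_all
qed

lemma rays_lcone:
  assumes F: "face_closed \<Sigma>" and c: "tchart \<Sigma> B C J" and i: "i \<in> J"
  shows "lcone B {i} \<in> rays \<Sigma>"
proof -
  have BC: "mutual_inverse B C" and S: "lcone B J \<in> \<Sigma>" using c by (auto simp: tchart_def)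
  have "lcone B {i} face_of lcone B J" using lcone_face[OF BC, of "{i}" J] i by simp
  then have "lcone B {i} \<in> \<Sigma>" using F S lcone_nonempty[OF BC] unfolding face_closed_def by blast
  then show ?thesis by (simp add: rays_def dim_lcone[OF BC])
qed

text \<open>In a chart the closed orbit of a ray is the coordinate hyperplane of the corresponding
  generator, or empty if the ray does not span an edge of the cone.\<close>

lemma closure_of_orb_ray:
  assumes F: "face_closed \<Sigma>" and c: "tchart \<Sigma> B C J" and x: "x \<in> affine_piece \<Sigma> (lcone B J)"
    and \<nu>: "\<nu> \<in> rays \<Sigma>"
  shows "x \<in> mtop (toric_variety \<Sigma>) closure_of orb \<nu> \<longleftrightarrow> (\<exists>i\<in>J. \<nu> = lcone B {i} \<and> tcoord C x $ i = 0)"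
proof -
  let ?U = "affine_piece \<Sigma> (lcone B J)" and ?Y = "toric_variety \<Sigma>"
  have BC: "mutual_inverse B C" using c by (auto simp: tchart_def)
  have M: "atlas ?Y" by (rule toric_atlas(1)[OF F])
  have ch: "(?U, tcoord C) \<in> charts ?Y"
    using c unfolding toric_variety_def toric_charts_iff by auto
  have oU: "openin (mtop ?Y) ?U" by (rule atlasD(2)[OF M ch])
  have sub: "?U \<subseteq> carrier ?Y" using openin_subset[OF oU] .
  have orbU: "y \<in> orb (lcone B {i}) \<longleftrightarrow> {k. tcoord C y $ k = 0} = {i}" if yU: "y \<in> ?U" for y i
  proof -
    obtain K where "K \<subseteq> J" and K: "y \<in> orb (lcone B K)" by (rule affine_pieceE[OF F c yU])
    show ?thesis unfolding orb_unique[OF K] lcone_inj[OF BC] orb_tcoord(1)[OF BC K] ..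
  qed
  show ?thesis
  proof
    assume "\<exists>i\<in>J. \<nu> = lcone B {i} \<and> tcoord C x $ i = 0"
    then obtain i where i: "i \<in> J" "\<nu> = lcone B {i}" "tcoord C x $ i = 0" by blast
    show "x \<in> mtop ?Y closure_of orb \<nu>"
      unfolding in_closure_of
    proof (intro conjI allI impI)
      show "x \<in> carrier ?Y" using x sub by blast
      fix T assume T: "x \<in> T \<and> openin (mtop ?Y) T"
      then have T': "openin (mtop ?Y) T" "x \<in> T" by auto
      obtain y where y: "y \<in> T" "y \<in> ?U" "\<And>k. k \<in> {i} \<Longrightarrow> tcoord C y $ k = tcoord C x $ k"
        "\<And>k. k \<notin> {i} \<Longrightarrow> tcoord C y $ k \<noteq> 0"
        using toric_perturb[OF F c x T', where K="{i}"] by metis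
      have "{k. tcoord C y $ k = 0} = {i}" using y(3,4) i(3) by auto
      then have "y \<in> orb \<nu>" unfolding i(2) orbU[OF y(2)] .
      then show "\<exists>y. y \<in> orb \<nu> \<and> y \<in> T" using y(1) by blast
    qed
  next
    assume cl: "x \<in> mtop ?Y closure_of orb \<nu>"
    show "\<exists>i\<in>J. \<nu> = lcone B {i} \<and> tcoord C x $ i = 0"
    proof (rule ccontr)
      assume n: "\<not> ?thesis"
      \<comment> \<open>At most one generator spans \<open>\<nu>\<close>. Where its coordinate is
        nonzero there is no point of the orbit, and this set is open and would contain
        \<open>x\<close>.\<close>
      let ?I = "{i\<in>J. \<nu> = lcone B {i}}"
      let ?V = "{y\<in>?U. tcoord C y \<in> {w. \<forall>k. k \<notin> - ?I \<longrightarrow> w $ k \<noteq> 0}}"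
      have "tcoord C ` ?V = tcoord C ` ?U \<inter> {w. \<forall>k. k \<notin> - ?I \<longrightarrow> w $ k \<noteq> 0}" by blast
      moreover have "open \<dots>" by (intro open_Int open_zero_set atlasD(3)[OF M ch])
      ultimately have "openin (mtop ?Y) ?V" using atlasD(5)[OF M ch, of ?V] by auto
      moreover have "x \<in> ?V" using x n by auto
      ultimately have "\<exists>y. y \<in> orb \<nu> \<and> y \<in> ?V" using cl unfolding in_closure_of by (elim conjE allE[of _ ?V]) simp
      then obtain y where y: "y \<in> orb \<nu>" "y \<in> ?V" by (elim exE conjE)
      have "y \<in> ?U" using y(2) by simp
      from affine_pieceE[OF F c this] obtain K where K: "K \<subseteq> J" "y \<in> orb (lcone B K)" by metis
      have "\<nu> = lcone B K" using y(1) orb_unique[OF K(2), of \<nu>] by simp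
      then have "card K = 1" using \<nu> dim_lcone[OF BC, of K] by (simp add: rays_def)
      then obtain i where i: "K = {i}" using card_1_singletonE by blast
      then have "i \<in> ?I" using K(1) \<open>\<nu> = lcone B K\<close> by simp
      moreover have "tcoord C y $ i = 0" using orb_tcoord(1)[OF BC K(2)] i by auto
      ultimately show False using y(2) by auto
    qed
  qed
qed

lemma toric_torus_dense:
  assumes F: "face_closed \<Sigma>" and V: "openin (mtop (toric_variety \<Sigma>)) V" "V \<noteq> {}"
  shows "V \<inter> orb {0} \<noteq> {}"
proof -
  obtain x where x: "x \<in> V" using V by blast
  then have "x \<in> carrier (toric_variety \<Sigma>)" using openin_subset[OF V(1)] by blast
  then obtain U \<phi> where c: "(U, \<phi>) \<in> charts (toric_variety \<Sigma>)" "x \<in> U" using atlas_chart[OF toric_atlas(1)[OF F]] by blast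
  then have "(U, \<phi>) \<in> toric_charts \<Sigma>" by (simp add: toric_variety_def)
  then obtain B C J where B: "tchart \<Sigma> B C J" "U = affine_piece \<Sigma> (lcone B J)" "\<phi> = tcoord C"
    unfolding toric_charts_iff by blast
  have "x \<in> affine_piece \<Sigma> (lcone B J)" using c B by simp
  obtain y where
    y: "y \<in> V" "y \<in> affine_piece \<Sigma> (lcone B J)" "\<And>k. k \<notin> {} \<Longrightarrow> tcoord C y $ k \<noteq> 0"
    using toric_perturb[OF F B(1) \<open>x \<in> affine_piece \<Sigma> (lcone B J)\<close> V(1) x, where K="{}"] by metis
  then have "y \<in> orb {0}" by (simp add: orb_0_tcoord[OF F B(1) y(2)])
  then show ?thesis using y by blast
qed

subsection \<open>The fan of the universal cover\<close>

lemma smooth_fan_face_closed: "smooth_fan \<Sigma> \<Longrightarrow> face_closed \<Sigma>"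
  by (simp add: smooth_fan_def face_closed_def)

lemma lcone_image: "(*v) (rmat P) ` lcone B K = lcone (P ** B) K"
proof -
  have "rmat P *v rvec (column j B) = rvec (column j (P ** B))" for j
    by (simp add: vec_eq_iff rmat_def rvec_def column_def matrix_vector_mult_def matrix_matrix_mult_def)
  then have "rvec ` (\<lambda>j. column j (P ** B)) ` K = (*v) (rmat P) ` rvec ` (\<lambda>j. column j B) ` K"
    by (simp add: image_image)
  then show ?thesis
    unfolding lcone_def by (simp add: convex_cone_hull_linear_image[symmetric])
qed

lemma mutual_inverse_mult:
  assumes "mutual_inverse P Q" "mutual_inverse B C" shows "mutual_inverse (P ** B) (C ** Q)"
proof -
  have "(P ** B) ** (C ** Q) = P ** ((B ** C) ** Q)" "(C ** Q) ** (P ** B) = C ** ((Q ** P) ** B)"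
    by (simp_all add: matrix_mul_assoc)
  then show ?thesis using assms by (simp add: mutual_inverse_def)
qed

lemma funpow_rmat:
  fixes P :: "int^'n^'n"
  assumes "mutual_inverse P Q"
  shows "\<exists>P' Q'. mutual_inverse P' Q' \<and> ((*v) (rmat P)) ^^ k = (*v) (rmat P')"
proof (induction k)
  case 0
  have "rmat (mat 1 :: int^'n^'n) = mat 1" by (simp add: rmat_def mat_def vec_eq_iff)
  then have "((*v) (rmat P)) ^^ 0 = (*v) (rmat (mat 1 :: int^'n^'n))" by (simp add: fun_eq_iff)
  then show ?case using mutual_inverse_mat1 by blast
next
  case (Suc k)
  then obtain P' Q' where P': "mutual_inverse P' Q'" "((*v) (rmat P)) ^^ k = (*v) (rmat P')" by blast
  have "rmat (P ** P') = rmat P ** rmat P'" by (simp add: rmat_def matrix_matrix_mult_def vec_eq_iff)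
  then have "((*v) (rmat P)) ^^ Suc k = (*v) (rmat (P ** P'))"
    by (simp add: P' fun_eq_iff matrix_vector_mul_assoc)
  then show ?case using mutual_inverse_mult[OF assms P'(1)] by blast
qed

lemma iter_rmat:
  assumes "mutual_inverse A A'"
  shows "\<exists>P Q. mutual_inverse P Q \<and> iter UNIV ((*v) (rmat A)) m = (*v) (rmat P)"
proof -
  have A': "mutual_inverse A' A" using assms by (simp add: mutual_inverse_def)
  have "inv_into UNIV ((*v) (rmat A)) = (*v) (rmat A')"
    by (rule inv_equality) (simp_all add: matrix_vector_mul_assoc mutual_inverse_rmat[OF assms])
  then show ?thesis unfolding iter_def using funpow_rmat[OF assms] funpow_rmat[OF A'] by simp
qed

text \<open>Integral automorphisms map faces to faces. The point to check is that discarding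
  \<open>lcone A UNIV\<close> discards no face of another cone.\<close>

lemma cover_fan_face_closed:
  fixes A :: "int^'n^'n"
  assumes S: "face_closed \<Sigma>" and A: "mutual_inverse A A'"
  shows "face_closed (cover_fan \<Sigma> (lcone A UNIV) A)"
proof -
  have "smooth_cone \<tau>' \<and> (\<forall>\<rho>. \<rho> face_of \<tau>' \<and> \<rho> \<noteq> {} \<longrightarrow> \<rho> \<in> cover_fan \<Sigma> (lcone A UNIV) A)"
    if t': "\<tau>' \<in> cover_fan \<Sigma> (lcone A UNIV) A" for \<tau>'
  proof -
    obtain \<tau> m where t: "\<tau> \<in> \<Sigma>" "\<tau> \<noteq> lcone A UNIV" "\<tau>' = iter UNIV ((*v) (rmat A)) m ` \<tau>"
      using t' unfolding cover_fan_def by blast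
    obtain P Q where P: "mutual_inverse P Q" "iter UNIV ((*v) (rmat A)) m = (*v) (rmat P)" using iter_rmat[OF A] by blast
    have "smooth_cone \<tau>" using S t(1) by (simp add: face_closed_def)
    then obtain B C J where B: "mutual_inverse B C" "\<tau> = lcone B J" unfolding smooth_cone_lcone by blast
    have PB: "mutual_inverse (P ** B) (C ** Q)" by (rule mutual_inverse_mult[OF P(1) B(1)])
    have t2: "\<tau>' = lcone (P ** B) J" unfolding t(3) P(2) B(2) by (rule lcone_image)
    have "\<rho> \<in> cover_fan \<Sigma> (lcone A UNIV) A" if r: "\<rho> face_of \<tau>'" "\<rho> \<noteq> {}" for \<rho>
    proof -
      obtain K where K: "K \<subseteq> J" "\<rho> = lcone (P ** B) K" using face_of_lcone[OF PB] r unfolding t2 by blast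
      have r2: "\<rho> = iter UNIV ((*v) (rmat A)) m ` lcone B K" unfolding K(2) P(2) by (rule lcone_image[symmetric])
      have "lcone B K face_of \<tau>" unfolding B(2) by (rule lcone_face[OF B(1) K(1)])
      then have "lcone B K \<in> \<Sigma>" using S t(1) lcone_nonempty[OF B(1)] unfolding face_closed_def by blast
      \<comment> \<open>A face equal to the discarded cone has full dimension and is therefore the
        whole cone, which was not the discarded one.\<close>
      moreover have "lcone B K \<noteq> lcone A UNIV"
      proof
        assume e: "lcone B K = lcone A UNIV"
        then have "card K = card (UNIV :: 'n set)" using dim_lcone[OF B(1), of K] dim_lcone[OF A, of UNIV] by simp
        then have "K = UNIV" by (simp add: card_subset_eq)
        then have "J = K" using K(1) by blast
        then show False using e B(2) t(2) by simp
      qed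
      ultimately show ?thesis unfolding cover_fan_def r2 by blast
    qed
    moreover have "smooth_cone \<tau>'" unfolding smooth_cone_lcone using PB t2 by blast
    ultimately show ?thesis by blast
  qed
  then show ?thesis unfolding face_closed_def by blast
qed

lemma zero_in_face_closed:
  assumes F: "face_closed \<Sigma>" and "\<Sigma> \<noteq> {}" shows "{0} \<in> \<Sigma>"
proof -
  obtain \<tau> where t: "\<tau> \<in> \<Sigma>" using assms(2) by blast
  then have "smooth_cone \<tau>" using F by (simp add: face_closed_def)
  then obtain B C J where B: "mutual_inverse B C" "\<tau> = lcone B J" unfolding smooth_cone_lcone by blast
  have "lcone B {} face_of \<tau>" unfolding B(2) by (rule lcone_face[OF B(1)]) simp
  then show ?thesis using F t unfolding face_closed_def lcone_empty[OF B(1)] by blast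
qed

lemma zero_in_cover_fan:
  assumes S: "face_closed \<Sigma>" "\<Sigma> \<noteq> {}" and A: "mutual_inverse A A'"
  shows "{0} \<in> cover_fan \<Sigma> (lcone A UNIV) A"
proof -
  have "{0} \<noteq> lcone A UNIV"
    using lcone_inj[OF A, of "{}" UNIV] lcone_empty[OF A] by auto
  then have "{0} \<in> \<Sigma> - {lcone A UNIV}" using zero_in_face_closed[OF S] by blast
  moreover have "{0} = iter UNIV ((*v) (rmat A)) 0 ` {0}" by (simp add: iter_def)
  ultimately show ?thesis unfolding cover_fan_def by blast
qed

section \<open>Restriction and composition of local biholomorphisms\<close>

lemma lbihI:
  assumes "openin (mtop M) V" "openin (mtop N) U" "\<And>x. x \<in> V \<Longrightarrow> f x \<in> U" "\<And>x. x \<in> V \<Longrightarrow> g (f x) = x"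
    "\<And>y. y \<in> U \<Longrightarrow> g y \<in> V" "\<And>y. y \<in> U \<Longrightarrow> f (g y) = y"
    "cont_on_open (mtop M) V (mtop N) f" "cont_on_open (mtop N) U (mtop M) g"
    "\<And>x. x \<in> V \<Longrightarrow> hmap_at M N f x" "\<And>y. y \<in> U \<Longrightarrow> hmap_at N M g y"
  shows "lbih M N V U f g"
  using assms unfolding lbih_def by blast

lemma hmap_at_open_sub_source:
  fixes N :: "('b, 'd::finite) cmanifold"
  assumes M: "atlas M" and U: "openin (mtop M) U" and x: "x \<in> U"
  shows "hmap_at (open_sub M U) N f x \<longleftrightarrow> hmap_at M N f x"
proof -
  have "cdiffv (\<psi> \<circ> f \<circ> inv_into (V \<inter> U) \<phi>) (\<phi> x) \<longleftrightarrow> cdiffv (\<psi> \<circ> f \<circ> inv_into V \<phi>) (\<phi> x)"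
    if c: "(V, \<phi>) \<in> charts M" "x \<in> V" for V \<phi> and \<psi> :: "'b \<Rightarrow> (complex, 'd) vec"
  proof -
    have x': "\<phi> x \<in> \<phi> ` (V \<inter> U)" using c x by blast
    note e = inv_into_chart_Int[OF atlasD(4)[OF M c(1)], of _ U]
    show ?thesis
      by (rule iffI; erule cdiffv_cong_open[OF _ chart_Int_open[OF M c(1) U] x']; simp add: e)
  qed
  then show ?thesis unfolding hmap_at_def ball_charts_open_sub
    by (intro ball_cong refl) (clarsimp simp: x)
qed

lemma hmap_at_open_sub_target:
  assumes "f x \<in> U"
  shows "hmap_at M (open_sub N U) f x \<longleftrightarrow> hmap_at M N f x"
  unfolding hmap_at_def ball_charts_open_sub using assms by simp

lemma lbih_open_sub_right:
  assumes N: "atlas N" and W: "openin (mtop N) W" and b: "lbih M (open_sub N W) V U f g"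
  shows "lbih M N V U f g"
proof -
  have U: "openin (mtop N) U" "U \<subseteq> W" using lbih_cont(2)[OF b] by (simp_all add: openin_open_sub[OF W])
  have c: "cont_on_open (mtop M) V (mtop N) f"
    unfolding cont_on_open_def
  proof (intro allI impI)
    fix S assume "openin (mtop N) S"
    then have "openin (mtop (open_sub N W)) (S \<inter> W)" using W by (simp add: openin_open_sub[OF W] openin_Int)
    then have "openin (mtop M) {x\<in>V. f x \<in> S \<inter> W}" using lbih_cont(3)[OF b] unfolding cont_on_open_def by blast
    moreover have "{x\<in>V. f x \<in> S \<inter> W} = {x\<in>V. f x \<in> S}" using lbihD(2)[OF b] U(2) by blast
    ultimately show "openin (mtop M) {x\<in>V. f x \<in> S}" by simp
  qed
  have c': "cont_on_open (mtop N) U (mtop M) g"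
    using lbih_cont(4)[OF b] by (simp add: cont_on_open_def openin_open_sub[OF W])
  have h: "hmap_at M N f x" if "x \<in> V" for x
    using lbihD(3)[OF b that] lbihD(2)[OF b that] U(2) hmap_at_open_sub_target[of f x W M N] by blast
  have h': "hmap_at N M g y" if "y \<in> U" for y
    using lbihD(3)[OF lbih_sym[OF b] that] U(2) that hmap_at_open_sub_source[OF N W, of y M g] by blast
  show ?thesis
  proof (rule lbihI)
    show "openin (mtop M) V" by (rule lbih_cont(1)[OF b])
  qed (fact U(1) lbihD(2)[OF b] lbihD(1)[OF b] lbihD(2)[OF lbih_sym[OF b]] lbihD(1)[OF lbih_sym[OF b]] c c' h h')+
qed

lemma cont_on_open_compose:
  assumes f: "cont_on_open S V T f" and g: "cont_on_open T U R g" and fV: "\<And>x. x \<in> V \<Longrightarrow> f x \<in> U"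
  shows "cont_on_open S V R (\<lambda>x. g (f x))"
  unfolding cont_on_open_def
proof (intro allI impI)
  fix W assume "openin R W"
  then have "openin T {y\<in>U. g y \<in> W}" using g by (simp add: cont_on_open_def)
  then have "openin S {x\<in>V. f x \<in> {y\<in>U. g y \<in> W}}" using f unfolding cont_on_open_def by blast
  moreover have "{x\<in>V. f x \<in> {y\<in>U. g y \<in> W}} = {x\<in>V. g (f x) \<in> W}" using fV by blast
  ultimately show "openin S {x\<in>V. g (f x) \<in> W}" by simp
qed

lemma lbih_compose:
  assumes M: "atlas M" and N: "atlas N" and P: "atlas P" and b: "lbih M N V U f g" and c: "lbih N P U U' f' g'"
  shows "lbih M P V U' (\<lambda>x. f' (f x)) (\<lambda>y. g (g' y))"
proof -
  note b' = lbih_sym[OF b] and c' = lbih_sym[OF c]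
  have 1: "hmap_at M P (\<lambda>x. f' (f x)) x" if x: "x \<in> V" for x
    by (rule hmap_at_compose[OF M N x lbih_cont(3)[OF b] lbihD(3)[OF b x] lbihD(3)[OF c lbihD(2)[OF b x]]])
      (use lbih_carrier[OF b x] in blast)
  have 2: "hmap_at P M (\<lambda>y. g (g' y)) y" if y: "y \<in> U'" for y
    by (rule hmap_at_compose[OF P N y lbih_cont(3)[OF c'] lbihD(3)[OF c' y] lbihD(3)[OF b' lbihD(2)[OF c' y]]])
      (use lbih_carrier[OF c' y] in blast)
  show ?thesis
  proof (rule lbihI)
    show "openin (mtop M) V" "openin (mtop P) U'" by (fact lbih_cont(1)[OF b] lbih_cont(2)[OF c])+
    show "f' (f x) \<in> U'" "g (g' (f' (f x))) = x" if x: "x \<in> V" for x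
      using lbihD(1,2)[OF b x] lbihD(1,2)[OF c lbihD(2)[OF b x]] by simp_all
    show "g (g' y) \<in> V" "f' (f (g (g' y))) = y" if y: "y \<in> U'" for y
      using lbihD(1,2)[OF c' y] lbihD(1,2)[OF b' lbihD(2)[OF c' y]] by simp_all
    show "cont_on_open (mtop M) V (mtop P) (\<lambda>x. f' (f x))"
      by (rule cont_on_open_compose[OF lbih_cont(3)[OF b] lbih_cont(3)[OF c] lbihD(2)[OF b]])
    show "cont_on_open (mtop P) U' (mtop M) (\<lambda>y. g (g' y))"
      by (rule cont_on_open_compose[OF lbih_cont(4)[OF c] lbih_cont(4)[OF b] lbihD(2)[OF c']])
  qed (fact 1 2)+
qed

section \<open>The Kato manifold: gluing, atlas and compactness\<close>

locale kato =
  fixes M :: "('a, 'n::finite) cmanifold" and \<pi> :: "'a \<Rightarrow> complex^'n" and \<sigma> :: "complex^'n \<Rightarrow> 'a" and \<epsilon> :: real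
  assumes kd: "kato_data M \<pi> \<sigma>" and cw: "collar_width \<pi> \<sigma> \<epsilon>"
begin

lemma atlasM: "atlas M"
  by (rule complex_manifold_atlas) (use kd in \<open>simp add: kato_data_def\<close>)

lemma hausM: "Hausdorff_space (mtop M)"
  using kd by (simp add: kato_data_def complex_manifold_def)

lemma eps: "0 < \<epsilon>" "\<epsilon> < 1" using cw by (auto simp: collar_width_def)

lemma norm_pi_sigma: "norm z \<le> 1 \<Longrightarrow> norm (\<pi> (\<sigma> z)) < 1 - \<epsilon>"
  using cw by (auto simp: collar_width_def image_subset_iff)

definition Bl :: "(complex^'n, 'n) cmanifold" where "Bl = open_sub Cn (ball 0 1)"

lemma openCn: "openin (mtop Cn) (ball 0 1 :: (complex^'n) set)" by (simp add: mtop_Cn)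

lemma carrier_Bl: "carrier Bl = ball 0 1" unfolding Bl_def by (rule carrier_open_sub[OF openCn])

lemma mtop_Bl: "mtop Bl = top_of_set (ball 0 1)" by (simp add: Bl_def open_sub_def mtop_Cn)

lemma atlas_Bl: "atlas Bl" unfolding Bl_def by (rule atlas_open_sub[OF atlas_Cn openCn])

lemma pm: "proper_modification_at M Bl \<pi> 0" using kd by (simp add: kato_data_def Bl_def)

lemma pi_cont: "continuous_map (mtop M) (top_of_set (ball 0 1)) \<pi>"
  using pm by (simp add: proper_modification_at_def holo_map_hmap_at mtop_Bl)

lemma norm_pi: "x \<in> carrier M \<Longrightarrow> norm (\<pi> x) < 1"
  using continuous_map_image_subset_topspace[OF pi_cont] by (auto simp: image_subset_iff)

lemma pi_open: "open S \<Longrightarrow> openin (mtop M) {x\<in>carrier M. \<pi> x \<in> S}"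
proof -
  assume "open S"
  then have "openin (top_of_set (ball 0 1)) (ball 0 1 \<inter> S)" by (rule openin_open_Int)
  from openin_continuous_map_preimage[OF pi_cont this]
  have "openin (mtop M) {x\<in>carrier M. \<pi> x \<in> ball 0 1 \<inter> S}" .
  moreover have "{x\<in>carrier M. \<pi> x \<in> ball 0 1 \<inter> S} = {x\<in>carrier M. \<pi> x \<in> S}" using norm_pi by auto
  ultimately show ?thesis by simp
qed

lemma pi_lbih: "\<exists>g. lbih M Cn {x\<in>carrier M. \<pi> x \<noteq> 0} (ball 0 1 - {0}) \<pi> g"
proof -
  have o1: "openin (mtop M) {x\<in>carrier M. \<pi> x \<noteq> 0}" using pi_open[of "-{0}"] by (simp add: open_Compl)
  have o2: "openin (mtop Bl) (ball 0 1 - {0})"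
    unfolding mtop_Bl by (rule openin_open_eq[THEN iffD2]) (auto simp: open_delete)
  have "biholo (open_sub M {x\<in>carrier M. \<pi> x \<noteq> 0}) (open_sub Bl (carrier Bl - {0})) \<pi>"
    using pm unfolding proper_modification_at_def by blast
  then have "biholo (open_sub M {x\<in>carrier M. \<pi> x \<noteq> 0}) (open_sub Bl (ball 0 1 - {0})) \<pi>" by (simp add: carrier_Bl)
  then obtain g where "lbih M Bl {x\<in>carrier M. \<pi> x \<noteq> 0} (ball 0 1 - {0}) \<pi> g"
    by (rule biholo_lbih[OF atlasM atlas_Bl o1 o2])
  then have "lbih M Cn {x\<in>carrier M. \<pi> x \<noteq> 0} (ball 0 1 - {0}) \<pi> g"
    unfolding Bl_def by (rule lbih_open_sub_right[OF atlas_Cn openCn])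
  then show ?thesis by blast
qed

lemma sigma_lbih: "\<exists>U g. open U \<and> cball 0 1 \<subseteq> U \<and> lbih Cn M U (\<sigma> ` U) \<sigma> g"
proof -
  obtain U where U: "open U" "cball 0 1 \<subseteq> U" "openin (mtop M) (\<sigma> ` U)"
    "biholo (open_sub Cn U) (open_sub M (\<sigma> ` U)) \<sigma>" using kd unfolding kato_data_def by blast
  have oU: "openin (mtop Cn) U" using U by (simp add: mtop_Cn)
  obtain g where "lbih Cn M U (\<sigma> ` U) \<sigma> g" by (rule biholo_lbih[OF atlas_Cn atlasM oU U(3,4)])
  then show ?thesis using U by blast
qed

lemma sigma_inj: "inj_on \<sigma> (cball 0 1)"
proof -
  obtain U g where U: "open U" "cball 0 1 \<subseteq> U" "lbih Cn M U (\<sigma> ` U) \<sigma> g" using sigma_lbih by metis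
  show ?thesis by (rule inj_on_inverseI[where g=g]) (use lbihD(1)[OF U(3)] U(2) in blast)
qed

lemma sigma_open: "open S \<Longrightarrow> S \<subseteq> cball 0 1 \<Longrightarrow> openin (mtop M) (\<sigma> ` S)"
proof -
  assume S: "open S" "S \<subseteq> cball 0 1"
  obtain U g where U: "open U" "cball 0 1 \<subseteq> U" "lbih Cn M U (\<sigma> ` U) \<sigma> g" using sigma_lbih by metis
  show ?thesis by (rule lbih_open_image[OF U(3)]) (use S U in \<open>auto simp: mtop_Cn\<close>)
qed

text \<open>The image of a compact ball in a Hausdorff space. It makes \<open>W\<close>
  open.\<close>

lemma sigma_closed:
  assumes "r \<le> 1" shows "closedin (mtop M) (\<sigma> ` cball 0 r)"
proof -
  obtain U g where U: "open U" "cball 0 1 \<subseteq> U" "lbih Cn M U (\<sigma> ` U) \<sigma> g" using sigma_lbih by metis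
  have sub: "cball 0 r \<subseteq> U" using U(2) assms by (meson order.trans subset_cball)
  have "continuous_map (top_of_set U) (mtop M) \<sigma>"
    unfolding continuous_map
  proof (intro conjI allI impI)
    show "\<sigma> ` topspace (top_of_set U) \<subseteq> carrier M" using lbih_carrier[OF U(3)] by auto
    fix W assume "openin (mtop M) W"
    then have "open {x\<in>U. \<sigma> x \<in> W}" using lbih_cont(3)[OF U(3)] by (simp add: cont_on_open_def mtop_Cn)
    then show "openin (top_of_set U) {x \<in> topspace (top_of_set U). \<sigma> x \<in> W}"
      using U(1) by (simp add: openin_open_eq)
  qed
  then have "compactin (mtop M) (\<sigma> ` cball 0 r)"
    by (rule image_compactin[rotated]) (use sub in \<open>simp add: compactin_subtopology\<close>)
  then show ?thesis by (rule compactin_imp_closedin[OF hausM])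
qed

definition W :: "'a set" where "W = kato_domain M \<sigma> \<epsilon>"

lemma W_def': "W = carrier M - \<sigma> ` cball 0 (1 - \<epsilon>)" by (simp add: W_def kato_domain_def)

lemma openW: "openin (mtop M) W"
  unfolding W_def' by (rule openin_diff) (use sigma_closed[of "1-\<epsilon>"] eps in auto)

lemma W_sub: "W \<subseteq> carrier M" by (auto simp: W_def')

definition outer :: "'a set" where "outer = {x\<in>carrier M. 1 - \<epsilon> < norm (\<pi> x)}"

definition inner :: "'a set" where "inner = \<sigma> ` {z. 1 - \<epsilon> < norm z \<and> norm z < 1}"

definition h :: "'a \<Rightarrow> 'a" where "h x = \<sigma> (\<pi> x)"

lemma outer_W: "outer \<subseteq> W"
proof
  fix x assume x: "x \<in> outer"
  have "x \<notin> \<sigma> ` cball 0 (1 - \<epsilon>)"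
  proof
    assume "x \<in> \<sigma> ` cball 0 (1 - \<epsilon>)"
    then obtain z where "x = \<sigma> z" "norm z \<le> 1 - \<epsilon>" by auto
    then have "norm (\<pi> x) < 1 - \<epsilon>" using norm_pi_sigma[of z] eps by simp
    then show False using x by (simp add: outer_def)
  qed
  then show "x \<in> W" using x by (simp add: outer_def W_def')
qed

lemma outer_iff: "x \<in> W \<Longrightarrow> x \<in> outer \<longleftrightarrow> 1 - \<epsilon> < norm (\<pi> x)"
  using W_sub by (auto simp: outer_def)

lemma inner_W: "inner \<subseteq> W"
proof
  fix x assume "x \<in> inner"
  then obtain z where z: "x = \<sigma> z" "1 - \<epsilon> < norm z" "norm z < 1" by (auto simp: inner_def)
  obtain U g where U: "open U" "cball 0 1 \<subseteq> U" "lbih Cn M U (\<sigma> ` U) \<sigma> g" using sigma_lbih by metis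
  have zU: "z \<in> U" using U(2) z by auto
  have "x \<notin> \<sigma> ` cball 0 (1 - \<epsilon>)"
  proof
    assume "x \<in> \<sigma> ` cball 0 (1 - \<epsilon>)"
    then obtain w where w: "x = \<sigma> w" "norm w \<le> 1 - \<epsilon>" by auto
    then have "z = w" using inj_onD[OF sigma_inj, of z w] z eps by auto
    then show False using w z by simp
  qed
  then show "x \<in> W" using lbih_carrier[OF U(3) zU] z by (simp add: W_def')
qed

lemma inner_pi: "x \<in> inner \<Longrightarrow> norm (\<pi> x) < 1 - \<epsilon>"
  using norm_pi_sigma by (auto simp: inner_def)

text \<open>The choice of the collar width enters here: the gluing map cannot be applied twice, so
  the one-step relation \<open>R\<close> is already transitive.\<close>

lemma inner_not_outer: "x \<in> inner \<Longrightarrow> x \<notin> outer"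
  using inner_pi by (force simp: outer_def)

text \<open>Away from the fibre over 0, \<open>\<pi>\<close> is a biholomorphism and carries the
  outer collar onto the shell; \<open>\<sigma>\<close> carries the shell onto the inner
  collar.\<close>

lemma h_lbih: "\<exists>g. lbih M M outer inner h g"
proof -
  obtain U s where U: "open U" "cball 0 1 \<subseteq> U" "lbih Cn M U (\<sigma> ` U) \<sigma> s" using sigma_lbih by metis
  obtain g where g: "lbih M Cn {x\<in>carrier M. \<pi> x \<noteq> 0} (ball 0 1 - {0}) \<pi> g" using pi_lbih by blast
  have oo: "openin (mtop M) outer"
  proof -
    have "open (- cball 0 (1 - \<epsilon>) :: (complex^'n) set)" by (simp add: open_Compl)
    from pi_open[OF this] show ?thesis by (simp add: outer_def not_le)
  qed
  have sub: "outer \<subseteq> {x\<in>carrier M. \<pi> x \<noteq> 0}" using eps by (auto simp: outer_def)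
  let ?S = "{z :: complex^'n. 1 - \<epsilon> < norm z \<and> norm z < 1}"
  have im: "\<pi> ` outer = ?S"
  proof
    show "\<pi> ` outer \<subseteq> ?S" using norm_pi by (auto simp: outer_def)
    show "?S \<subseteq> \<pi> ` outer"
    proof
      fix z assume z: "z \<in> ?S"
      then have "z \<in> ball 0 1 - {0}" using eps by auto
      then have "g z \<in> carrier M \<and> \<pi> (g z) = z"
        using lbihD(1,2)[OF lbih_sym[OF g]] by auto
      then show "z \<in> \<pi> ` outer" using z by (auto simp: outer_def image_iff intro!: bexI[of _ "g z"])
    qed
  qed
  have 1: "lbih M Cn outer ?S \<pi> g" using lbih_subset[OF g oo sub] unfolding im .
  have S: "?S \<subseteq> U" using U(2) by auto
  have oS: "openin (mtop Cn) ?S" using lbih_cont(2)[OF 1] .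
  have 2: "lbih Cn M ?S inner \<sigma> s" using lbih_subset[OF U(3) oS S] unfolding inner_def .
  show ?thesis using lbih_compose[OF atlasM atlas_Cn atlasM 1 2] unfolding h_def[abs_def] by blast
qed

definition R :: "('a \<times> 'a) set" where "R = glue_rel M \<pi> \<sigma> \<epsilon>"

definition p :: "'a \<Rightarrow> 'a set" where "p = kato_proj M \<pi> \<sigma> \<epsilon>"

lemma p_def': "p x = R `` {x}" by (simp add: p_def R_def kato_proj_def)

lemma R_iff: "(x, y) \<in> R \<longleftrightarrow> x \<in> W \<and> y \<in> W \<and> (x = y \<or> (x \<in> outer \<and> y = h x) \<or> (y \<in> outer \<and> x = h y))"
  unfolding R_def glue_rel_def h_def W_def[symmetric] by (auto simp: outer_iff)

lemma R_equiv: "equiv W R"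
proof -
  obtain g where g: "lbih M M outer inner h g" using h_lbih by blast
  have hin: "h x \<in> inner" if "x \<in> outer" for x using lbihD(2)[OF g that] .
  have hno: "h x \<notin> outer" if "x \<in> outer" for x using hin[OF that] inner_not_outer by blast
  have inj: "x = y" if "x \<in> outer" "y \<in> outer" "h x = h y" for x y
    using lbihD(1)[OF g that(1)] lbihD(1)[OF g that(2)] that(3) by metis
  show ?thesis
  proof (rule equivI)
    show "R \<subseteq> W \<times> W" by (auto simp: R_iff)
    show "refl_on W R" by (auto simp: refl_on_def R_iff)
    show "sym R" by (auto simp: sym_def R_iff)
    show "trans R" unfolding trans_def R_iff using hno inj by blast
  qed
qed

lemma p_eq: "x \<in> W \<Longrightarrow> y \<in> W \<Longrightarrow> p x = p y \<longleftrightarrow> (x, y) \<in> R"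
  unfolding p_def' using eq_equiv_class_iff[OF R_equiv] by blast

lemma p_h: "x \<in> outer \<Longrightarrow> p (h x) = p x"
proof -
  assume x: "x \<in> outer"
  obtain g where g: "lbih M M outer inner h g" using h_lbih by blast
  have "x \<in> W" "h x \<in> W" using x outer_W inner_W lbihD(2)[OF g x] by auto
  then show ?thesis using p_eq[of "h x" x] x by (auto simp: R_iff)
qed

definition X :: "('a set, 'n) cmanifold" where "X = kato_manifold M \<pi> \<sigma> \<epsilon>"

lemma openinX: "openin (mtop X) V \<longleftrightarrow> V \<subseteq> p ` W \<and> openin (mtop M) {x\<in>W. p x \<in> V}"
proof -
  have q: "W // R = p ` W" by (auto simp: quotient_def p_def')
  let ?P = "\<lambda>V. V \<subseteq> p ` W \<and> openin (mtop M) {x\<in>W. p x \<in> V}"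
  have "istopology ?P"
    unfolding istopology_def
  proof (intro conjI allI impI)
    fix S T assume S: "?P S" and T: "?P T"
    show "S \<inter> T \<subseteq> p ` W" using S by blast
    have "{x\<in>W. p x \<in> S \<inter> T} = {x\<in>W. p x \<in> S} \<inter> {x\<in>W. p x \<in> T}" by blast
    then show "openin (mtop M) {x\<in>W. p x \<in> S \<inter> T}" using S T by (simp add: openin_Int)
  next
    fix \<K> assume K: "\<forall>K\<in>\<K>. ?P K"
    show "\<Union>\<K> \<subseteq> p ` W" using K by blast
    have "{x\<in>W. p x \<in> \<Union>\<K>} = \<Union>((\<lambda>K. {x\<in>W. p x \<in> K}) ` \<K>)" by blast
    moreover have "openin (mtop M) \<dots>" using K by (intro openin_Union) auto
    ultimately show "openin (mtop M) {x\<in>W. p x \<in> \<Union>\<K>}" by simp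
  qed
  moreover have "mtop X = topology ?P"
    by (simp add: X_def kato_manifold_def Let_def W_def[symmetric] p_def[symmetric] R_def[symmetric] q)
  ultimately show ?thesis by simp
qed

lemma chartsX: "(V, \<psi>) \<in> charts X \<longleftrightarrow> (\<exists>G U \<phi>. V = p ` G \<and> \<psi> = \<phi> \<circ> inv_into G p \<and> (U, \<phi>) \<in> charts M \<and>
    openin (mtop M) G \<and> G \<subseteq> U \<inter> W \<and> inj_on p G)"
  by (auto simp: X_def kato_manifold_def Let_def W_def p_def)

text \<open>The saturation of \<open>G\<close> adds only the preimage and the image of
  \<open>G\<close> under the gluing map, and both are open.\<close>

lemma p_open: assumes G: "openin (mtop M) G" "G \<subseteq> W" shows "openin (mtop X) (p ` G)"
proof -
  obtain g where g: "lbih M M outer inner h g" using h_lbih by blast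
  have hin: "h x \<in> inner" if "x \<in> outer" for x using lbihD(2)[OF g that] .
  have "{x\<in>W. p x \<in> p ` G} = G \<union> {x\<in>outer. h x \<in> G} \<union> h ` (G \<inter> outer)" (is "?L = ?Rr")
  proof
    show "?L \<subseteq> ?Rr"
    proof
      fix x assume "x \<in> ?L"
      then obtain y where y: "x \<in> W" "y \<in> G" "p x = p y" by auto
      then have "(x, y) \<in> R" using p_eq G(2) by auto
      then show "x \<in> ?Rr" using y unfolding R_iff by auto
    qed
    show "?Rr \<subseteq> ?L"
    proof
      fix x assume "x \<in> ?Rr"
      then consider "x \<in> G" | "x \<in> outer" "h x \<in> G" | y where "x = h y" "y \<in> G" "y \<in> outer" by blast
      then show "x \<in> ?L"
      proof cases
        case 1 then show ?thesis using G by auto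
      next
        case 2 then show ?thesis using p_h[of x] outer_W by (metis (mono_tags, lifting) image_eqI mem_Collect_eq subsetD)
      next
        case 3 then show ?thesis using p_h[of y] hin[of y] inner_W by auto
      qed
    qed
  qed
  moreover have "openin (mtop M) {x\<in>outer. h x \<in> G}" using lbih_cont(3)[OF g] G by (simp add: cont_on_open_def)
  moreover have "openin (mtop M) (h ` (G \<inter> outer))"
    by (rule lbih_open_image[OF g]) (use G lbih_cont(1)[OF g] in auto)
  ultimately have "openin (mtop M) {x\<in>W. p x \<in> p ` G}" using G by (simp add: openin_Un)
  then show ?thesis unfolding openinX using G by blast
qed

lemma carrierX: "carrier X = p ` W"
proof
  show "carrier X \<subseteq> p ` W" unfolding topspace_def openinX by blast
  show "p ` W \<subseteq> carrier X" using openin_subset[OF p_open[OF openW order_refl]] .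
qed

text \<open>A nontrivial identification pairs an outer point with an inner one, so \<open>p\<close>
  is injective on any set that misses one collar. The complement of the closed ball's image misses
  the inner collar; around points of that image the condition on the norm of \<open>\<pi>\<close>
  excludes the outer one.\<close>

lemma p_locally_injective:
  assumes "x \<in> W" shows "\<exists>G. openin (mtop M) G \<and> x \<in> G \<and> G \<subseteq> W \<and> inj_on p G"
proof -
  obtain g where g: "lbih M M outer inner h g" using h_lbih by blast
  have hin: "h x \<in> inner" if "x \<in> outer" for x using lbihD(2)[OF g that] .
  show ?thesis
  proof (cases "x \<in> \<sigma> ` cball 0 1")
    case False
    let ?G = "W - \<sigma> ` cball 0 1"
    have "inj_on p ?G"
    proof (rule inj_onI)
      fix u v assume u: "u \<in> ?G" "v \<in> ?G" "p u = p v"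
      then have "(u, v) \<in> R" using p_eq by auto
      moreover have "u \<notin> inner" "v \<notin> inner" using u by (auto simp: inner_def)
      ultimately show "u = v" using hin unfolding R_iff by blast
    qed
    moreover have "openin (mtop M) ?G" using openin_diff[OF openW sigma_closed[of 1]] by simp
    ultimately show ?thesis using False assms by (intro exI[of _ ?G]) auto
  next
    case True
    let ?G = "W \<inter> {x\<in>carrier M. \<pi> x \<in> ball 0 (1 - \<epsilon>)}"
    have "inj_on p ?G"
    proof (rule inj_onI)
      fix u v assume u: "u \<in> ?G" "v \<in> ?G" "p u = p v"
      then have "(u, v) \<in> R" using p_eq by auto
      moreover have "u \<notin> outer" "v \<notin> outer" using u by (auto simp: outer_def)
      ultimately show "u = v" unfolding R_iff by blast
    qed
    moreover have "openin (mtop M) ?G" using openin_Int[OF openW pi_open[OF open_ball]] .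
    moreover have "x \<in> ?G" using True assms W_sub norm_pi_sigma by auto
    ultimately show ?thesis by blast
  qed
qed

text \<open>Near \<open>y\<close> the identification of \<open>y\<close> with \<open>y'\<close> is the identity, \<open>h\<close> or the inverse of \<open>h\<close>.\<close>

lemma gluing_local:
  assumes "y \<in> W" "y' \<in> W" "p y = p y'"
  shows "\<exists>V k. openin (mtop M) V \<and> y \<in> V \<and> V \<subseteq> W \<and> cont_on_open (mtop M) V (mtop M) k \<and> hmap_at M M k y \<and>
     k y = y' \<and> (\<forall>z\<in>V. k z \<in> W \<and> p (k z) = p z)"
proof -
  obtain g where g: "lbih M M outer inner h g" using h_lbih by blast
  note g' = lbih_sym[OF g]
  have "(y, y') \<in> R" using assms p_eq by blast
  then consider "y = y'" | "y \<in> outer" "y' = h y" | "y' \<in> outer" "y = h y'" unfolding R_iff by blast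
  then show ?thesis
  proof cases
    case 1
    then show ?thesis using openW assms(1) cont_on_open_id[OF openW] hmap_at_id[OF atlasM, of y]
      by (intro exI[of _ W] exI[of _ "\<lambda>x. x"]) simp
  next
    case 2
    have "\<forall>z\<in>outer. h z \<in> W \<and> p (h z) = p z" using lbihD(2)[OF g] inner_W p_h by blast
    then show ?thesis using 2 outer_W lbih_cont(1,3)[OF g] lbihD(3)[OF g, of y]
      by (intro exI[of _ outer] exI[of _ h]) simp
  next
    case 3
    have "\<forall>z\<in>inner. g z \<in> W \<and> p (g z) = p z"
    proof
      fix z assume z: "z \<in> inner"
      then have gz: "g z \<in> outer" "h (g z) = z" using lbihD(1,2)[OF g'] by blast+
      then show "g z \<in> W \<and> p (g z) = p z" using outer_W p_h[OF gz(1)] by auto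
    qed
    moreover have "y \<in> inner" "g y = y'" using 3 lbihD(1,2)[OF g] by auto
    ultimately show ?thesis using inner_W lbih_cont(2,4)[OF g] lbihD(3)[OF g', of y]
      by (intro exI[of _ inner] exI[of _ g]) simp
  qed
qed

lemma atlasX: "atlas X"
proof (rule atlasI)
  show "carrier X = (\<Union>(U, \<phi>)\<in>charts X. U)"
  proof
    show "carrier X \<subseteq> (\<Union>(U, \<phi>)\<in>charts X. U)"
    proof
      fix z assume "z \<in> carrier X"
      then obtain x where x: "x \<in> W" "z = p x" unfolding carrierX by blast
      obtain G where G: "openin (mtop M) G" "x \<in> G" "G \<subseteq> W" "inj_on p G" using p_locally_injective[OF x(1)] by blast
      have "x \<in> carrier M" using x W_sub by blast
      then obtain U \<phi> where U: "(U, \<phi>) \<in> charts M" "x \<in> U" by (rule atlas_chart[OF atlasM])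
      let ?G = "G \<inter> U"
      have "openin (mtop M) ?G" using G(1) atlasD(2)[OF atlasM U(1)] by (rule openin_Int)
      moreover have "inj_on p ?G" using G(4) by (rule inj_on_subset) blast
      ultimately have "(p ` ?G, \<phi> \<circ> inv_into ?G p) \<in> charts X"
        unfolding chartsX using U(1) G(3) by (intro exI[of _ ?G] exI[of _ U] exI[of _ \<phi>]) auto
      moreover have "z \<in> p ` ?G" using x U G by blast
      ultimately show "z \<in> (\<Union>(U, \<phi>)\<in>charts X. U)" by blast
    qed
    show "(\<Union>(U, \<phi>)\<in>charts X. U) \<subseteq> carrier X"
      unfolding carrierX by (auto simp: chartsX intro!: imageI)
  qed
  fix V \<psi> assume "(V, \<psi>) \<in> charts X"
  then obtain G U \<phi> where V: "V = p ` G" "\<psi> = \<phi> \<circ> inv_into G p" "(U, \<phi>) \<in> charts M"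
    "openin (mtop M) G" "G \<subseteq> U \<inter> W" "inj_on p G" unfolding chartsX by blast
  have i\<phi>: "inj_on \<phi> U" by (rule atlasD(4)[OF atlasM V(3)])
  have GU: "G \<subseteq> U" and GW: "G \<subseteq> W" using V(5) by auto
  have \<psi>p: "\<psi> (p x) = \<phi> x" if "x \<in> G" for x using V(2,6) that by simp
  have im: "\<psi> ` (p ` S) = \<phi> ` S" if "S \<subseteq> G" for S using \<psi>p that by (force simp: image_iff)
  have oG: "openin (mtop M) S \<longleftrightarrow> open (\<phi> ` S)" if "S \<subseteq> G" for S
    by (rule atlasD(5)[OF atlasM V(3)]) (use that GU in blast)
  have inj: "inj_on \<psi> V"
    unfolding V(1)
  proof (rule inj_onI, clarify)
    fix x y assume "x \<in> G" "y \<in> G" "\<psi> (p x) = \<psi> (p y)"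
    then show "p x = p y" using \<psi>p inj_onD[OF i\<phi>, of x y] GU by auto
  qed
  show opn: "openin (mtop X) S = open (\<psi> ` S)" if "S \<subseteq> V" for S
  proof -
    let ?S = "{x\<in>G. p x \<in> S}"
    have S: "p ` ?S = S" using that V(1) by blast
    have "openin (mtop X) S \<longleftrightarrow> openin (mtop M) ?S"
    proof
      assume "openin (mtop X) S"
      then have "openin (mtop M) (G \<inter> {x\<in>W. p x \<in> S})" using V(4) unfolding openinX by (simp add: openin_Int)
      moreover have "G \<inter> {x\<in>W. p x \<in> S} = ?S" using GW by blast
      ultimately show "openin (mtop M) ?S" by simp
    next
      assume "openin (mtop M) ?S"
      from p_open[OF this] show "openin (mtop X) S" unfolding S using GW by blast
    qed
    also have "\<dots> \<longleftrightarrow> open (\<phi> ` ?S)" by (rule oG) blast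
    also have "\<phi> ` ?S = \<psi> ` S" using im[of ?S] S by auto
    finally show ?thesis .
  qed
  show "openin (mtop X) V \<and> open (\<psi> ` V) \<and> inj_on \<psi> V"
    using inj opn[of V] p_open[OF V(4) GW] V(1) by simp
  fix V' \<psi>' x assume V': "(V', \<psi>') \<in> charts X" and x: "x \<in> V" "x \<in> V'"
  then obtain G' U' \<phi>' where V': "V' = p ` G'" "\<psi>' = \<phi>' \<circ> inv_into G' p" "(U', \<phi>') \<in> charts M"
    "openin (mtop M) G'" "G' \<subseteq> U' \<inter> W" "inj_on p G'" unfolding chartsX by blast
  obtain y y' where y: "y \<in> G" "x = p y" "y' \<in> G'" "x = p y'" using x V(1) V'(1) by blast
  have "y \<in> W" "y' \<in> W" "p y = p y'" using y V(5) V'(5) by auto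
  \<comment> \<open>The representatives \<open>y\<close> and \<open>y'\<close> of \<open>x\<close>
    may differ. The local gluing map \<open>k\<close> joins them, and the transition of the two
    charts of \<open>X\<close> is \<open>k\<close> read in charts of the total space.\<close>
  from gluing_local[OF this] obtain N k where N: "openin (mtop M) N" "y \<in> N" "N \<subseteq> W"
    "cont_on_open (mtop M) N (mtop M) k" "hmap_at M M k y" "k y = y'" "\<forall>z\<in>N. k z \<in> W \<and> p (k z) = p z" by metis
  have yU: "y \<in> U" "k y \<in> U'" using y GU V'(5) N(6) by auto
  have d: "cdiffv (\<phi>' \<circ> k \<circ> inv_into U \<phi>) (\<phi> y)" by (rule hmap_atD[OF N(5) V(3) V'(3) yU])
  let ?S = "G \<inter> {z\<in>N. k z \<in> G'}"
  have "openin (mtop M) {z\<in>N. k z \<in> G'}" using N(4) V'(4) by (simp add: cont_on_open_def)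
  then have "openin (mtop M) ?S" using V(4) by (simp add: openin_Int)
  then have oS: "open (\<phi> ` ?S)" using oG[of ?S] by blast
  have yS: "\<phi> y \<in> \<phi> ` ?S" using y N by auto
  have "cdiffv (\<psi>' \<circ> inv_into V \<psi>) (\<phi> y)"
  proof (rule cdiffv_cong_open[OF d oS yS])
    fix w assume "w \<in> \<phi> ` ?S"
    then obtain z where z: "z \<in> G" "z \<in> N" "k z \<in> G'" "w = \<phi> z" by blast
    have 1: "inv_into U \<phi> w = z" using z GU i\<phi> by auto
    have "inv_into V \<psi> (\<psi> (p z)) = p z" by (rule inv_into_f_f[OF inj]) (use z V(1) in blast)
    then have 2: "inv_into V \<psi> w = p z" using \<psi>p[OF z(1)] z(4) by simp
    have "inv_into G' p (p (k z)) = k z" by (rule inv_into_f_f[OF V'(6) z(3)])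
    then have "\<psi>' (p z) = \<phi>' (k z)" using V'(2) N(7) z(2) by simp
    then show "(\<phi>' \<circ> k \<circ> inv_into U \<phi>) w = (\<psi>' \<circ> inv_into V \<psi>) w" by (simp add: 1 2)
  qed
  then show "cdiffv (\<psi>' \<circ> inv_into V \<psi>) (\<psi> x)" using \<psi>p[OF y(1)] y(2) by simp
qed

text \<open>Cutting in the middle of the collars gives a set \<open>?K\<close> between two spheres
  that is compact, by properness of \<open>\<pi>\<close>, and meets every class.\<close>

lemma compactX: "compact_space (mtop X)"
proof -
  \<comment> \<open>Any radius strictly between \<open>1 - \<epsilon>\<close> and 1 has the required
    effect: both cuts then lie inside the collars.\<close>
  let ?r = "1 - \<epsilon> / 2"
  have r: "0 < ?r" "?r < 1" "1 - \<epsilon> < ?r" using eps by auto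
  let ?Q = "{x\<in>carrier M. \<pi> x \<in> cball 0 ?r}" let ?K = "(carrier M - \<sigma> ` ball 0 ?r) \<inter> ?Q"
  have "proper_map (mtop M) (top_of_set (ball 0 1)) \<pi>" using pm by (simp add: proper_modification_at_def mtop_Bl)
  moreover have "compactin (top_of_set (ball 0 1)) (cball 0 ?r :: (complex^'n) set)"
    unfolding compactin_subtopology using r by auto
  ultimately have k0: "compactin (mtop M) ?Q" by (rule compactin_proper_map_preimage)
  have cl: "closedin (mtop M) (carrier M - \<sigma> ` ball 0 ?r)"
  proof (rule closedin_diff)
    have "ball 0 ?r \<subseteq> (cball 0 1 :: (complex^'n) set)"
    proof
      fix x :: "complex^'n" assume "x \<in> ball 0 ?r"
      then have "norm x < ?r" by simp
      then show "x \<in> cball 0 1" using r by simp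
    qed
    from sigma_open[OF open_ball this] show "openin (mtop M) (\<sigma> ` ball 0 ?r)" .
  qed simp
  have K: "compactin (mtop M) ?K" by (rule closed_Int_compactin[OF cl k0])
  have KW: "?K \<subseteq> W" using r unfolding W_def' by force
  have "continuous_map (subtopology (mtop M) W) (mtop X) p"
    unfolding continuous_map
  proof (intro conjI allI impI)
    show "p ` topspace (subtopology (mtop M) W) \<subseteq> carrier X" unfolding carrierX by auto
    fix V assume "openin (mtop X) V"
    then have "openin (mtop M) {x\<in>W. p x \<in> V}" by (simp add: openinX)
    moreover have "topspace (subtopology (mtop M) W) = W" using W_sub by auto
    ultimately show "openin (subtopology (mtop M) W) {x \<in> topspace (subtopology (mtop M) W). p x \<in> V}"
      using openW by (simp add: openin_open_subtopology)
  qed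
  then have cK: "compactin (mtop X) (p ` ?K)"
    by (rule image_compactin[rotated]) (use K KW in \<open>simp add: compactin_subtopology\<close>)
  have sub: "p ` W \<subseteq> p ` ?K"
  proof
    fix z assume "z \<in> p ` W"
    then obtain x where x: "x \<in> W" "z = p x" by blast
    have xM: "x \<in> carrier M" using x W_sub by blast
    obtain g where g: "lbih M M outer inner h g" using h_lbih by blast
    show "z \<in> p ` ?K"
    proof (cases "x \<in> \<sigma> ` ball 0 ?r")
      case True
      then obtain w where w: "x = \<sigma> w" "norm w < ?r" by auto
      have "\<not> norm w \<le> 1 - \<epsilon>" using x(1) w unfolding W_def' by auto
      then have "x \<in> inner" using w r unfolding inner_def by auto
      \<comment> \<open>A point too close to the removed ball is replaced by its partner in the
        outer collar, where the norm of \<open>\<pi>\<close> is the norm of \<open>w\<close>, below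
        \<open>?r\<close>.\<close>
      then have gx: "g x \<in> outer" "h (g x) = x" using lbihD(1,2)[OF lbih_sym[OF g]] by blast+
      have "\<pi> (g x) \<in> cball 0 1" using norm_pi[of "g x"] gx(1) by (auto simp: outer_def)
      then have pw: "\<pi> (g x) = w"
        using gx(2) w r inj_onD[OF sigma_inj, of "\<pi> (g x)" w] by (auto simp: h_def)
      have "g x \<notin> \<sigma> ` ball 0 ?r"
      proof
        assume "g x \<in> \<sigma> ` ball 0 ?r"
        then have "norm (\<pi> (g x)) < 1 - \<epsilon>" using norm_pi_sigma r by auto
        then show False using gx(1) by (auto simp: outer_def)
      qed
      then have "g x \<in> ?K" using gx(1) pw w by (auto simp: outer_def)
      moreover have "p (g x) = z" using p_h[OF gx(1)] gx(2) x(2) by simp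
      ultimately show ?thesis by blast
    next
      case False
      show ?thesis
      proof (cases "norm (\<pi> x) \<le> ?r")
        case True
        then have "x \<in> ?K" using False xM by simp
        then show ?thesis using x by blast
      next
        case n: False
        then have xo: "x \<in> outer" using r xM by (auto simp: outer_def)
        \<comment> \<open>A point too close to the outer boundary is replaced by its partner in the
          inner collar.\<close>
        have hx: "h x \<in> inner" by (rule lbihD(2)[OF g xo])
        have "norm (\<pi> (h x)) \<le> ?r" using inner_pi[OF hx] r by simp
        moreover have "h x \<notin> \<sigma> ` ball 0 ?r"
        proof
          assume "h x \<in> \<sigma> ` ball 0 ?r"
          then obtain w where w: "h x = \<sigma> w" "norm w < ?r" by auto
          then have "\<pi> x = w" using inj_onD[OF sigma_inj, of "\<pi> x" w] norm_pi[OF xM] r by (auto simp: h_def)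
          then show False using n w by simp
        qed
        moreover have "h x \<in> carrier M" using hx inner_W W_sub by blast
        ultimately have "h x \<in> ?K" by simp
        then show ?thesis using p_h[OF xo] x(2) by blast
      qed
    qed
  qed
  have "carrier X = p ` ?K" unfolding carrierX by (rule subset_antisym[OF sub image_mono[OF KW]])
  with cK have "compactin (mtop X) (carrier X)" by simp
  then show ?thesis by (simp add: compact_space_def)
qed

lemma X_nonempty: "carrier X \<noteq> {}"
proof -
  obtain g where g: "lbih M Cn {x\<in>carrier M. \<pi> x \<noteq> 0} (ball 0 1 - {0}) \<pi> g" using pi_lbih by blast
  \<comment> \<open>A point of the punctured ball whose norm lies in the collar; its preimage under
    \<open>\<pi>\<close> is in \<open>outer\<close>.\<close>
  let ?z = "of_real (1 - \<epsilon>/2) *s axis undefined 1 :: complex^'n"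
  have "norm ?z = norm (of_real (1 - \<epsilon>/2) :: complex)" by (simp only: norm_smult_complex norm_complex_axis mult_1_right)
  then have n: "norm ?z = 1 - \<epsilon>/2" unfolding norm_of_real using eps by simp
  then have z: "?z \<in> ball 0 1 - {0}" using eps by auto
  have "\<pi> (g ?z) = ?z" "g ?z \<in> carrier M" using lbihD(1,2)[OF lbih_sym[OF g] z] by auto
  then have "g ?z \<in> outer" using n eps by (simp add: outer_def)
  then show ?thesis using outer_W unfolding carrierX by blast
qed

end

section \<open>The universal cover and its torus chart\<close>

text \<open>The cover enters as an open subset \<open>Om\<close> of a toric variety in which the
  basin is dense; \<open>A'\<close> is the inverse of \<open>A\<close>. The exact shape of
  \<open>Om\<close>, the interior of a closure, returns only when it is shown to leave the
  torus.\<close>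

locale tcover =
  fixes S :: "(real^'n::finite) set set" and Om :: "'n tpoint set" and lam :: "complex^'n" and A A' :: "int^'n^'n"
    and X :: "('b, 'n) cmanifold" and q :: "'n tpoint \<Rightarrow> 'b" and \<gamma> :: "'n tpoint \<Rightarrow> 'n tpoint"
    and E :: "('n tpoint, 'n) cmanifold"
  assumes F: "face_closed S" and Om: "openin (mtop (toric_variety S)) Om" and zS: "{0} \<in> S"
    and E: "E = open_sub (toric_variety S) Om"
    and X: "atlas X" and uc: "universal_cover_with_generator E X q \<gamma>" and ext: "extends_to_cover E lam A \<gamma>"
    and dens: "Om \<subseteq> mtop (toric_variety S) closure_of (torus_emb ` torus_basin lam A)"
    and lam: "lam \<in> torus" and A: "mutual_inverse A A'"
begin

lemma atlasE: "atlas E" unfolding E by (rule atlas_open_sub[OF toric_atlas(1)[OF F] Om])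

lemma carrierE: "carrier E = Om" unfolding E by (rule carrier_open_sub[OF Om])

lemma openinE: "openin (mtop E) V \<longleftrightarrow> openin (mtop (toric_variety S)) V \<and> V \<subseteq> Om"
  unfolding E by (rule openin_open_sub[OF Om])

lemma openE: "openin (mtop E) Om" by (simp add: openinE Om)

definition tU :: "int^'n^'n \<Rightarrow> 'n set \<Rightarrow> 'n tpoint set" where
  "tU B J = affine_piece S (lcone B J) \<inter> Om"

lemma chartE: "tchart S B C J \<Longrightarrow> (tU B J, tcoord C) \<in> charts E"
  unfolding E charts_open_sub tU_def toric_variety_def by (auto simp: toric_charts_iff)

lemma tU_cover:
  assumes "y \<in> Om" obtains B C J where "tchart S B C J" "y \<in> tU B J"
proof -
  have "y \<in> carrier (toric_variety S)" using assms openin_subset[OF Om] by blast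
  then obtain U \<phi> where c: "(U, \<phi>) \<in> charts (toric_variety S)" "y \<in> U" by (rule atlas_chart[OF toric_atlas(1)[OF F]])
  then have "(U, \<phi>) \<in> toric_charts S" by (simp add: toric_variety_def)
  then obtain B C J where "tchart S B C J" "U = affine_piece S (lcone B J)" unfolding toric_charts_iff by blast
  then show ?thesis using c assms by (intro that[of B C J]) (auto simp: tU_def)
qed

text \<open>The zero cone with the standard basis. Its chart is the torus in its own coordinates,
  the reference chart for the logarithmic form.\<close>

lemma tchart0: "tchart S (mat 1) (mat 1) {}"
  by (simp add: tchart_def mutual_inverse_mat1 lcone_empty[OF mutual_inverse_mat1] zS)

definition T0 :: "'n tpoint set" where "T0 = orb {0} \<inter> Om"

lemma tU0: "tU (mat 1) {} = T0"
proof -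
  have "x \<in> affine_piece S (lcone (mat 1) {}) \<longleftrightarrow> x \<in> orb {0}" for x
    unfolding affine_piece_lcone[OF F tchart0] by (simp add: lcone_empty[OF mutual_inverse_mat1])
  then show ?thesis by (auto simp: tU_def T0_def)
qed

abbreviation tc :: "'n tpoint \<Rightarrow> complex^'n" where "tc \<equiv> tcoord (mat 1)"

lemma chart0: "(T0, tc) \<in> charts E" using chartE[OF tchart0] by (simp add: tU0)

lemma T0_sub: "T0 \<subseteq> Om" by (auto simp: T0_def)

lemma monomial_map_1: "monomial_map 1 (mat 1) t = t" for t :: "complex^'n"
proof -
  have "(\<Prod>k\<in>UNIV. t $ k powi (mat 1 :: int^'n^'n) $ j $ k) = (\<Prod>k\<in>UNIV. if k = j then t $ k else 1)" for j
    by (rule prod.cong) (auto simp: mat_def)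
  then show ?thesis by (simp add: monomial_map_def vec_eq_iff)
qed

lemma tc_emb: "tc (torus_emb t) = t"
  by (simp add: tcoord_torus_emb monomial_map_1)

lemma T0E:
  assumes "y \<in> T0" shows "tc y \<in> torus" "y = torus_emb (tc y)"
proof -
  obtain t where t: "y = torus_emb t" "t \<in> torus" using assms unfolding T0_def orb_0 by blast
  then show "tc y \<in> torus" "y = torus_emb (tc y)" by (simp_all add: tc_emb)
qed

lemma T0_iff:
  assumes "tchart S B C J" "y \<in> tU B J" shows "y \<in> T0 \<longleftrightarrow> (\<forall>k. tcoord C y $ k \<noteq> 0)"
  using orb_0_tcoord[OF F assms(1), of y] assms(2) by (simp add: T0_def tU_def)

lemma T0_dense: "openin (mtop E) V \<Longrightarrow> V \<noteq> {} \<Longrightarrow> \<exists>y\<in>V. y \<in> T0"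
  using toric_torus_dense[OF F, of V] unfolding openinE T0_def by blast

text \<open>Identities of holomorphic functions on the cover need checking only on the torus, where
  \<open>logjac\<close> and the generator have explicit formulas.\<close>

lemma holo_eq_T0:
  assumes "holo_fun E U f" "holo_fun E U g" "\<And>y. y \<in> U \<Longrightarrow> y \<in> T0 \<Longrightarrow> f y = g y" "y \<in> U"
  shows "f y = g y"
proof (rule holo_fun_eq_dense[OF atlasE assms(1,2) _ assms(4)])
  fix V assume V: "openin (mtop E) V" "V \<subseteq> U" "V \<noteq> {}"
  obtain y where "y \<in> V" "y \<in> T0" using T0_dense[OF V(1,3)] by blast
  then show "\<exists>x\<in>V. f x = g x" using assms(3)[of y] V(2) by blast
qed

lemma tcoord_holo:
  assumes c: "tchart S B C J" and y: "y \<in> tU B J" shows "holo_at E (\<lambda>y. tcoord C y $ i) y"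
proof (rule holo_at_chart[OF atlasE chartE[OF c] y])
  have "cdiff (\<lambda>w. w $ i) (tcoord C y)" by (rule cdiff_nth)
  then show "cdiff ((\<lambda>y. tcoord C y $ i) \<circ> inv_into (tU B J) (tcoord C)) (tcoord C y)"
    by (rule cdiff_cong_open[OF _ atlasD(3)[OF atlasE chartE[OF c]]]) (use y in \<open>auto simp: f_inv_into_f\<close>)
qed

subsection \<open>The covering map\<close>

lemma cov: "holo_covering E X q" using uc by (simp add: universal_cover_with_generator_def)

lemma q_local:
  assumes y: "y \<in> Om" shows "\<exists>V U g. y \<in> V \<and> lbih E X V U q g"
proof -
  have "q ` carrier E = carrier X" using cov by (simp add: holo_covering_def)
  then have "q y \<in> carrier X" using y by (auto simp: carrierE)
  then obtain U \<V> where U: "openin (mtop X) U" "q y \<in> U" "\<Union>\<V> = {x\<in>carrier E. q x \<in> U}"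
    "\<forall>V\<in>\<V>. openin (mtop E) V \<and> biholo (open_sub E V) (open_sub X U) q"
    using cov unfolding holo_covering_def by meson
  have "y \<in> \<Union>\<V>" using U y by (simp add: carrierE)
  then obtain V where V: "V \<in> \<V>" "y \<in> V" by blast
  obtain g where "lbih E X V U q g" using U(4) V(1) biholo_lbih[OF atlasE X _ U(1)] by metis
  then show ?thesis using V by blast
qed

lemma q_hmap: "y \<in> Om \<Longrightarrow> hmap_at E X q y"
  using q_local lbihD(3) by metis

lemma q_carrier: "y \<in> Om \<Longrightarrow> q y \<in> carrier X"
  using cov by (auto simp: holo_covering_def carrierE)

lemma q_surj: "x \<in> carrier X \<Longrightarrow> \<exists>y\<in>Om. q y = x"
proof -
  have "q ` Om = carrier X" using cov by (simp add: holo_covering_def carrierE)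
  moreover assume "x \<in> carrier X"
  ultimately have "x \<in> q ` Om" by simp
  then show "\<exists>y\<in>Om. q y = x" by blast
qed

lemma q_cont: "cont_on_open (mtop E) Om (mtop X) q"
  unfolding cont_on_open_def
proof (intro allI impI)
  fix W assume W: "openin (mtop X) W"
  show "openin (mtop E) {x\<in>Om. q x \<in> W}"
  proof (subst openin_subopen, clarify)
    fix y assume y: "y \<in> Om" "q y \<in> W"
    obtain V U g where V: "y \<in> V" "lbih E X V U q g" using q_local[OF y(1)] by blast
    have "openin (mtop E) {x\<in>V. q x \<in> W}" using lbih_cont(3)[OF V(2)] W by (simp add: cont_on_open_def)
    moreover have "V \<subseteq> Om" using lbih_cont(1)[OF V(2)] by (simp add: openinE)
    ultimately show "\<exists>T. openin (mtop E) T \<and> y \<in> T \<and> T \<subseteq> {x\<in>Om. q x \<in> W}"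
      using V y by (intro exI[of _ "{x\<in>V. q x \<in> W}"]) auto
  qed
qed

lemma q_preimage: "openin (mtop X) W \<Longrightarrow> openin (mtop E) {y\<in>Om. q y \<in> W}"
  using q_cont by (simp add: cont_on_open_def)

lemma q_chart_preimage: "(U, \<phi>) \<in> charts X \<Longrightarrow> openin (mtop E) {y\<in>Om. q y \<in> U}"
  by (rule q_preimage[OF atlasD(2)[OF X]])

lemma q_cjac_nonzero:
  assumes "y \<in> Om" "(W, \<psi>) \<in> charts E" "y \<in> W" "(U, \<phi>) \<in> charts X" "q y \<in> U"
  shows "cjac W \<psi> q \<phi> y \<noteq> 0"
proof -
  obtain V U' g where V: "y \<in> V" "lbih E X V U' q g" using q_local[OF assms(1)] by blast
  show ?thesis by (rule lbih_cjac_nonzero[OF atlasE X V(2,1) assms(2-5)])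
qed

subsection \<open>The logarithmic volume form\<close>

text \<open>The invariant form \<open>dt\<^sub>1/t\<^sub>1 \<and> \<dots> \<and> dt\<^sub>n/t\<^sub>n\<close> of the torus times \<open>logjac \<phi>\<close> is the pullback of
  \<open>d\<phi>\<^sub>1 \<and> \<dots> \<and> d\<phi>\<^sub>n\<close> under \<open>q\<close>; the value off the torus is the limit.\<close>

definition logjac :: "('b \<Rightarrow> complex^'n) \<Rightarrow> 'n tpoint \<Rightarrow> complex" where
  "logjac \<phi> y = (if y \<in> T0 then (\<Prod>i\<in>UNIV. tc y $ i) * cjac T0 tc q \<phi> y else 0)"

definition detA :: complex where "detA = of_int (det A)"

lemma det_unit:
  assumes "mutual_inverse B C" shows "det B = 1 \<or> det B = -1" "det C = 1 \<or> det C = -1"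
proof -
  have "det B * det C = 1" using assms det_mul[of B C] by (simp add: mutual_inverse_def)
  then show "det B = 1 \<or> det B = -1" "det C = 1 \<or> det C = -1"
    using zmult_eq_1_iff by auto
qed

lemma detA: "detA = 1 \<or> detA = -1"
  using det_unit(1)[OF A] by (auto simp: detA_def)

text \<open>On the torus, change from torus coordinates to those of the chart: the Jacobian of that
  monomial map exchanges the product of the torus coordinates for \<open>det C\<close> times the
  product of the chart coordinates. Off the torus both sides vanish. So \<open>logjac\<close> is
  holomorphic, with the product of coordinates as its divisor.\<close>

lemma logjac_chart:
  assumes c: "tchart S B C J" and y: "y \<in> tU B J" and U: "(U, \<phi>) \<in> charts X" "q y \<in> U"
  shows "logjac \<phi> y = of_int (det C) * (\<Prod>i\<in>UNIV. tcoord C y $ i) * cjac (tU B J) (tcoord C) q \<phi> y"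
proof (cases "y \<in> T0")
  case True
  have yO: "y \<in> Om" using True T0_sub by blast
  let ?t = "tc y"
  have t: "?t \<in> torus" and yt: "y = torus_emb ?t" using T0E[OF True] by blast+
  have nz: "(\<Prod>k\<in>UNIV. ?t $ k) \<noteq> 0" using t by (simp add: torus_def)
  have tC: "tcoord C y = monomial_map 1 C ?t" using tcoord_torus_emb[of C ?t] yt by simp
  have "cjac T0 tc (\<lambda>x. q x) \<phi> y = cjac (tU B J) (tcoord C) q \<phi> y * cjac T0 tc (\<lambda>x. x) (tcoord C) y"
    by (rule cjac_compose[OF atlasE atlasE True cont_on_open_id[OF atlasD(2)[OF atlasE chart0]] hmap_at_id[OF atlasE]
       q_hmap[OF yO] chart0 True chartE[OF c] y U])
  moreover have "cjac T0 tc (\<lambda>x. x) (tcoord C) y = jac (monomial_map 1 C) ?t"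
    unfolding cjac_def
  proof (rule jac_cong_open[OF monomial_map_cdiffv[OF t] atlasD(3)[OF atlasE chart0]])
    show "?t \<in> tc ` T0" using True by blast
    fix w assume "w \<in> tc ` T0"
    then obtain x where x: "x \<in> T0" "w = tc x" by blast
    have "inv_into T0 tc w = x" using x atlasD(4)[OF atlasE chart0] by simp
    moreover have "tcoord C x = monomial_map 1 C (tc x)" using tcoord_torus_emb[of C "tc x"] T0E(2)[OF x(1)] by simp
    ultimately show "monomial_map 1 C w = (tcoord C \<circ> (\<lambda>x. x) \<circ> inv_into T0 tc) w" using x by simp
  qed
  ultimately show ?thesis
    using True nz monomial_map_jac[OF t, of 1 C] by (simp add: logjac_def tC)
next
  case False
  then have "(\<Prod>i\<in>UNIV. tcoord C y $ i) = 0" using T0_iff[OF c y] by (simp add: prod_zero_iff)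
  then show ?thesis using False by (simp add: logjac_def)
qed

text \<open>What remains of \<open>logjac\<close> beside the product of coordinates has no zeros:
  \<open>det C\<close> is 1 or -1, and \<open>q\<close> is a local biholomorphism.\<close>

lemma logjac_unit:
  assumes c: "tchart S B C J" and U: "(U, \<phi>) \<in> charts X"
  shows "unit_fun E (tU B J \<inter> {y\<in>Om. q y \<in> U}) (\<lambda>y. of_int (det C) * cjac (tU B J) (tcoord C) q \<phi> y)"
  unfolding unit_fun_def holo_fun_iff
proof (intro conjI ballI)
  show "openin (mtop E) (tU B J \<inter> {y\<in>Om. q y \<in> U})"
    by (rule openin_Int[OF atlasD(2)[OF atlasE chartE[OF c]] q_chart_preimage[OF U]])
  fix y assume y: "y \<in> tU B J \<inter> {y\<in>Om. q y \<in> U}"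
  have "holo_at E (cjac (tU B J) (tcoord C) q \<phi>) y"
    by (rule cjac_holo_at[OF atlasE X openE q_cont q_hmap chartE[OF c] _ U]) (use y in auto)
  then show "holo_at E (\<lambda>y. of_int (det C) * cjac (tU B J) (tcoord C) q \<phi> y) y"
    by (simp add: holo_at_mult holo_at_const)
  have "det C \<noteq> 0" using det_unit(2) c unfolding tchart_def by fastforce
  moreover have "cjac (tU B J) (tcoord C) q \<phi> y \<noteq> 0"
    by (rule q_cjac_nonzero[OF _ chartE[OF c] _ U]) (use y in auto)
  ultimately show "of_int (det C) * cjac (tU B J) (tcoord C) q \<phi> y \<noteq> 0" by simp
qed

lemma logjac_holo:
  assumes U: "(U, \<phi>) \<in> charts X" shows "holo_fun E {y\<in>Om. q y \<in> U} (logjac \<phi>)"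
  unfolding holo_fun_iff
proof (intro conjI ballI)
  show "openin (mtop E) {y\<in>Om. q y \<in> U}" by (rule q_chart_preimage[OF U])
  fix y assume y: "y \<in> {y\<in>Om. q y \<in> U}"
  then have yO: "y \<in> Om" by blast
  obtain B C J where c: "tchart S B C J" "y \<in> tU B J" by (rule tU_cover[OF yO])
  note u = logjac_unit[OF c(1) U, unfolded unit_fun_def holo_fun_iff]
  have yN: "y \<in> tU B J \<inter> {y\<in>Om. q y \<in> U}" using c y by blast
  have "holo_at E (\<lambda>y. (of_int (det C) * cjac (tU B J) (tcoord C) q \<phi> y) * (\<Prod>i\<in>UNIV. tcoord C y $ i)) y"
  proof (rule holo_at_mult)
    show "holo_at E (\<lambda>y. of_int (det C) * cjac (tU B J) (tcoord C) q \<phi> y) y" using u yN by blast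
  qed (intro holo_at_prod tcoord_holo[OF c])
  then show "holo_at E (logjac \<phi>) y"
    by (rule holo_at_cong[OF atlasE _ _ yN]) (use u logjac_chart[OF c(1) _ U] in auto)
qed

lemma logjac_trans:
  assumes y: "y \<in> Om" and U: "(U, \<phi>) \<in> charts X" "q y \<in> U" and U': "(U', \<phi>') \<in> charts X" "q y \<in> U'"
  shows "logjac \<phi>' y = cjac U \<phi> (\<lambda>x. x) \<phi>' (q y) * logjac \<phi> y"
proof (cases "y \<in> T0")
  case True
  have "cjac T0 tc (\<lambda>x. q x) \<phi>' y = cjac U \<phi> (\<lambda>x. x) \<phi>' (q y) * cjac T0 tc q \<phi> y"
    by (rule cjac_compose[OF atlasE X y q_cont q_hmap[OF y] hmap_at_id[OF X] chart0 True U U'])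
  then show ?thesis using True by (simp add: logjac_def)
qed (simp add: logjac_def)

subsection \<open>The generator of the deck group\<close>

lemma gamma_lbih: "\<exists>g. lbih E E Om Om \<gamma> g"
proof -
  have "biholo E E \<gamma>" using ext by (simp add: extends_to_cover_def)
  from open_sub_carrier_holo[OF atlasE openE this] show ?thesis by (simp add: carrierE)
qed

lemma q_gamma: "y \<in> Om \<Longrightarrow> q (\<gamma> y) = q y"
  using uc by (simp add: universal_cover_with_generator_def deck_group_def carrierE)

text \<open>The hypothesis covers basin points only, and \<open>y\<close> may be a limit of such
  points. Both sides are holomorphic near \<open>y\<close> and agree on the dense basin.\<close>

lemma gamma_emb:
  assumes y: "y \<in> T0" shows "\<gamma> y = torus_emb (monomial_map lam A (tc y))"
proof -
  obtain g where g: "lbih E E Om Om \<gamma> g" using gamma_lbih by blast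
  have yO: "y \<in> Om" using y T0_sub by blast
  then have gyO: "\<gamma> y \<in> Om" by (rule lbihD(2)[OF g])
  obtain B C J where c: "tchart S B C J" "\<gamma> y \<in> tU B J" by (rule tU_cover[OF gyO])
  \<comment> \<open>That \<open>\<gamma> y\<close> is in the torus is not yet known, so the
    comparison takes place in some chart around it; this is the region where both sides can be read
    in that chart.\<close>
  let ?N = "T0 \<inter> {x\<in>Om. \<gamma> x \<in> tU B J}"
  have N: "openin (mtop E) ?N"
    using lbih_cont(3)[OF g] atlasD(2)[OF atlasE chart0] atlasD(2)[OF atlasE chartE[OF c(1)]]
    by (simp add: cont_on_open_def openin_Int)
  have yN: "y \<in> ?N" using y yO c by blast
  let ?F = "\<lambda>x. monomial_map lam A (tc x)"
  have FT: "?F x \<in> torus" if "x \<in> T0" for x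
  proof -
    have "tc x $ k \<noteq> 0" for k using T0E(1)[OF that] by (simp add: torus_def)
    then show ?thesis using lam by (simp add: monomial_map_def torus_def prod_zero_iff)
  qed
  have dense: "\<exists>x\<in>V. \<gamma> x = torus_emb (?F x)" if V: "openin (mtop E) V" "V \<subseteq> ?N" "V \<noteq> {}" for V
  proof -
    obtain v where v: "v \<in> V" using V(3) by blast
    have "v \<in> Om" using v V(2) by blast
    then have "v \<in> mtop (toric_variety S) closure_of (torus_emb ` torus_basin lam A)" using dens by blast
    moreover have "openin (mtop (toric_variety S)) V" using V(1) by (simp add: openinE)
    ultimately obtain z where z: "z \<in> torus_basin lam A" "torus_emb z \<in> V" using v unfolding in_closure_of by blast
    have "tc (torus_emb z) = z" by (rule tc_emb)
    moreover have "\<gamma> (torus_emb z) = torus_emb (monomial_map lam A z)" using ext z(1) by (simp add: extends_to_cover_def)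
    ultimately show ?thesis using z(2) by (intro bexI[of _ "torus_emb z"]) simp_all
  qed
  have eq: "tcoord C (\<gamma> y) $ i = monomial_map 1 C (?F y) $ i" for i
  proof (rule holo_fun_eq_dense[OF atlasE _ _ _ yN])
    show "holo_fun E ?N (\<lambda>x. tcoord C (\<gamma> x) $ i)"
      unfolding holo_fun_iff
    proof (intro conjI ballI N)
      fix x assume x: "x \<in> ?N"
      then have xO: "x \<in> Om" by blast
      show "holo_at E (\<lambda>x. tcoord C (\<gamma> x) $ i) x"
        by (rule lbih_holo_at[OF atlasE atlasE g xO tcoord_holo[OF c(1)]]) (use x in blast)
    qed
    show "holo_fun E ?N (\<lambda>x. monomial_map 1 C (?F x) $ i)"
      unfolding holo_fun_iff
    proof (intro conjI ballI N)
      fix x assume x: "x \<in> ?N"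
      have d: "cdiff (\<lambda>w. monomial_map 1 C (monomial_map lam A w) $ i) (tc x)"
        using cdiff_compose[OF monomial_map_cdiffv[of "tc x" lam A], of "\<lambda>w. monomial_map 1 C w $ i"]
          monomial_map_cdiffv[of "?F x" 1 C] T0E(1)[of x] FT[of x] x by (simp add: cdiffv_iff)
      show "holo_at E (\<lambda>x. monomial_map 1 C (?F x) $ i) x"
      proof (rule holo_at_chart[OF atlasE chart0])
        show "x \<in> T0" using x by blast
        show "cdiff ((\<lambda>x. monomial_map 1 C (?F x) $ i) \<circ> inv_into T0 tc) (tc x)"
          by (rule cdiff_cong_open[OF d atlasD(3)[OF atlasE chart0]]) (use x in \<open>auto simp: f_inv_into_f\<close>)
      qed
    qed
    fix V assume V: "openin (mtop E) V" "V \<subseteq> ?N" "V \<noteq> {}"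
    obtain x where "x \<in> V" "\<gamma> x = torus_emb (?F x)" using dense[OF V] by blast
    then show "\<exists>x\<in>V. tcoord C (\<gamma> x) $ i = monomial_map 1 C (?F x) $ i"
      by (intro bexI[of _ x]) (simp_all add: tcoord_torus_emb)
  qed
  have "tcoord C (\<gamma> y) = tcoord C (torus_emb (?F y))"
    by (simp add: vec_eq_iff eq tcoord_torus_emb)
  moreover have "inj_on (tcoord C) (affine_piece S (lcone B J))" by (rule tcoord_inj(1)[OF F c(1)])
  moreover have "\<gamma> y \<in> affine_piece S (lcone B J)" using c(2) by (simp add: tU_def)
  moreover have "torus_emb (?F y) \<in> affine_piece S (lcone B J)"
    by (rule torus_emb_affine_piece[OF F c(1) FT[OF y]])
  ultimately show ?thesis by (meson inj_onD)
qed

text \<open>As \<open>q\<close> is unchanged by \<open>\<gamma>\<close>, the chain rule leaves the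
  Jacobian of the monomial map as the only factor, and it turns the product of the coordinates at
  \<open>y\<close> into \<open>det A\<close> times the product at \<open>\<gamma> y\<close>.\<close>

lemma logjac_gamma:
  assumes y: "y \<in> Om" and U: "(U, \<phi>) \<in> charts X" "q y \<in> U"
  shows "logjac \<phi> y = detA * logjac \<phi> (\<gamma> y)"
proof -
  obtain g where g: "lbih E E Om Om \<gamma> g" using gamma_lbih by blast
  let ?V = "{y\<in>Om. q y \<in> U}"
  have gV: "\<gamma> x \<in> ?V" if "x \<in> ?V" for x using that q_gamma[of x] lbihD(2)[OF g, of x] by simp
  show ?thesis
  proof (rule holo_eq_T0[where U="?V" and f="logjac \<phi>" and g="\<lambda>y. detA * logjac \<phi> (\<gamma> y)"])
    show "holo_fun E ?V (logjac \<phi>)" by (rule logjac_holo[OF U(1)])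
    show "holo_fun E ?V (\<lambda>y. detA * logjac \<phi> (\<gamma> y))"
      unfolding holo_fun_iff
    proof (intro conjI ballI)
      show "openin (mtop E) ?V" by (rule q_chart_preimage[OF U(1)])
      fix x assume x: "x \<in> ?V"
      then have xO: "x \<in> Om" by blast
      have "holo_at E (logjac \<phi>) (\<gamma> x)" using logjac_holo[OF U(1)] gV[OF x] unfolding holo_fun_iff by blast
      from lbih_holo_at[OF atlasE atlasE g xO this]
      show "holo_at E (\<lambda>y. detA * logjac \<phi> (\<gamma> y)) x" by (simp add: holo_at_mult holo_at_const)
    qed
    show "y \<in> ?V" using y U by blast
    fix x assume x: "x \<in> ?V" "x \<in> T0"
    let ?t = "tc x" let ?G = "monomial_map lam A"
    have xO: "x \<in> Om" using x by blast
    have t: "?t \<in> torus" by (rule T0E(1)[OF x(2)])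
    have tk: "?t $ k \<noteq> 0" for k using t by (simp add: torus_def)
    have Gt: "?G ?t \<in> torus" using lam tk by (simp add: monomial_map_def torus_def prod_zero_iff)
    have gx: "\<gamma> x = torus_emb (?G ?t)" by (rule gamma_emb[OF x(2)])
    have gT: "\<gamma> x \<in> T0"
      using gx Gt lbihD(2)[OF g xO] unfolding T0_def orb_0 by blast
    have tgx: "tc (\<gamma> x) = ?G ?t" using gx tc_emb by simp
    have nz: "(\<Prod>k\<in>UNIV. ?t $ k) \<noteq> 0" using tk by (simp add: prod_zero_iff)
    have qg: "q (\<gamma> x) \<in> U" using x(1) q_gamma[OF xO] by simp
    have "cjac T0 tc (\<lambda>x. q (\<gamma> x)) \<phi> x = cjac T0 tc q \<phi> (\<gamma> x) * cjac T0 tc \<gamma> tc x"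
      by (rule cjac_compose[OF atlasE atlasE xO lbih_cont(3)[OF g] lbihD(3)[OF g xO] q_hmap chart0 x(2) chart0 gT U(1) qg])
        (rule lbihD(2)[OF g xO])
    moreover have "cjac T0 tc (\<lambda>x. q (\<gamma> x)) \<phi> x = cjac T0 tc q \<phi> x"
      by (rule cjac_cong(1)[OF atlasE chart0 x(2) U(1) _ q_hmap[OF xO] openE xO]) (use x q_gamma in auto)
    moreover have "cjac T0 tc \<gamma> tc x = jac ?G ?t"
      unfolding cjac_def
    proof (rule jac_cong_open[OF monomial_map_cdiffv[OF t] atlasD(3)[OF atlasE chart0]])
      show "?t \<in> tc ` T0" using x by blast
      fix w assume "w \<in> tc ` T0"
      then obtain z where z: "z \<in> T0" "w = tc z" by blast
      have "inv_into T0 tc w = z" using z atlasD(4)[OF atlasE chart0] by simp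
      moreover have "?G (tc z) \<in> torus"
        using lam T0E(1)[OF z(1)] by (simp add: monomial_map_def torus_def prod_zero_iff)
      ultimately show "?G w = (tc \<circ> \<gamma> \<circ> inv_into T0 tc) w" using z gamma_emb[OF z(1)] tc_emb by simp
    qed
    ultimately show "logjac \<phi> x = detA * logjac \<phi> (\<gamma> x)"
      using x(2) gT nz monomial_map_jac[OF t, of lam A] by (simp add: logjac_def tgx detA_def)
  qed
qed

end

subsection \<open>Tensor products and divisor bundles\<close>

lemma holo_line_bundleD:
  assumes "holo_line_bundle M L" "i \<in> lb_index L"
  shows "openin (mtop M) (lb_open L i)"
    "j \<in> lb_index L \<Longrightarrow> unit_fun M (lb_open L i \<inter> lb_open L j) (lb_trans L i j)"
    "j \<in> lb_index L \<Longrightarrow> k \<in> lb_index L \<Longrightarrow> x \<in> lb_open L i \<Longrightarrow> x \<in> lb_open L j \<Longrightarrow> x \<in> lb_open L k \<Longrightarrow>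
      lb_trans L i j x * lb_trans L j k x = lb_trans L i k x"
  using assms unfolding holo_line_bundle_def by simp_all

lemma holo_line_bundle_tensor:
  assumes L: "holo_line_bundle M L" and L': "holo_line_bundle M L'"
  shows "holo_line_bundle M (lb_tensor L L')"
proof -
  have s: "lb_index (lb_tensor L L') = lb_index L \<times> lb_index L'"
    "lb_open (lb_tensor L L') (i, a) = lb_open L i \<inter> lb_open L' a"
    "lb_trans (lb_tensor L L') (i, a) (j, b) = (\<lambda>x. lb_trans L i j x * lb_trans L' a b x)" for i a j b
    by (simp_all add: lb_tensor_def)
  show ?thesis
    unfolding holo_line_bundle_def
  proof (intro conjI ballI)
    have c: "carrier M = (\<Union>i\<in>lb_index L. lb_open L i)" "carrier M = (\<Union>i\<in>lb_index L'. lb_open L' i)"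
      using L L' by (simp_all add: holo_line_bundle_def)
    have "(\<Union>i\<in>lb_index (lb_tensor L L'). lb_open (lb_tensor L L') i) =
        (\<Union>i\<in>lb_index L. lb_open L i) \<inter> (\<Union>a\<in>lb_index L'. lb_open L' a)"
      unfolding s(1) by (force simp: s(2))
    then show "carrier M = (\<Union>i\<in>lb_index (lb_tensor L L'). lb_open (lb_tensor L L') i)"
      unfolding c(1)[symmetric] c(2)[symmetric] by simp
    fix p assume "p \<in> lb_index (lb_tensor L L')"
    then obtain i a where p: "p = (i, a)" "i \<in> lb_index L" "a \<in> lb_index L'" by (auto simp: s)
    have o: "openin (mtop M) (lb_open L i \<inter> lb_open L' a)"
      by (rule openin_Int[OF holo_line_bundleD(1)[OF L p(2)] holo_line_bundleD(1)[OF L' p(3)]])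
    then show "openin (mtop M) (lb_open (lb_tensor L L') p)" by (simp add: p s)
    fix p' assume "p' \<in> lb_index (lb_tensor L L')"
    then obtain j b where p': "p' = (j, b)" "j \<in> lb_index L" "b \<in> lb_index L'" by (auto simp: s)
    have o': "openin (mtop M) (lb_open L j \<inter> lb_open L' b)"
      by (rule openin_Int[OF holo_line_bundleD(1)[OF L p'(2)] holo_line_bundleD(1)[OF L' p'(3)]])
    have oo: "openin (mtop M) (lb_open L i \<inter> lb_open L' a \<inter> (lb_open L j \<inter> lb_open L' b))" by (rule openin_Int[OF o o'])
    show "unit_fun M (lb_open (lb_tensor L L') p \<inter> lb_open (lb_tensor L L') p') (lb_trans (lb_tensor L L') p p')"
      unfolding p(1) p'(1) s
      by (rule unit_fun_mult; rule unit_fun_subset[OF _ oo])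
        (use holo_line_bundleD(2)[OF L p(2) p'(2)] holo_line_bundleD(2)[OF L' p(3) p'(3)] in auto)
    fix p'' x assume "p'' \<in> lb_index (lb_tensor L L')"
      and x: "x \<in> lb_open (lb_tensor L L') p \<inter> lb_open (lb_tensor L L') p' \<inter> lb_open (lb_tensor L L') p''"
    then obtain k c where p'': "p'' = (k, c)" "k \<in> lb_index L" "c \<in> lb_index L'" by (auto simp: s)
    have "lb_trans L i j x * lb_trans L j k x = lb_trans L i k x"
      by (rule holo_line_bundleD(3)[OF L p(2) p'(2) p''(2)]) (use x p(1) p'(1) p''(1) in \<open>auto simp: s\<close>)
    moreover have "lb_trans L' a b x * lb_trans L' b c x = lb_trans L' a c x"
      by (rule holo_line_bundleD(3)[OF L' p(3) p'(3) p''(3)]) (use x p(1) p'(1) p''(1) in \<open>auto simp: s\<close>)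
    ultimately show "lb_trans (lb_tensor L L') p p' x * lb_trans (lb_tensor L L') p' p'' x = lb_trans (lb_tensor L L') p p'' x"
      unfolding p(1) p'(1) p''(1) s by (metis (no_types, lifting) mult.assoc mult.left_commute)
  qed
qed

lemma ratio_unit_iff:
  "ratio_unit M (U, f, h) (U', f', h') u \<longleftrightarrow> unit_fun M (U \<inter> U') u \<and> (\<forall>x\<in>U \<inter> U'. f x * h' x = u x * (f' x * h x))"
  by (simp add: ratio_unit_def)

lemma cartier_divisorD:
  assumes "cartier_divisor M D" "(U, f, h) \<in> D"
  shows "regular_fun M U f" "regular_fun M U h" "openin (mtop M) U"
proof -
  have "\<forall>(U, f, h)\<in>D. regular_fun M U f \<and> regular_fun M U h" using assms(1) by (simp add: cartier_divisor_def)
  then show "regular_fun M U f" "regular_fun M U h" using assms(2) by auto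
  then show "openin (mtop M) U" by (simp add: regular_fun_def holo_fun_iff)
qed

lemma cartier_divisor_uminus:
  assumes D: "cartier_divisor M D" shows "cartier_divisor M (divisor_uminus D)"
  unfolding cartier_divisor_def
proof (intro conjI ballI)
  have "(\<Union>(U, f, h)\<in>divisor_uminus D. U) = (\<Union>(U, f, h)\<in>D. U)"
    by (simp add: divisor_uminus_def case_prod_unfold)
  then show "carrier M = (\<Union>(U, f, h)\<in>divisor_uminus D. U)" using D by (simp add: cartier_divisor_def)
  fix d assume "d \<in> divisor_uminus D"
  then obtain U f h where d: "d = (U, h, f)" "(U, f, h) \<in> D" by (auto simp: divisor_uminus_def)
  show "case d of (U, f, h) \<Rightarrow> regular_fun M U f \<and> regular_fun M U h"
    using cartier_divisorD[OF D d(2)] d(1) by simp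
  fix d' assume "d' \<in> divisor_uminus D"
  then obtain U' f' h' where d': "d' = (U', h', f')" "(U', f', h') \<in> D" by (auto simp: divisor_uminus_def)
  have "\<exists>u. ratio_unit M (U', f', h') (U, f, h) u" using D d(2) d'(2) by (simp add: cartier_divisor_def)
  then obtain u where "unit_fun M (U' \<inter> U) u" "\<forall>x\<in>U' \<inter> U. f' x * h x = u x * (f x * h' x)"
    unfolding ratio_unit_iff by blast
  then show "\<exists>u. ratio_unit M d d' u" unfolding d d' ratio_unit_iff
    by (intro exI[of _ u]) (auto simp: Int_commute mult.commute)
qed

lemma divisor_bundle_trans:
  assumes D: "cartier_divisor M D" and d: "d \<in> D" "d' \<in> D"
  shows "ratio_unit M d d' (lb_trans (divisor_bundle M D) d d')"
proof -
  have "\<exists>u. ratio_unit M d d' u" using D d by (simp add: cartier_divisor_def)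
  then show ?thesis by (simp add: divisor_bundle_def someI_ex)
qed

text \<open>The transition functions are chosen by \<open>SOME\<close> and known only through
  \<open>ratio_unit\<close>, so the cocycle identity is verified after multiplication by the
  denominators.\<close>

lemma holo_line_bundle_divisor:
  assumes M: "atlas M" and D: "cartier_divisor M D"
  shows "holo_line_bundle M (divisor_bundle M D)"
  unfolding holo_line_bundle_def
proof (intro conjI ballI)
  let ?L = "divisor_bundle M D"
  have s: "lb_index ?L = D" "lb_open ?L = fst" by (simp_all add: divisor_bundle_def)
  show "carrier M = (\<Union>i\<in>lb_index ?L. lb_open ?L i)"
    using D unfolding s cartier_divisor_def by (simp add: case_prod_unfold)
  fix d assume "d \<in> lb_index ?L"
  then obtain U f h where d: "d = (U, f, h)" "(U, f, h) \<in> D" unfolding s by (cases d) auto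
  show "openin (mtop M) (lb_open ?L d)" using cartier_divisorD(3)[OF D d(2)] by (simp add: s d)
  fix d' assume "d' \<in> lb_index ?L"
  then obtain U' f' h' where d': "d' = (U', f', h')" "(U', f', h') \<in> D" unfolding s by (cases d') auto
  have 1: "ratio_unit M (U, f, h) (U', f', h') (lb_trans ?L d d')"
    using divisor_bundle_trans[OF D d(2) d'(2)] d d' by simp
  show "unit_fun M (lb_open ?L d \<inter> lb_open ?L d') (lb_trans ?L d d')"
    using 1 by (simp add: s d d' ratio_unit_iff)
  fix d'' x assume "d'' \<in> lb_index ?L" and x: "x \<in> lb_open ?L d \<inter> lb_open ?L d' \<inter> lb_open ?L d''"
  then obtain U'' f'' h'' where d'': "d'' = (U'', f'', h'')" "(U'', f'', h'') \<in> D" unfolding s by (cases d'') auto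
  have 2: "ratio_unit M (U', f', h') (U'', f'', h'') (lb_trans ?L d' d'')"
    using divisor_bundle_trans[OF D d'(2) d''(2)] d' d'' by simp
  have 3: "ratio_unit M (U, f, h) (U'', f'', h'') (lb_trans ?L d d'')"
    using divisor_bundle_trans[OF D d(2) d''(2)] d d'' by simp
  let ?W = "U \<inter> U' \<inter> U''"
  note r = cartier_divisorD[OF D d(2)] cartier_divisorD[OF D d'(2)] cartier_divisorD[OF D d''(2)]
  have W: "openin (mtop M) ?W" using r by (intro openin_Int)
  have u: "holo_fun M ?W (lb_trans ?L d d')" "holo_fun M ?W (lb_trans ?L d' d'')" "holo_fun M ?W (lb_trans ?L d d'')"
  proof -
    have "holo_fun M (U \<inter> U') (lb_trans ?L d d')" "holo_fun M (U' \<inter> U'') (lb_trans ?L d' d'')"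
      "holo_fun M (U \<inter> U'') (lb_trans ?L d d'')"
      using 1 2 3 by (simp_all add: ratio_unit_iff unit_fun_def)
    then show "holo_fun M ?W (lb_trans ?L d d')" "holo_fun M ?W (lb_trans ?L d' d'')" "holo_fun M ?W (lb_trans ?L d d'')"
      by (auto intro: holo_fun_subset[OF _ W])
  qed
  \<comment> \<open>The product of the denominators in the relations for the first two quotients; it
    also contains the denominator for the third.\<close>
  have reg: "regular_fun M ?W (\<lambda>x. f' x * h x * (f'' x * h' x))"
  proof -
    have s: "regular_fun M ?W f'" "regular_fun M ?W h" "regular_fun M ?W f''" "regular_fun M ?W h'"
      using r by (auto intro: regular_fun_subset[OF _ W])
    show ?thesis by (rule regular_fun_mult[OF M regular_fun_mult[OF M s(1,2)] regular_fun_mult[OF M s(3,4)]])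
  qed
  show "lb_trans ?L d d' x * lb_trans ?L d' d'' x = lb_trans ?L d d'' x"
  proof (rule regular_fun_cancel[OF M reg, where a="\<lambda>x. lb_trans ?L d d' x * lb_trans ?L d' d'' x" and b="lb_trans ?L d d''"])
    show "holo_fun M ?W (\<lambda>x. lb_trans ?L d d' x * lb_trans ?L d' d'' x)"
      using u unfolding holo_fun_iff by (simp add: holo_at_mult)
    show "holo_fun M ?W (lb_trans ?L d d'')" by (rule u(3))
    show "x \<in> ?W" using x by (simp add: s d d' d'')
    fix y assume y: "y \<in> ?W"
    let ?u = "lb_trans ?L d d' y" and ?v = "lb_trans ?L d' d'' y" and ?w = "lb_trans ?L d d'' y"
    have e: "f y * h' y = ?u * (f' y * h y)" "f' y * h'' y = ?v * (f'' y * h' y)" "f y * h'' y = ?w * (f'' y * h y)"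
      using 1 2 3 y unfolding ratio_unit_iff by auto
    have "?u * ?v * (f' y * h y * (f'' y * h' y)) = (?u * (f' y * h y)) * (?v * (f'' y * h' y))" by (simp only: mult_ac)
    also have "\<dots> = (f y * h'' y) * (f' y * h' y)" unfolding e(1,2)[symmetric] by (simp only: mult_ac)
    also have "\<dots> = ?w * (f' y * h y * (f'' y * h' y))" unfolding e(3) by (simp only: mult_ac)
    finally show "?u * ?v * (f' y * h y * (f'' y * h' y)) = ?w * (f' y * h y * (f'' y * h' y))" .
  qed
qed

text \<open>A product of two functions vanishing at \<open>z\<close> has derivative 0 there, a
  coordinate does not. This shows that a coordinate and a local equation of its hyperplane differ by
  a unit.\<close>

lemma coordinate_not_product:
  assumes K: "cdiff K z" "K z = 0" and G: "cdiff G z" "G z = 0"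
    and S: "open S" "z \<in> S" "\<And>w. w \<in> S \<Longrightarrow> w $ i = K w * G w"
  shows False
proof -
  note dK = cdiff_frechet(1)[OF K(1)] and dG = cdiff_frechet(1)[OF G(1)]
  have "((\<lambda>w. K w * G w) has_derivative (\<lambda>v. K z * frechet_derivative G (at z) v + frechet_derivative K (at z) v * G z)) (at z)"
    by (rule has_derivative_mult[OF dK dG])
  then have 1: "((\<lambda>w. K w * G w) has_derivative (\<lambda>v. 0)) (at z)" using K(2) G(2) by simp
  have "((\<lambda>w. w $ i) has_derivative (\<lambda>v. v $ i)) (at z)"
    by (rule bounded_linear_imp_has_derivative[OF bounded_linear_vec_nth])
  then have 2: "((\<lambda>w. K w * G w) has_derivative (\<lambda>v. v $ i)) (at z)"
    by (rule has_derivative_transform_within_open[OF _ S(1,2)]) (rule S(3))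
  have "(\<lambda>v :: complex^'a. v $ i) = (\<lambda>v. 0)" by (rule has_derivative_unique[OF 2 1])
  then have "(axis i 1 :: complex^'a) $ i = 0" by metis
  then show False by simp
qed

context tcover
begin

subsection \<open>Iterates of the generator\<close>

abbreviation it :: "int \<Rightarrow> 'n tpoint \<Rightarrow> 'n tpoint" where "it \<equiv> iter Om \<gamma>"

lemma gamma_inv:
  assumes "y \<in> Om"
  shows "\<gamma> y \<in> Om" "inv_into Om \<gamma> y \<in> Om" "\<gamma> (inv_into Om \<gamma> y) = y" "inv_into Om \<gamma> (\<gamma> y) = y"
proof -
  obtain g where g: "lbih E E Om Om \<gamma> g" using gamma_lbih by blast
  have inj: "inj_on \<gamma> Om" by (rule inj_on_inverseI[where g=g]) (rule lbihD(1)[OF g])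
  have y: "y \<in> \<gamma> ` Om" using lbihD(1,2)[OF lbih_sym[OF g] assms] by (metis imageI)
  show "\<gamma> y \<in> Om" by (rule lbihD(2)[OF g assms])
  show "inv_into Om \<gamma> y \<in> Om" "\<gamma> (inv_into Om \<gamma> y) = y" using y by (simp_all add: inv_into_into f_inv_into_f)
  show "inv_into Om \<gamma> (\<gamma> y) = y" by (rule inv_into_f_f[OF inj assms])
qed

lemma it_0: "it 0 y = y" by (simp add: iter_def)

lemma it_in: assumes "y \<in> Om" shows "it k y \<in> Om"
proof -
  have "(\<gamma> ^^ n) y \<in> Om" "(inv_into Om \<gamma> ^^ n) y \<in> Om" for n
    by (induction n) (simp_all add: assms gamma_inv)
  then show ?thesis by (simp add: iter_def)
qed

lemma it_succ: assumes "y \<in> Om" shows "it (k + 1) y = \<gamma> (it k y)"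
proof (cases "0 \<le> k")
  case True
  then have "nat (k + 1) = Suc (nat k)" by simp
  then show ?thesis using True by (simp add: iter_def)
next
  case False
  then have n: "nat (- k) = Suc (nat (- (k + 1)))" by simp
  have "it k y = inv_into Om \<gamma> ((inv_into Om \<gamma> ^^ nat (- (k + 1))) y)"
    using False unfolding iter_def n by simp
  moreover have "it (k + 1) y = (inv_into Om \<gamma> ^^ nat (- (k + 1))) y"
    using False by (cases "k = -1") (simp_all add: iter_def)
  moreover have "it (k + 1) y \<in> Om" by (rule it_in[OF assms])
  ultimately show ?thesis using gamma_inv(3) by simp
qed

lemma it_pred: assumes "y \<in> Om" shows "it (k - 1) y = inv_into Om \<gamma> (it k y)"
  using it_succ[OF assms, of "k - 1"] gamma_inv(4)[OF it_in[OF assms, of "k - 1"]] by simp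

lemma it_add: assumes "y \<in> Om" shows "it (k + l) y = it k (it l y)"
proof (induction k rule: int_induct[where k=0])
  case base show ?case by (simp add: it_0)
next
  case (step1 k)
  have "it (k + 1 + l) y = \<gamma> (it (k + l) y)" using it_succ[OF assms, of "k + l"] by (simp add: ac_simps)
  then show ?case using step1 it_succ[OF it_in[OF assms, of l], of k] by simp
next
  case (step2 k)
  have "it (k - 1 + l) y = inv_into Om \<gamma> (it (k + l) y)" using it_pred[OF assms, of "k + l"] by (simp add: algebra_simps)
  then show ?case using step2 it_pred[OF it_in[OF assms, of l], of k] by simp
qed

lemma q_it: assumes "y \<in> Om" shows "q (it k y) = q y"
proof (induction k rule: int_induct[where k=0])
  case base show ?case by (simp add: it_0)
next
  case (step1 k)
  then show ?case using it_succ[OF assms] q_gamma[OF it_in[OF assms]] by simp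
next
  case (step2 k)
  have "q (it (k - 1) y) = q (\<gamma> (it (k - 1) y))" using q_gamma[OF it_in[OF assms]] by simp
  also have "\<gamma> (it (k - 1) y) = it k y" using it_succ[OF assms, of "k - 1"] by simp
  finally show ?case using step2 by simp
qed

lemma it_unique:
  assumes y: "y \<in> Om" and e: "it k y = it l y" shows "k = l"
proof -
  have "it (k - l) y = it (- l) (it k y)" using it_add[OF y, of "- l" k] by simp
  also have "\<dots> = it (- l + l) y" unfolding e by (rule it_add[OF y, symmetric])
  finally have "it (k - l) y = y" by (simp add: it_0)
  moreover have "\<forall>x\<in>Om. \<forall>k. it k x = x \<longrightarrow> k = 0"
    using uc unfolding universal_cover_with_generator_def carrierE by (elim conjE)
  ultimately have "k - l = 0" using y by blast
  then show ?thesis by simp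
qed

lemma it_transitive: "x \<in> Om \<Longrightarrow> y \<in> Om \<Longrightarrow> q x = q y \<Longrightarrow> \<exists>k. y = it k x"
proof -
  have "\<forall>x\<in>Om. \<forall>y\<in>Om. q x = q y \<longrightarrow> (\<exists>k. y = it k x)"
    using uc unfolding universal_cover_with_generator_def carrierE by (elim conjE)
  then show "x \<in> Om \<Longrightarrow> y \<in> Om \<Longrightarrow> q x = q y \<Longrightarrow> \<exists>k. y = it k x" by blast
qed

lemma it_cont: "cont_on_open (mtop E) Om (mtop E) (it k)"
proof -
  obtain g where g: "lbih E E Om Om \<gamma> g" using gamma_lbih by blast
  have cong: "cont_on_open (mtop E) Om (mtop E) b" if "cont_on_open (mtop E) Om (mtop E) a" "\<And>y. y \<in> Om \<Longrightarrow> a y = b y" for a b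
  proof -
    have "{x\<in>Om. a x \<in> W} = {x\<in>Om. b x \<in> W}" for W by (rule Collect_cong) (metis that(2))
    then show ?thesis using that(1) by (simp add: cont_on_open_def)
  qed
  have gi: "cont_on_open (mtop E) Om (mtop E) (inv_into Om \<gamma>)"
  proof (rule cong[OF lbih_cont(4)[OF g]])
    fix y assume y: "y \<in> Om"
    have "g (\<gamma> (inv_into Om \<gamma> y)) = inv_into Om \<gamma> y" by (rule lbihD(1)[OF g gamma_inv(2)[OF y]])
    then show "g y = inv_into Om \<gamma> y" by (simp add: gamma_inv(3)[OF y])
  qed
  show ?thesis
  proof (induction k rule: int_induct[where k=0])
    case base
    have "it 0 = (\<lambda>x. x)" by (simp add: fun_eq_iff it_0)
    then show ?case using cont_on_open_id[OF openE] by simp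
  next
    case (step1 k)
    show ?case
      by (rule cong[OF cont_on_open_compose[OF step1(2) lbih_cont(3)[OF g] it_in]]) (simp_all add: it_succ)
  next
    case (step2 k)
    show ?case
      by (rule cong[OF cont_on_open_compose[OF step2(2) gi it_in]]) (simp_all add: it_pred)
  qed
qed

lemma logjac_it:
  assumes y: "y \<in> Om" and U: "(U, \<phi>) \<in> charts X" "q y \<in> U"
  shows "logjac \<phi> y = detA powi k * logjac \<phi> (it k y)"
proof -
  have a: "detA \<noteq> 0" using detA by auto
  have step: "logjac \<phi> (it k y) = detA * logjac \<phi> (it (k + 1) y)" for k
    using logjac_gamma[OF it_in[OF y] U(1), of k] U(2) q_it[OF y] it_succ[OF y] by simp
  show ?thesis
  proof (induction k rule: int_induct[where k=0])
    case base show ?case by (simp add: it_0)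
  next
    case (step1 k)
    then show ?case using step[of k] a by (simp add: power_int_add)
  next
    case (step2 k)
    then show ?case using step[of "k - 1"] a by (simp add: power_int_diff)
  qed
qed

subsection \<open>Local sections of the covering and flat line bundles\<close>

text \<open>Membership in the index set of \<open>flat_bundle\<close>.\<close>

definition qsec :: "'b set \<Rightarrow> ('b \<Rightarrow> 'n tpoint) \<Rightarrow> bool" where
  "qsec U s \<longleftrightarrow> openin (mtop X) U \<and> continuous_map (subtopology (mtop X) U) (mtop E) s \<and> (\<forall>x\<in>U. q (s x) = x)"

lemma qsecD:
  assumes s: "qsec U s"
  shows "openin (mtop X) U" "x \<in> U \<Longrightarrow> q (s x) = x" "x \<in> U \<Longrightarrow> s x \<in> Om" "cont_on_open (mtop X) U (mtop E) s"
proof -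
  show oU: "openin (mtop X) U" and "x \<in> U \<Longrightarrow> q (s x) = x" using s by (simp_all add: qsec_def)
  have c: "continuous_map (subtopology (mtop X) U) (mtop E) s" using s by (simp add: qsec_def)
  have t: "topspace (subtopology (mtop X) U) = U" using openin_subset[OF oU] by auto
  show "x \<in> U \<Longrightarrow> s x \<in> Om" using continuous_map_image_subset_topspace[OF c] unfolding t carrierE by auto
  show "cont_on_open (mtop X) U (mtop E) s"
    unfolding cont_on_open_def
  proof (intro allI impI)
    fix W assume "openin (mtop E) W"
    from openin_continuous_map_preimage[OF c this] show "openin (mtop X) {x\<in>U. s x \<in> W}"
      unfolding t using oU by (simp add: openin_open_subtopology)
  qed
qed

text \<open>A section is only assumed continuous; near each point it coincides with the holomorphic
  inverse of one sheet.\<close>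

lemma qsec_local:
  assumes s: "qsec U s" and x: "x \<in> U"
  shows "\<exists>N V U' g. openin (mtop X) N \<and> x \<in> N \<and> N \<subseteq> U \<and> N \<subseteq> U' \<and> lbih E X V U' q g \<and> (\<forall>z\<in>N. s z \<in> V \<and> s z = g z)"
proof -
  obtain V U' g where V: "s x \<in> V" "lbih E X V U' q g" using q_local[OF qsecD(3)[OF s x]] by blast
  let ?N = "{z\<in>U. s z \<in> V}"
  have N: "openin (mtop X) ?N" using qsecD(4)[OF s] lbih_cont(1)[OF V(2)] by (simp add: cont_on_open_def)
  have "\<forall>z\<in>?N. s z \<in> V \<and> s z = g z"
  proof
    fix z assume "z \<in> ?N"
    then have z: "z \<in> U" "s z \<in> V" by simp_all
    have "g (q (s z)) = s z" by (rule lbihD(1)[OF V(2) z(2)])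
    then show "s z \<in> V \<and> s z = g z" using z qsecD(2)[OF s z(1)] by simp
  qed
  moreover have "?N \<subseteq> U'"
  proof
    fix z assume z: "z \<in> ?N"
    then have "q (s z) \<in> U'" using lbihD(2)[OF V(2)] by blast
    then show "z \<in> U'" using z qsecD(2)[OF s] by simp
  qed
  ultimately show ?thesis using N V x by blast
qed

text \<open>At \<open>x\<close> the two sections differ by some iterate. Near \<open>x\<close> both
  the first section and the shifted second one take values in a single sheet, where \<open>q\<close>
  is injective; so the exponent is locally constant.\<close>

lemma qsec_shift_local:
  assumes s: "qsec U s" and s': "qsec U' s'" and x: "x \<in> U" "x \<in> U'"
  shows "\<exists>N k. openin (mtop X) N \<and> x \<in> N \<and> N \<subseteq> U \<inter> U' \<and> (\<forall>z\<in>N. s z = it k (s' z))"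
proof -
  have "q (s' x) = q (s x)" using qsecD(2)[OF s x(1)] qsecD(2)[OF s' x(2)] by simp
  then obtain k where k: "s x = it k (s' x)"
    using it_transitive[OF qsecD(3)[OF s' x(2)] qsecD(3)[OF s x(1)]] by blast
  obtain N V U1 g where N: "openin (mtop X) N" "x \<in> N" "N \<subseteq> U" "N \<subseteq> U1" "lbih E X V U1 q g" "\<forall>z\<in>N. s z \<in> V \<and> s z = g z"
    using qsec_local[OF s x(1)] by blast
  let ?N = "N \<inter> {z\<in>U'. it k (s' z) \<in> V}"
  have "cont_on_open (mtop X) U' (mtop E) (\<lambda>z. it k (s' z))"
    by (rule cont_on_open_compose[OF qsecD(4)[OF s'] it_cont qsecD(3)[OF s']])
  then have "openin (mtop X) {z\<in>U'. it k (s' z) \<in> V}" using lbih_cont(1)[OF N(5)] by (simp add: cont_on_open_def)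
  then have 1: "openin (mtop X) ?N" using N(1) by (rule openin_Int[rotated])
  have "s x \<in> V" using N(2,6) by blast
  then have 2: "x \<in> ?N" using N(2) x(2) k by simp
  have "s z = it k (s' z)" if z: "z \<in> ?N" for z
  proof -
    have zU': "z \<in> U'" and zV: "it k (s' z) \<in> V" and zN: "z \<in> N" using z by auto
    have "q (it k (s' z)) = z" using q_it[OF qsecD(3)[OF s' zU']] qsecD(2)[OF s' zU'] by simp
    then have "g z = it k (s' z)" using lbihD(1)[OF N(5) zV] by simp
    then show ?thesis using N(6) zN by simp
  qed
  then show ?thesis using 1 2 N(3) by blast
qed

text \<open>The exponent in \<open>flat_bundle\<close>; freeness of the action makes it unique
  (\<open>it_unique\<close>).\<close>

definition shift :: "('b \<Rightarrow> 'n tpoint) \<Rightarrow> ('b \<Rightarrow> 'n tpoint) \<Rightarrow> 'b \<Rightarrow> int" where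
  "shift s s' x = (THE k. s x = it k (s' x))"

lemma shift_eq: "s' x \<in> Om \<Longrightarrow> s x = it k (s' x) \<Longrightarrow> shift s s' x = k"
  unfolding shift_def by (rule the_equality) (auto intro: it_unique)

lemma shift:
  assumes s: "qsec U s" and s': "qsec U' s'" and x: "x \<in> U" "x \<in> U'"
  shows "s x = it (shift s s' x) (s' x)"
proof -
  obtain N k where "x \<in> N" "\<forall>z\<in>N. s z = it k (s' z)" using qsec_shift_local[OF assms] by blast
  then show ?thesis using shift_eq[of s' x s k] qsecD(3)[OF s' x(2)] by simp
qed

abbreviation Lflat :: "('b set \<times> ('b \<Rightarrow> 'n tpoint), 'b) line_bundle" where
  "Lflat \<equiv> flat_bundle E X q \<gamma> detA"

lemma Lflat_simps:
  "lb_index Lflat = {(U, s). qsec U s}" "lb_open Lflat = fst"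
  "lb_trans Lflat (U, s) (U', s') = (\<lambda>x. detA powi shift s s' x)"
  by (simp_all add: flat_bundle_def qsec_def shift_def carrierE fun_eq_iff)

lemma qsec_exists: assumes "x \<in> carrier X" shows "\<exists>U s. qsec U s \<and> x \<in> U"
proof -
  obtain y where y: "y \<in> Om" "q y = x" using q_surj[OF assms] by blast
  obtain V U g where V: "y \<in> V" "lbih E X V U q g" using q_local[OF y(1)] by blast
  note V' = lbih_sym[OF V(2)]
  have t: "topspace (subtopology (mtop X) U) = U" using openin_subset[OF lbih_cont(2)[OF V(2)]] by auto
  have "continuous_map (subtopology (mtop X) U) (mtop E) g"
    unfolding continuous_map t
  proof (intro conjI allI impI)
    show "g ` U \<subseteq> carrier E" using lbih_carrier[OF V'] by blast
    fix W assume "openin (mtop E) W"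
    then have "openin (mtop X) {x\<in>U. g x \<in> W}" using lbih_cont(4)[OF V(2)] by (simp add: cont_on_open_def)
    then show "openin (subtopology (mtop X) U) {x\<in>U. g x \<in> W}"
      using lbih_cont(2)[OF V(2)] by (simp add: openin_open_subtopology)
  qed
  then have "qsec U g" using lbih_cont(2)[OF V(2)] lbihD(1)[OF V'] by (simp add: qsec_def)
  moreover have "x \<in> U" using lbihD(2)[OF V(2,1)] y by simp
  ultimately show ?thesis by blast
qed

text \<open>Transition functions are locally constant by \<open>qsec_shift_local\<close>, and their
  cocycle identity is additivity of the exponents.\<close>

lemma holo_line_bundle_flat: "holo_line_bundle X Lflat"
  unfolding holo_line_bundle_def
proof (intro conjI ballI)
  show "carrier X = (\<Union>i\<in>lb_index Lflat. lb_open Lflat i)"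
  proof
    show "carrier X \<subseteq> (\<Union>i\<in>lb_index Lflat. lb_open Lflat i)"
      using qsec_exists by (force simp: Lflat_simps)
    show "(\<Union>i\<in>lb_index Lflat. lb_open Lflat i) \<subseteq> carrier X"
      using openin_subset[OF qsecD(1)] by (force simp: Lflat_simps)
  qed
  fix i assume "i \<in> lb_index Lflat"
  then obtain U s where i: "i = (U, s)" and s: "qsec U s" by (auto simp: Lflat_simps)
  show "openin (mtop X) (lb_open Lflat i)" using qsecD(1)[OF s] by (simp add: i Lflat_simps)
  fix j assume "j \<in> lb_index Lflat"
  then obtain U' s' where j: "j = (U', s')" and s': "qsec U' s'" by (auto simp: Lflat_simps)
  have a: "detA \<noteq> 0" using detA by auto
  show "unit_fun X (lb_open Lflat i \<inter> lb_open Lflat j) (lb_trans Lflat i j)"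
    unfolding i j Lflat_simps fst_conv unit_fun_def holo_fun_iff
  proof (intro conjI ballI)
    show "openin (mtop X) (U \<inter> U')" by (rule openin_Int[OF qsecD(1)[OF s] qsecD(1)[OF s']])
    fix x assume x: "x \<in> U \<inter> U'"
    show "detA powi shift s s' x \<noteq> 0" using a by simp
    obtain N k where N: "openin (mtop X) N" "x \<in> N" "N \<subseteq> U \<inter> U'" "\<forall>z\<in>N. s z = it k (s' z)"
      using qsec_shift_local[OF s s'] x by blast
    show "holo_at X (\<lambda>x. detA powi shift s s' x) x"
    proof (rule holo_at_cong[OF X holo_at_const[of X "detA powi k"] N(1,2)])
      fix z assume z: "z \<in> N"
      have "s' z \<in> Om" using qsecD(3)[OF s', of z] z N(3) by blast
      then show "detA powi k = detA powi shift s s' z" using shift_eq[of s' z s k] N(4) z by simp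
    qed
  qed
  fix l x assume "l \<in> lb_index Lflat" and x: "x \<in> lb_open Lflat i \<inter> lb_open Lflat j \<inter> lb_open Lflat l"
  then obtain U'' s'' where l: "l = (U'', s'')" and s'': "qsec U'' s''" by (auto simp: Lflat_simps)
  have x: "x \<in> U" "x \<in> U'" "x \<in> U''" using x by (simp_all add: i j l Lflat_simps)
  have "s x = it (shift s s' x) (it (shift s' s'' x) (s'' x))"
    using shift[OF s s' x(1,2)] shift[OF s' s'' x(2,3)] by simp
  then have "s x = it (shift s s' x + shift s' s'' x) (s'' x)" using it_add[OF qsecD(3)[OF s'' x(3)]] by simp
  then have "shift s s'' x = shift s s' x + shift s' s'' x" by (rule shift_eq[of s'' x s, OF qsecD(3)[OF s'' x(3)]])
  then show "lb_trans Lflat i j x * lb_trans Lflat j l x = lb_trans Lflat i l x"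
    using a by (simp add: i j l Lflat_simps power_int_add)
qed

subsection \<open>Local equations of the toric divisor\<close>

text \<open>The product of the chart coordinates is a local equation of the toric divisor. It is
  compared with the given equation factor by factor: coordinates are matched with rays, and
  unmatched factors on either side are units.\<close>

lemma cover_divisor_local:
  assumes d: "(Uc, G, h) \<in> cover_divisor S E" and c: "tchart S B C J"
  shows "h = (\<lambda>_. 1) \<and> openin (mtop E) Uc \<and>
    (\<exists>k. unit_fun E (Uc \<inter> tU B J) k \<and> (\<forall>y\<in>Uc \<inter> tU B J. (\<Prod>i\<in>UNIV. tcoord C y $ i) = k y * G y))"
proof -
  have BC: "mutual_inverse B C" using c by (simp add: tchart_def)
  define H where "H \<nu> = (mtop (toric_variety S) closure_of orb \<nu>) \<inter> Om" for \<nu>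
  let ?I = "{\<nu>\<in>rays S. H \<nu> \<inter> Uc \<noteq> {}}"
  obtain f where f: "G = (\<lambda>x. \<Prod>\<nu>\<in>?I. f \<nu> x)" "h = (\<lambda>_. 1)" "openin (mtop E) Uc" "finite ?I"
    "\<forall>\<nu>\<in>?I. local_equation E (H \<nu>) Uc (f \<nu>)"
    using d unfolding cover_divisor_def divisor_sum_def H_def carrierE by blast
  let ?V = "Uc \<inter> tU B J" and ?r = "\<lambda>i. lcone B {i}"
  have oV: "openin (mtop E) ?V" by (rule openin_Int[OF f(3) atlasD(2)[OF atlasE chartE[OF c]]])
  have H: "y \<in> H \<nu> \<longleftrightarrow> (\<exists>i\<in>J. \<nu> = ?r i \<and> tcoord C y $ i = 0)" if "y \<in> ?V" "\<nu> \<in> rays S" for y \<nu>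
    using closure_of_orb_ray[OF F c _ that(2), of y] that(1) by (simp add: H_def tU_def)
  have rinj: "inj_on ?r T" for T by (rule inj_onI) (simp add: lcone_inj[OF BC])
  have coordV: "holo_fun E ?V (\<lambda>y. tcoord C y $ i)" for i
    unfolding holo_fun_iff using oV tcoord_holo[OF c] by blast
  have le: "holo_fun E Uc (f \<nu>)" "\<And>y. y \<in> Uc \<inter> H \<nu> \<Longrightarrow> f \<nu> y = 0"
    "\<And>g. holo_fun E ?V g \<Longrightarrow> (\<And>y. y \<in> ?V \<inter> H \<nu> \<Longrightarrow> g y = 0) \<Longrightarrow> \<exists>k. holo_fun E ?V k \<and> (\<forall>y\<in>?V. g y = k y * f \<nu> y)"
    if "\<nu> \<in> ?I" for \<nu>
  proof -
    have l: "local_equation E (H \<nu>) Uc (f \<nu>)" using f(5) that by blast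
    show "holo_fun E Uc (f \<nu>)" and "\<And>y. y \<in> Uc \<inter> H \<nu> \<Longrightarrow> f \<nu> y = 0"
      using l unfolding local_equation_def by blast+
    fix g assume "holo_fun E ?V g" "\<And>y. y \<in> ?V \<inter> H \<nu> \<Longrightarrow> g y = 0"
    then show "\<exists>k. holo_fun E ?V k \<and> (\<forall>y\<in>?V. g y = k y * f \<nu> y)"
      using l unfolding local_equation_def by (elim conjE allE[of _ ?V] allE[of _ g]) blast
  qed
  \<comment> \<open>The matched indices: generators of the chart's cone whose ray has a factor in
    \<open>G\<close>.\<close>
  let ?I1 = "{i\<in>J. ?r i \<in> ?I}"
  have ex1: "\<exists>k. unit_fun E ?V k \<and> (\<forall>y\<in>?V. tcoord C y $ i = k y * f (?r i) y)" if i: "i \<in> ?I1" for i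
  proof -
    have iJ: "i \<in> J" and ri: "?r i \<in> ?I" "?r i \<in> rays S" using i by auto
    have Hi: "y \<in> H (?r i) \<longleftrightarrow> tcoord C y $ i = 0" if "y \<in> ?V" for y
      using H[OF that ri(2)] iJ lcone_inj[OF BC] by auto
    obtain k where k: "holo_fun E ?V k" "\<forall>y\<in>?V. tcoord C y $ i = k y * f (?r i) y"
      using le(3)[OF ri(1) coordV[of i]] Hi by blast
    \<comment> \<open>If \<open>k\<close> vanished at \<open>y\<close>, so would the coordinate, and
      hence the local equation; the coordinate would be a product of two functions vanishing at
      \<open>y\<close>.\<close>
    have "k y \<noteq> 0" if y: "y \<in> ?V" for y
    proof
      assume k0: "k y = 0"
      then have "tcoord C y $ i = 0" using k(2) y by simp
      then have f0: "f (?r i) y = 0" using le(2)[OF ri(1), of y] Hi[OF y] y by blast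
      let ?inv = "inv_into (tU B J) (tcoord C)"
      have yU: "y \<in> tU B J" using y by blast
      have inv: "?inv (tcoord C x) = x" if "x \<in> tU B J" for x
        by (rule inv_into_f_f[OF atlasD(4)[OF atlasE chartE[OF c]] that])
      have "holo_at E k y" "holo_at E (f (?r i)) y" using k(1) le(1)[OF ri(1)] y unfolding holo_fun_iff by blast+
      then have d: "cdiff (k \<circ> ?inv) (tcoord C y)" "cdiff (f (?r i) \<circ> ?inv) (tcoord C y)"
        using holo_atD[OF _ chartE[OF c] yU] by blast+
      have o: "open (tcoord C ` ?V)" using atlasD(5)[OF atlasE chartE[OF c], of ?V] oV by blast
      show False
      proof (rule coordinate_not_product[OF d(1) _ d(2) _ o])
        show "(k \<circ> ?inv) (tcoord C y) = 0" "(f (?r i) \<circ> ?inv) (tcoord C y) = 0" using inv[OF yU] k0 f0 by simp_all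
        show "tcoord C y \<in> tcoord C ` ?V" using y by blast
        fix w assume "w \<in> tcoord C ` ?V"
        then obtain x where x: "x \<in> ?V" "w = tcoord C x" by blast
        then have "?inv w = x" using inv by blast
        then show "w $ i = (k \<circ> ?inv) w * (f (?r i) \<circ> ?inv) w" using k(2) x by simp
      qed
    qed
    then show ?thesis using k unfolding unit_fun_def by blast
  qed
  define k1 where "k1 i = (SOME k. unit_fun E ?V k \<and> (\<forall>y\<in>?V. tcoord C y $ i = k y * f (?r i) y))" for i
  have k1': "unit_fun E ?V (k1 i) \<and> (\<forall>y\<in>?V. tcoord C y $ i = k1 i y * f (?r i) y)" if "i \<in> ?I1" for i
    unfolding k1_def by (rule someI_ex[OF ex1[OF that]])
  have k1: "unit_fun E ?V (k1 i)" "y \<in> ?V \<Longrightarrow> tcoord C y $ i = k1 i y * f (?r i) y" if "i \<in> ?I1" for i y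
    using k1'[OF that] by simp_all
  \<comment> \<open>An unmatched ray's hypersurface meets \<open>Uc\<close> but not the chart. There
    1 vanishes on the empty set, hence is a multiple of the local equation.\<close>
  have ex2: "\<exists>k. unit_fun E ?V k \<and> (\<forall>y\<in>?V. 1 = k y * f \<nu> y)" if n: "\<nu> \<in> ?I - ?r ` ?I1" for \<nu>
  proof -
    have nI: "\<nu> \<in> ?I" "\<nu> \<in> rays S" using n by auto
    have "y \<notin> H \<nu>" if "y \<in> ?V" for y using H[OF that nI(2)] n by blast
    then obtain k where k: "holo_fun E ?V k" "\<forall>y\<in>?V. 1 = k y * f \<nu> y"
      using le(3)[OF nI(1), of "\<lambda>_. 1"] oV by (auto simp: holo_fun_iff holo_at_const)
    have "\<forall>y\<in>?V. k y \<noteq> 0"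
    proof (intro ballI notI)
      fix y assume "y \<in> ?V" "k y = 0"
      then show False using bspec[OF k(2), of y] by simp
    qed
    then show ?thesis using k unfolding unit_fun_def by blast
  qed
  define k2 where "k2 \<nu> = (SOME k. unit_fun E ?V k \<and> (\<forall>y\<in>?V. 1 = k y * f \<nu> y))" for \<nu>
  have k2': "unit_fun E ?V (k2 \<nu>) \<and> (\<forall>y\<in>?V. 1 = k2 \<nu> y * f \<nu> y)" if "\<nu> \<in> ?I - ?r ` ?I1" for \<nu>
    unfolding k2_def by (rule someI_ex[OF ex2[OF that]])
  have k2: "unit_fun E ?V (k2 \<nu>)" "y \<in> ?V \<Longrightarrow> 1 = k2 \<nu> y * f \<nu> y" if "\<nu> \<in> ?I - ?r ` ?I1" for \<nu> y
    using k2'[OF that] by simp_all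
  \<comment> \<open>An unmatched coordinate has no zeros on \<open>?V\<close>: it does not belong to
    the cone, or the hypersurface of its ray misses \<open>Uc\<close>.\<close>
  have k3: "unit_fun E ?V (\<lambda>y. tcoord C y $ i)" if i: "i \<notin> ?I1" for i
  proof -
    have "tcoord C y $ i \<noteq> 0" if y: "y \<in> ?V" for y
    proof (cases "i \<in> J")
      case False
      have "y \<in> affine_piece S (lcone B J)" using y by (simp add: tU_def)
      from affine_piece_tpt(2)[OF F c this] show ?thesis using False by blast
    next
      case True
      have ri: "?r i \<in> rays S" by (rule rays_lcone[OF F c True])
      then have "H (?r i) \<inter> Uc = {}" using i True by blast
      then have "y \<notin> H (?r i)" using y by blast
      then show ?thesis using H[OF y ri] True by blast
    qed
    then show ?thesis using coordV unfolding unit_fun_def by blast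
  qed
  define k where "k y = (\<Prod>i\<in>?I1. k1 i y) * (\<Prod>i\<in>-?I1. tcoord C y $ i) * (\<Prod>\<nu>\<in>?I - ?r ` ?I1. k2 \<nu> y)" for y
  have "unit_fun E ?V k"
    unfolding k_def[abs_def] by (intro unit_fun_mult unit_fun_prod oV k1(1) k2(1) k3) auto
  moreover have "(\<Prod>i\<in>UNIV. tcoord C y $ i) = k y * G y" if y: "y \<in> ?V" for y
  proof -
    have sub: "?r ` ?I1 \<subseteq> ?I" by blast
    have "(\<Prod>i\<in>UNIV. tcoord C y $ i) = (\<Prod>i\<in>?I1. tcoord C y $ i) * (\<Prod>i\<in>-?I1. tcoord C y $ i)"
      by (subst prod.union_disjoint[symmetric]) (auto intro: prod.cong)
    also have "(\<Prod>i\<in>?I1. tcoord C y $ i) = (\<Prod>i\<in>?I1. k1 i y * f (?r i) y)" using k1(2) y by (intro prod.cong) auto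
    also have "\<dots> = (\<Prod>i\<in>?I1. k1 i y) * (\<Prod>\<nu>\<in>?r ` ?I1. f \<nu> y)"
      by (simp only: prod.distrib prod.reindex[OF rinj] o_def)
    finally have 1: "(\<Prod>i\<in>UNIV. tcoord C y $ i) =
      (\<Prod>i\<in>?I1. k1 i y) * (\<Prod>\<nu>\<in>?r ` ?I1. f \<nu> y) * (\<Prod>i\<in>-?I1. tcoord C y $ i)" .
    have "(\<Prod>\<nu>\<in>?I - ?r ` ?I1. k2 \<nu> y) * (\<Prod>\<nu>\<in>?I - ?r ` ?I1. f \<nu> y) = (\<Prod>\<nu>\<in>?I - ?r ` ?I1. k2 \<nu> y * f \<nu> y)"
      by (simp only: prod.distrib)
    also have "\<dots> = (\<Prod>\<nu>\<in>?I - ?r ` ?I1. 1)" by (rule prod.cong[OF refl]) (rule k2(2)[OF _ y, symmetric])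
    finally have 2: "(\<Prod>\<nu>\<in>?I - ?r ` ?I1. k2 \<nu> y) * (\<Prod>\<nu>\<in>?I - ?r ` ?I1. f \<nu> y) = 1" by simp
    have 3: "G y = (\<Prod>\<nu>\<in>?I - ?r ` ?I1. f \<nu> y) * (\<Prod>\<nu>\<in>?r ` ?I1. f \<nu> y)"
      unfolding f(1) by (rule prod.subset_diff[OF sub f(4)])
    have "k y * G y = (\<Prod>i\<in>?I1. k1 i y) * (\<Prod>i\<in>-?I1. tcoord C y $ i) * (\<Prod>\<nu>\<in>?r ` ?I1. f \<nu> y) *
      ((\<Prod>\<nu>\<in>?I - ?r ` ?I1. k2 \<nu> y) * (\<Prod>\<nu>\<in>?I - ?r ` ?I1. f \<nu> y))"
      unfolding k_def 3 by (simp only: mult_ac)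
    then show ?thesis unfolding 1 2 by (simp only: mult_ac mult_1_right mult_1_left)
  qed
  ultimately show ?thesis using f(2,3) by blast
qed

end

context tcover
begin

subsection \<open>The canonical bundle and the toric divisor\<close>

text \<open>Pulled down along a local section, \<open>logjac\<close> and \<open>f / h\<close> have
  the same divisor. The relation is written as a product so that it makes sense at the zeros of
  \<open>h\<close>.\<close>

lemma coeff_local:
  assumes D: "cartier_divisor X D" and deq: "divisor_eq E (divisor_pullback E q D) (cover_divisor S E)"
    and U: "(U, \<phi>) \<in> charts X" and s: "qsec U1 s" and d: "(U2, f, h) \<in> D" and x: "x \<in> U" "x \<in> U1" "x \<in> U2"
  shows "\<exists>N u. openin (mtop X) N \<and> x \<in> N \<and> N \<subseteq> U \<inter> U1 \<inter> U2 \<and> unit_fun X N u \<and>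
    (\<forall>z\<in>N. u z * f z = logjac \<phi> (s z) * h z)"
proof -
  let ?y = "s x"
  have y: "?y \<in> Om" "q ?y = x" using qsecD(2,3)[OF s x(2)] by simp_all
  have cd: "cartier_divisor E (cover_divisor S E)" using deq by (simp add: divisor_eq_def)
  then have "carrier E = (\<Union>(U, f, h)\<in>cover_divisor S E. U)" by (simp add: cartier_divisor_def)
  then obtain Uc G h1 where c: "(Uc, G, h1) \<in> cover_divisor S E" "?y \<in> Uc" using y(1) unfolding carrierE by auto
  obtain B C J where t: "tchart S B C J" "?y \<in> tU B J" by (rule tU_cover[OF y(1)])
  obtain k where h1: "h1 = (\<lambda>_. 1)" and oc: "openin (mtop E) Uc" and k: "unit_fun E (Uc \<inter> tU B J) k"
    "\<forall>y\<in>Uc \<inter> tU B J. (\<Prod>i\<in>UNIV. tcoord C y $ i) = k y * G y"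
    using cover_divisor_local[OF c(1) t(1)] by blast
  let ?Q2 = "{y\<in>Om. q y \<in> U2}" and ?Q = "{y\<in>Om. q y \<in> U}"
  have "({x\<in>carrier E. q x \<in> U2}, f \<circ> q, h \<circ> q) \<in> divisor_pullback E q D"
    unfolding divisor_pullback_def using d by (rule rev_image_eqI) simp
  then have "\<exists>r. ratio_unit E (?Q2, f \<circ> q, h \<circ> q) (Uc, G, h1) r"
    using deq c(1) unfolding divisor_eq_def carrierE by blast
  then obtain r where r: "unit_fun E (?Q2 \<inter> Uc) r" "\<forall>y\<in>?Q2 \<inter> Uc. f (q y) = r y * (G y * h (q y))"
    unfolding ratio_unit_iff h1 by auto
  let ?e = "\<lambda>y. of_int (det C) * cjac (tU B J) (tcoord C) q \<phi> y"
  have e: "unit_fun E (tU B J \<inter> ?Q) ?e" by (rule logjac_unit[OF t(1) U])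
  \<comment> \<open>Three comparisons multiplied: \<open>logjac\<close> is \<open>?e\<close> times
    the product of coordinates, that product is \<open>k\<close> times \<open>G\<close>, and
    \<open>f\<close> is \<open>r\<close> times \<open>G\<close> times \<open>h\<close>.\<close>
  let ?V = "?Q2 \<inter> Uc \<inter> (tU B J \<inter> ?Q)" and ?u = "\<lambda>y. ?e y * k y * inverse (r y)"
  have oV: "openin (mtop E) ?V"
    by (intro openin_Int q_preimage[OF cartier_divisorD(3)[OF D d]] oc atlasD(2)[OF atlasE chartE[OF t(1)]] q_chart_preimage[OF U])
  have u: "unit_fun E ?V ?u"
  proof -
    have "unit_fun E ?V ?e" by (rule unit_fun_subset[OF e oV]) (rule Int_lower2)
    moreover have "unit_fun E ?V k" by (rule unit_fun_subset[OF k(1) oV]) (rule subsetI, simp)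
    moreover have "unit_fun E ?V r" by (rule unit_fun_subset[OF r(1) oV]) (rule subsetI, simp)
    ultimately show ?thesis by (intro unit_fun_mult[OF unit_fun_mult] unit_fun_inverse[OF atlasE])
  qed
  have eq: "?u y * f (q y) = logjac \<phi> y * h (q y)" if y: "y \<in> ?V" for y
  proof -
    have r0: "r y \<noteq> 0" using r(1) y unfolding unit_fun_def by blast
    have "f (q y) = r y * (G y * h (q y))" using r(2) y by blast
    then have "?u y * f (q y) = ?e y * (k y * G y) * h (q y)" using r0 by (simp add: field_simps)
    also have "k y * G y = (\<Prod>i\<in>UNIV. tcoord C y $ i)" using bspec[OF k(2), of y] y by simp
    also have "?e y * (\<Prod>i\<in>UNIV. tcoord C y $ i) = logjac \<phi> y"
      using logjac_chart[OF t(1) _ U, of y] y by (simp add: mult_ac)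
    finally show ?thesis .
  qed
  obtain N V' U' g where N: "openin (mtop X) N" "x \<in> N" "N \<subseteq> U1" "N \<subseteq> U'" "lbih E X V' U' q g"
    "\<forall>z\<in>N. s z \<in> V' \<and> s z = g z" using qsec_local[OF s x(2)] by blast
  let ?N = "N \<inter> {z\<in>U1. s z \<in> ?V}"
  have "openin (mtop X) {z\<in>U1. s z \<in> ?V}" using qsecD(4)[OF s] oV unfolding cont_on_open_def by blast
  then have oN: "openin (mtop X) ?N" by (rule openin_Int[OF N(1)])
  have qs: "q (s z) = z" "z \<in> U2" "z \<in> U" if "z \<in> ?N" for z using qsecD(2)[OF s, of z] that by auto
  have "?y \<in> ?V" using y x c(2) t(2) by simp
  then have xN: "x \<in> ?N" using N(2) x(2) by blast
  have "unit_fun X ?N (\<lambda>z. ?u (s z))"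
    unfolding unit_fun_def holo_fun_iff
  proof (intro conjI ballI oN)
    fix z assume z: "z \<in> ?N"
    have sV: "s z \<in> ?V" using z by blast
    have hu: "holo_at E ?u (s z)" and nz: "?u (s z) \<noteq> 0" using u sV unfolding unit_fun_def holo_fun_iff by blast+
    show "?u (s z) \<noteq> 0" by (rule nz)
    have zN: "z \<in> N" "z \<in> U'" using z N(4) by blast+
    have "holo_at E ?u (g z)" using hu N(6) zN(1) by simp
    from lbih_holo_at[OF X atlasE lbih_sym[OF N(5)] zN(2) this]
    show "holo_at X (\<lambda>z. ?u (s z)) z"
      by (rule holo_at_cong[OF X _ N(1) zN(1)]) (simp add: N(6))
  qed
  moreover have "?u (s z) * f z = logjac \<phi> (s z) * h z" if z: "z \<in> ?N" for z
    using eq[of "s z"] qs(1)[OF z] z by simp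
  moreover have "?N \<subseteq> U \<inter> U1 \<inter> U2" using qs(2,3) by blast
  ultimately show ?thesis using oN xN by blast
qed

text \<open>The coefficients of the isomorphism are \<open>logjac\<close> along a section,
  multiplied by \<open>h / f\<close>. Changing the chart produces the canonical cocycle, changing
  the section a power of \<open>det A\<close>, and changing the local equation the cocycle of the
  divisor.\<close>

lemma canonical_iso:
  assumes D: "cartier_divisor X D" and deq: "divisor_eq E (divisor_pullback E q D) (cover_divisor S E)"
  shows "lb_iso X (lb_tensor (canonical_bundle X) Lflat) (divisor_bundle X (divisor_uminus D))"
proof -
  let ?K = "canonical_bundle X" let ?L = "lb_tensor ?K Lflat" let ?M = "divisor_bundle X (divisor_uminus D)"
  note D' = cartier_divisor_uminus[OF D]
  \<comment> \<open>The third argument is an index for the negative divisor, hence the swapped order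
    of \<open>h\<close> and \<open>f\<close>.\<close>
  define coeff where "coeff = (\<lambda>((U :: 'b set, \<phi>), (U1 :: 'b set, s)) (U2 :: 'b set, h :: 'b \<Rightarrow> complex, f).
    SOME u. unit_fun X (U \<inter> U1 \<inter> U2) u \<and> (\<forall>z\<in>U \<inter> U1 \<inter> U2. u z * f z = logjac \<phi> (s z) * h z))"
  have coeff: "unit_fun X (U \<inter> U1 \<inter> U2) (coeff ((U, \<phi>), (U1, s)) (U2, h, f)) \<and>
      (\<forall>z\<in>U \<inter> U1 \<inter> U2. coeff ((U, \<phi>), (U1, s)) (U2, h, f) z * f z = logjac \<phi> (s z) * h z)"
    if U: "(U, \<phi>) \<in> charts X" and s: "qsec U1 s" and d: "(U2, f, h) \<in> D" for U \<phi> U1 s U2 f h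
  proof -
    have o: "openin (mtop X) (U \<inter> U1 \<inter> U2)"
      by (intro openin_Int atlasD(2)[OF X U] qsecD(1)[OF s] cartier_divisorD(3)[OF D d])
    have f: "regular_fun X (U \<inter> U1 \<inter> U2) f" by (rule regular_fun_subset[OF cartier_divisorD(1)[OF D d] o]) blast
    have "\<exists>u. unit_fun X (U \<inter> U1 \<inter> U2) u \<and> (\<forall>z\<in>U \<inter> U1 \<inter> U2. u z * f z = logjac \<phi> (s z) * h z)"
    proof (rule unit_fun_glue[OF X f, where w="\<lambda>z. logjac \<phi> (s z) * h z"])
      fix x assume "x \<in> U \<inter> U1 \<inter> U2"
      then have x: "x \<in> U" "x \<in> U1" "x \<in> U2" by auto
      show "\<exists>N u. openin (mtop X) N \<and> x \<in> N \<and> N \<subseteq> U \<inter> U1 \<inter> U2 \<and> unit_fun X N u \<and>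
          (\<forall>z\<in>N. u z * f z = logjac \<phi> (s z) * h z)"
        by (rule coeff_local[OF D deq U s d x])
    qed
    then show ?thesis unfolding coeff_def prod.case by (rule someI_ex)
  qed
  have idx: "lb_index ?L = charts X \<times> {(U, s). qsec U s}"
    by (simp add: lb_tensor_def canonical_bundle_def Lflat_simps)
  have opn: "lb_open ?L ((U, \<phi>), (U1, s)) = U \<inter> U1" for U \<phi> U1 s
    by (simp add: lb_tensor_def canonical_bundle_def Lflat_simps)
  have trn: "lb_trans ?L ((U, \<phi>), (U1, s)) ((U', \<phi>'), (U1', s')) x = cjac U \<phi> (\<lambda>x. x) \<phi>' x * detA powi shift s s' x"
    for U \<phi> U1 s U' \<phi>' U1' s' x
    by (simp add: lb_tensor_def canonical_bundle_trans Lflat_simps)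
  have idx': "lb_index ?M = divisor_uminus D" "lb_open ?M = fst" by (simp_all add: divisor_bundle_def)
  have indexE: "\<exists>U \<phi> U1 s. i = ((U, \<phi>), (U1, s)) \<and> (U, \<phi>) \<in> charts X \<and> qsec U1 s" if "i \<in> lb_index ?L" for i
    using that unfolding idx by auto
  have divE: "\<exists>U f h. a = (U, h, f) \<and> (U, f, h) \<in> D \<and> (U, h, f) \<in> divisor_uminus D" if a: "a \<in> divisor_uminus D" for a
  proof -
    obtain t where t: "t \<in> D" "a = (case t of (U, f, h) \<Rightarrow> (U, h, f))" using a unfolding divisor_uminus_def by blast
    obtain U f h where "t = (U, f, h)" by (cases t)
    then show ?thesis using t a by simp
  qed
  show ?thesis
    unfolding lb_iso_def
  proof (intro conjI exI[of _ coeff] ballI)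
    show "holo_line_bundle X ?L"
      by (rule holo_line_bundle_tensor[OF holo_line_bundle_canonical[OF X] holo_line_bundle_flat])
    show "holo_line_bundle X ?M" by (rule holo_line_bundle_divisor[OF X D'])
    fix i a assume i0: "i \<in> lb_index ?L" and a0: "a \<in> lb_index ?M"
    obtain U \<phi> U1 s where i: "i = ((U, \<phi>), (U1, s))" "(U, \<phi>) \<in> charts X" "qsec U1 s" using indexE[OF i0] by blast
    obtain U2 f h where a: "a = (U2, h, f)" "(U2, f, h) \<in> D" "(U2, h, f) \<in> divisor_uminus D" using divE a0 unfolding idx' by blast
    note ca = coeff[OF i(2,3) a(2)]
    show "unit_fun X (lb_open ?L i \<inter> lb_open ?M a) (coeff i a)"
      unfolding i(1) a(1) opn idx' fst_conv using ca by blast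
  next
    fix i j a b x
    assume i0: "i \<in> lb_index ?L" and j0: "j \<in> lb_index ?L" and a0: "a \<in> lb_index ?M" and b0: "b \<in> lb_index ?M"
      and x: "x \<in> lb_open ?L i \<inter> lb_open ?L j \<inter> lb_open ?M a \<inter> lb_open ?M b"
    obtain U \<phi> U1 s where i: "i = ((U, \<phi>), (U1, s))" "(U, \<phi>) \<in> charts X" "qsec U1 s" using indexE[OF i0] by blast
    obtain U' \<phi>' U1' s' where j: "j = ((U', \<phi>'), (U1', s'))" "(U', \<phi>') \<in> charts X" "qsec U1' s'" using indexE[OF j0] by blast
    obtain U2 f h where a: "a = (U2, h, f)" "(U2, f, h) \<in> D" "(U2, h, f) \<in> divisor_uminus D" using divE a0 unfolding idx' by blast
    obtain U2' f' h' where b: "b = (U2', h', f')" "(U2', f', h') \<in> D" "(U2', h', f') \<in> divisor_uminus D" using divE b0 unfolding idx' by blast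
    let ?W = "U \<inter> U1 \<inter> U2 \<inter> (U' \<inter> U1' \<inter> U2')"
    have W: "openin (mtop X) ?W"
      by (intro openin_Int atlasD(2)[OF X i(2)] qsecD(1)[OF i(3)] cartier_divisorD(3)[OF D a(2)]
        atlasD(2)[OF X j(2)] qsecD(1)[OF j(3)] cartier_divisorD(3)[OF D b(2)])
    note ci = coeff[OF i(2,3) a(2)] and cj = coeff[OF j(2,3) b(2)]
    have tM: "ratio_unit X (U2, h, f) (U2', h', f') (lb_trans ?M a b)"
      using divisor_bundle_trans[OF D' a(3) b(3)] a(1) b(1) by simp
    have hc: "holo_fun X ?W (coeff i a)" "holo_fun X ?W (coeff j b)" "holo_fun X ?W (lb_trans ?M a b)"
    proof -
      have h: "holo_fun X (U \<inter> U1 \<inter> U2) (coeff i a)" "holo_fun X (U' \<inter> U1' \<inter> U2') (coeff j b)"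
        "holo_fun X (U2 \<inter> U2') (lb_trans ?M a b)"
        using ci cj tM unfolding i(1) j(1) a(1) b(1) ratio_unit_iff unit_fun_def by blast+
      show "holo_fun X ?W (coeff i a)" by (rule holo_fun_subset[OF h(1) W]) blast
      show "holo_fun X ?W (coeff j b)" by (rule holo_fun_subset[OF h(2) W]) blast
      show "holo_fun X ?W (lb_trans ?M a b)" by (rule holo_fun_subset[OF h(3) W]) blast
    qed
    have hL: "holo_fun X ?W (lb_trans ?L i j)"
    proof -
      have "unit_fun X (lb_open ?L i \<inter> lb_open ?L j) (lb_trans ?L i j)"
        by (rule holo_line_bundleD(2)[OF holo_line_bundle_tensor[OF holo_line_bundle_canonical[OF X] holo_line_bundle_flat] i0 j0])
      then have "holo_fun X (U \<inter> U1 \<inter> (U' \<inter> U1')) (lb_trans ?L i j)" unfolding unit_fun_def i(1) j(1) opn by blast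
      then show ?thesis by (rule holo_fun_subset[OF _ W]) blast
    qed
    \<comment> \<open>The defining relations of the two coefficients contain the factors
      \<open>f\<close> and \<open>f'\<close>, so the identity is proved after multiplication by
      both.\<close>
    have reg: "regular_fun X ?W (\<lambda>x. f x * f' x)"
    proof -
      have "regular_fun X ?W f" by (rule regular_fun_subset[OF cartier_divisorD(1)[OF D a(2)] W]) blast
      moreover have "regular_fun X ?W f'" by (rule regular_fun_subset[OF cartier_divisorD(1)[OF D b(2)] W]) blast
      ultimately show ?thesis by (rule regular_fun_mult[OF X])
    qed
    show "coeff i a x * lb_trans ?L i j x = lb_trans ?M a b x * coeff j b x"
    proof (rule regular_fun_cancel[OF X reg, where a="\<lambda>x. coeff i a x * lb_trans ?L i j x" and b="\<lambda>x. lb_trans ?M a b x * coeff j b x"])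
      show "holo_fun X ?W (\<lambda>x. coeff i a x * lb_trans ?L i j x)" "holo_fun X ?W (\<lambda>x. lb_trans ?M a b x * coeff j b x)"
        using hc hL unfolding holo_fun_iff by (simp_all add: holo_at_mult)
      show "x \<in> ?W" using x unfolding i(1) j(1) a(1) b(1) opn idx' by simp
      fix z assume z: "z \<in> ?W"
      then have zz: "z \<in> U" "z \<in> U1" "z \<in> U'" "z \<in> U1'" by auto
      have e1: "coeff i a z * f z = logjac \<phi> (s z) * h z" using ci z unfolding i(1) a(1) by blast
      have e2: "coeff j b z * f' z = logjac \<phi>' (s' z) * h' z" using cj z unfolding j(1) b(1) by blast
      have e3: "h z * f' z = lb_trans ?M a b z * (h' z * f z)" using tM z unfolding ratio_unit_iff by blast
      have sO: "s z \<in> Om" "s' z \<in> Om" "q (s z) = z" "q (s' z) = z"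
        using qsecD(2,3)[OF i(3) zz(2)] qsecD(2,3)[OF j(3) zz(4)] by simp_all
      let ?k = "shift s s' z"
      have sh: "s z = it ?k (s' z)" by (rule shift[OF i(3) j(3) zz(2,4)])
      \<comment> \<open>Here the flat factor arises: the sections differ by an iterate of the
        generator, which scales \<open>logjac\<close> by a power of \<open>det A\<close>.\<close>
      have l1: "logjac \<phi> (s' z) = detA powi ?k * logjac \<phi> (s z)"
        using logjac_it[OF sO(2) i(2), of ?k] sO(4) zz(1) sh by simp
      have l2: "logjac \<phi>' (s' z) = cjac U \<phi> (\<lambda>x. x) \<phi>' z * logjac \<phi> (s' z)"
        using logjac_trans[OF sO(2) i(2) _ j(2)] sO(4) zz by simp
      have tr: "lb_trans ?L i j z = cjac U \<phi> (\<lambda>x. x) \<phi>' z * detA powi ?k" unfolding i(1) j(1) trn ..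
      have "coeff i a z * lb_trans ?L i j z * (f z * f' z) = (coeff i a z * f z) * lb_trans ?L i j z * f' z"
        by (simp only: mult_ac)
      also have "\<dots> = logjac \<phi>' (s' z) * (h z * f' z)" unfolding e1 tr l2 l1 by (simp only: mult_ac)
      also have "\<dots> = lb_trans ?M a b z * (coeff j b z * f' z) * f z" unfolding e2 e3 by (simp only: mult_ac)
      finally show "coeff i a z * lb_trans ?L i j z * (f z * f' z) = lb_trans ?M a b z * coeff j b z * (f z * f' z)"
        by (simp only: mult_ac)
    qed
  qed
qed

subsection \<open>Pluricanonical sections\<close>

lemma connectedE: "connected_space (mtop E)"
proof (rule path_connected_imp_connected_space)
  show "path_connected_space (mtop E)"
    using uc by (simp add: universal_cover_with_generator_def simply_connected_space_def)
qed

text \<open>The set where the maximum is attained is open, by the local maximum principle in a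
  chart; its complement is open by continuity; and the cover is path connected, being simply
  connected.\<close>

lemma max_modulus_E:
  assumes g: "holo_fun E Om g" and y0: "y0 \<in> Om" "\<And>y. y \<in> Om \<Longrightarrow> norm (g y) \<le> norm (g y0)" and y: "y \<in> Om"
  shows "norm (g y) = norm (g y0)"
proof -
  let ?A = "{y\<in>Om. norm (g y) = norm (g y0)}" let ?B = "{y\<in>Om. g y \<in> {c. norm c < norm (g y0)}}"
  have "open {c :: complex. norm c < norm (g y0)}" by (intro open_Collect_less continuous_intros)
  then have B: "openin (mtop E) ?B" by (rule holo_fun_preimage[OF atlasE g])
  have A: "openin (mtop E) ?A"
  proof (subst openin_subopen, intro ballI)
    fix y assume y: "y \<in> ?A"
    then have "y \<in> carrier E" by (simp add: carrierE)
    then obtain W \<psi> where W: "(W, \<psi>) \<in> charts E" "y \<in> W" by (rule atlas_chart[OF atlasE])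
    have WO: "W \<subseteq> Om" using openin_subset[OF atlasD(2)[OF atlasE W(1)]] by (simp add: carrierE)
    have i: "inj_on \<psi> W" by (rule atlasD(4)[OF atlasE W(1)])
    have "\<psi> y \<in> \<psi> ` W" using W(2) by blast
    then obtain r where r: "r > 0" "ball (\<psi> y) r \<subseteq> \<psi> ` W" using atlasD(3)[OF atlasE W(1)] open_contains_ball by blast
    let ?f = "g \<circ> inv_into W \<psi>" let ?T = "{x\<in>W. \<psi> x \<in> ball (\<psi> y) r}"
    have f: "?f (\<psi> x) = g x" if "x \<in> W" for x using that i by simp
    have bx: "\<exists>x\<in>W. w = \<psi> x" if "w \<in> ball (\<psi> y) r" for w using that r(2) by blast
    have const: "?f w = ?f (\<psi> y)" if w: "w \<in> ball (\<psi> y) r" for w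
    proof (rule cdiff_max_modulus[OF _ _ w])
      fix w' assume w': "w' \<in> ball (\<psi> y) r"
      obtain x where x: "x \<in> W" "w' = \<psi> x" using bx[OF w'] by blast
      have "holo_at E g x" using g x(1) WO unfolding holo_fun_iff by blast
      from holo_atD[OF this W(1) x(1)] show "cdiff ?f w'" unfolding x(2) .
      show "norm (?f w') \<le> norm (?f (\<psi> y))"
        unfolding x(2) f[OF x(1)] f[OF W(2)] using y0(2)[of x] x(1) WO y by auto
    qed
    have "\<psi> ` ?T = ball (\<psi> y) r" using r(2) by blast
    then have "openin (mtop E) ?T" using atlasD(5)[OF atlasE W(1), of ?T] by auto
    moreover have "y \<in> ?T" using W(2) r(1) by simp
    moreover have "?T \<subseteq> ?A"
    proof
      fix x assume x: "x \<in> ?T"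
      then have "g x = g y" using const[of "\<psi> x"] f[of x] f[OF W(2)] by simp
      then show "x \<in> ?A" using x y WO by auto
    qed
    ultimately show "\<exists>T. openin (mtop E) T \<and> y \<in> T \<and> T \<subseteq> ?A" by blast
  qed
  have "?B = {}"
  proof (rule ccontr)
    assume "?B \<noteq> {}"
    moreover have "?A \<noteq> {}" using y0(1) by blast
    moreover have "?A \<inter> ?B = {}" by auto
    moreover have "carrier E \<subseteq> ?A \<union> ?B" unfolding carrierE using y0(2) by (auto simp: order_less_le)
    ultimately show False using connectedE A B unfolding connected_space_def by blast
  qed
  then have "\<not> norm (g y) < norm (g y0)" using y by blast
  then show ?thesis using y0(2)[OF y] by simp
qed

text \<open>The modulus is constant on fibres, since the deck group is transitive on them. It
  descends to a continuous function on the compact space \<open>X\<close>.\<close>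

lemma invariant_attains_max:
  assumes c: "compact_space (mtop X)" and ne: "carrier X \<noteq> {}" and g: "holo_fun E Om g"
    and inv: "\<And>y k. y \<in> Om \<Longrightarrow> norm (g (it k y)) = norm (g y)"
  shows "\<exists>y0\<in>Om. \<forall>y\<in>Om. norm (g y) \<le> norm (g y0)"
proof -
  define G where "G x = norm (g (SOME y. y \<in> Om \<and> q y = x))" for x
  have G: "G (q y) = norm (g y)" if y: "y \<in> Om" for y
  proof -
    let ?z = "SOME z. z \<in> Om \<and> q z = q y"
    have z: "?z \<in> Om \<and> q ?z = q y" by (rule someI[of _ y]) (simp add: y)
    then obtain k where "?z = it k y" using it_transitive[OF y, of ?z] by auto
    then show ?thesis using inv[OF y, of k] by (simp add: G_def)
  qed
  have "continuous_map (mtop X) euclideanreal G"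
    unfolding continuous_map
  proof (intro conjI allI impI)
    fix T :: "real set" assume "openin euclideanreal T"
    then have T: "open T" by simp
    have oT: "open {c :: complex. norm c \<in> T}" 
    proof -
      have "open ((norm :: complex \<Rightarrow> real) -` T)" by (rule open_vimage[OF T]) (intro continuous_intros)
      then show ?thesis by (simp add: vimage_def)
    qed
    have P: "openin (mtop E) {y\<in>Om. g y \<in> {c. norm c \<in> T}}" by (rule holo_fun_preimage[OF atlasE g oT])
    show "openin (mtop X) {x \<in> carrier X. G x \<in> T}"
    proof (subst openin_subopen, clarify)
      fix x assume x: "x \<in> carrier X" "G x \<in> T"
      obtain y where y: "y \<in> Om" "q y = x" using q_surj[OF x(1)] by blast
      obtain V U h where V: "y \<in> V" "lbih E X V U q h" using q_local[OF y(1)] by blast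
      let ?V = "V \<inter> {y\<in>Om. g y \<in> {c. norm c \<in> T}}"
      have "openin (mtop E) ?V" by (rule openin_Int[OF lbih_cont(1)[OF V(2)] P])
      then have "openin (mtop X) (q ` ?V)" by (rule lbih_open_image[OF V(2)]) blast
      moreover have "y \<in> ?V" using V(1) y x(2) G[OF y(1)] by simp
      moreover have "q ` ?V \<subseteq> {x \<in> carrier X. G x \<in> T}" using q_carrier G by auto
      ultimately show "\<exists>T'. openin (mtop X) T' \<and> x \<in> T' \<and> T' \<subseteq> {x \<in> carrier X. G x \<in> T}"
        using y(2) by (intro exI[of _ "q ` ?V"]) blast
    qed
  qed simp
  then have "compactin euclideanreal (G ` carrier X)"
    using c image_compactin unfolding compact_space_def by blast
  then have "compact (G ` carrier X)" by simp
  then obtain m where "m \<in> G ` carrier X" "\<forall>t\<in>G ` carrier X. t \<le> m" using compact_attains_sup[of "G ` carrier X"] ne by auto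
  then obtain x0 where x0: "x0 \<in> carrier X" "\<forall>x\<in>carrier X. G x \<le> G x0" by auto
  obtain y0 where y0: "y0 \<in> Om" "q y0 = x0" using q_surj[OF x0(1)] by blast
  have "norm (g y) \<le> norm (g y0)" if y: "y \<in> Om" for y
    using x0(2) q_carrier[OF y] G[OF y] G[OF y0(1)] y0(2) by fastforce
  then show ?thesis using y0(1) by blast
qed

lemma logjac_nonzero:
  assumes y: "y \<in> T0" and U: "(U, \<phi>) \<in> charts X" "q y \<in> U" shows "logjac \<phi> y \<noteq> 0"
proof -
  have "cjac T0 tc q \<phi> y \<noteq> 0" by (rule q_cjac_nonzero[OF _ chart0 y U]) (use y T0_sub in blast)
  moreover have "(\<Prod>i\<in>UNIV. tc y $ i) \<noteq> 0" using T0E(1)[OF y] by (simp add: torus_def)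
  ultimately show ?thesis using y by (simp add: logjac_def)
qed

lemma pluricanonical_section_zero:
  assumes c: "compact_space (mtop X)" and ne: "carrier X \<noteq> {}" and y1: "y1 \<in> Om" "y1 \<notin> T0" and m: "m \<ge> 1"
    and s: "lb_section X (lb_power (canonical_bundle X) m) s" and U: "(U, \<phi>) \<in> charts X" "x \<in> U"
  shows "s (U, \<phi>) x = 0"
proof -
  let ?L = "lb_power (canonical_bundle X) m"
  have sh: "holo_fun X U (s (U, \<phi>))" if "(U, \<phi>) \<in> charts X" for U \<phi>
    using s that unfolding lb_section_def by (auto simp: lb_power_def canonical_bundle_def)
  have st: "s (U, \<phi>) x = cjac U \<phi> (\<lambda>x. x) \<phi>' x ^ m * s (U', \<phi>') x"
    if "(U, \<phi>) \<in> charts X" "(U', \<phi>') \<in> charts X" "x \<in> U" "x \<in> U'" for U \<phi> U' \<phi>' x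
  proof -
    have idx: "lb_index ?L = charts X" "lb_open ?L = fst"
      "lb_trans ?L i j x = lb_trans (canonical_bundle X) i j x ^ m" for i j x
      by (simp_all add: lb_power_def canonical_bundle_def)
    have H: "\<forall>i\<in>lb_index ?L. \<forall>j\<in>lb_index ?L. \<forall>x\<in>lb_open ?L i \<inter> lb_open ?L j. s i x = lb_trans ?L i j x * s j x"
      using s unfolding lb_section_def by (elim conjE)
    have "(U, \<phi>) \<in> lb_index ?L" "(U', \<phi>') \<in> lb_index ?L" "x \<in> lb_open ?L (U, \<phi>) \<inter> lb_open ?L (U', \<phi>')"
      using that by (simp_all add: idx(1,2))
    from bspec[OF bspec[OF bspec[OF H this(1)] this(2)] this(3)]
    have "s (U, \<phi>) x = lb_trans ?L (U, \<phi>) (U', \<phi>') x * s (U', \<phi>') x" .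
    then show ?thesis unfolding idx canonical_bundle_trans .
  qed
  \<comment> \<open>The section divided by the m-th power of the logarithmic form. The choice of
    chart is immaterial: the section and the power of \<open>logjac\<close> change by inverse
    factors.\<close>
  define g where "g y = (let i = (SOME i. i \<in> charts X \<and> q y \<in> fst i) in s i (q y) * logjac (snd i) y ^ m)" for y
  have g: "g y = s (U, \<phi>) (q y) * logjac \<phi> y ^ m" if y: "y \<in> Om" and U: "(U, \<phi>) \<in> charts X" "q y \<in> U" for y U \<phi>
  proof -
    let ?i = "SOME i. i \<in> charts X \<and> q y \<in> fst i"
    have i: "?i \<in> charts X \<and> q y \<in> fst ?i" by (rule someI[of _ "(U, \<phi>)"]) (use U in simp)
    obtain U' \<phi>' where i': "?i = (U', \<phi>')" by (cases ?i)
    then have U': "(U', \<phi>') \<in> charts X" "q y \<in> U'" using i by auto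
    have "g y = s (U', \<phi>') (q y) * logjac \<phi>' y ^ m" by (simp add: g_def i' Let_def)
    also have "\<dots> = s (U, \<phi>) (q y) * logjac \<phi> y ^ m"
      unfolding st[OF U(1) U'(1) U(2) U'(2)] logjac_trans[OF y U U'] by (simp add: power_mult_distrib mult_ac)
    finally show ?thesis .
  qed
  have gh: "holo_fun E Om g"
    unfolding holo_fun_iff
  proof (intro conjI ballI openE)
    fix y assume y: "y \<in> Om"
    obtain U \<phi> where U: "(U, \<phi>) \<in> charts X" "q y \<in> U" by (rule atlas_chart[OF X q_carrier[OF y]])
    obtain V U' h where V: "y \<in> V" "lbih E X V U' q h" using q_local[OF y] by blast
    have "holo_at X (s (U, \<phi>)) (q y)" using sh[OF U(1)] U(2) unfolding holo_fun_iff by blast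
    then have 1: "holo_at E (\<lambda>y. s (U, \<phi>) (q y)) y" by (rule lbih_holo_at[OF atlasE X V(2,1)])
    have "holo_at E (logjac \<phi>) y" using logjac_holo[OF U(1)] y U(2) unfolding holo_fun_iff by blast
    then have "holo_at E (\<lambda>y. s (U, \<phi>) (q y) * logjac \<phi> y ^ m) y" by (intro holo_at_mult[OF 1] holo_at_power)
    then show "holo_at E g y"
      by (rule holo_at_cong[OF atlasE _ q_chart_preimage[OF U(1)]]) (use y U g in auto)
  qed
  have inv: "norm (g (it k y)) = norm (g y)" if y: "y \<in> Om" for y k
  proof -
    obtain U \<phi> where U: "(U, \<phi>) \<in> charts X" "q y \<in> U" by (rule atlas_chart[OF X q_carrier[OF y]])
    have "norm detA = 1" using detA by auto
    then have "norm (logjac \<phi> y) = norm (logjac \<phi> (it k y))"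
      unfolding logjac_it[OF y U, of k] by (simp add: norm_mult norm_power_int)
    then show ?thesis
      using g[OF y U] g[OF it_in[OF y] U(1), of k] U(2) q_it[OF y, of k] by (simp add: norm_mult norm_power)
  qed
  obtain y0 where y0: "y0 \<in> Om" "\<And>y. y \<in> Om \<Longrightarrow> norm (g y) \<le> norm (g y0)"
    using invariant_attains_max[OF c ne gh inv] by blast
  \<comment> \<open>Off the torus \<open>logjac\<close> is 0, and the exponent \<open>m\<close> is
    positive. This zero forces the maximum to be 0.\<close>
  have "g y1 = 0"
  proof -
    obtain U \<phi> where U: "(U, \<phi>) \<in> charts X" "q y1 \<in> U" by (rule atlas_chart[OF X q_carrier[OF y1(1)]])
    show ?thesis unfolding g[OF y1(1) U] using y1(2) m by (simp add: logjac_def)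
  qed
  then have "norm (g y0) = 0" using max_modulus_E[OF gh y0 y1(1)] by simp
  then have g0: "g y = 0" if "y \<in> Om" for y using max_modulus_E[OF gh y0 that] by simp
  have "x \<in> carrier X" using openin_subset[OF atlasD(2)[OF X U(1)]] U(2) by blast
  then obtain y where y: "y \<in> Om" "q y = x" using q_surj by blast
  let ?V = "{y\<in>Om. q y \<in> U}"
  have "s (U, \<phi>) (q y) = 0"
  proof (rule holo_eq_T0[where U="?V" and f="\<lambda>y. s (U, \<phi>) (q y)" and g="\<lambda>_. 0"])
    show "holo_fun E ?V (\<lambda>y. s (U, \<phi>) (q y))"
      unfolding holo_fun_iff
    proof (intro conjI ballI q_chart_preimage[OF U(1)])
      fix z assume z: "z \<in> ?V"
      then have zO: "z \<in> Om" by blast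
      obtain V U' h where V: "z \<in> V" "lbih E X V U' q h" using q_local[OF zO] by blast
      have "holo_at X (s (U, \<phi>)) (q z)" using sh[OF U(1)] z unfolding holo_fun_iff by blast
      then show "holo_at E (\<lambda>y. s (U, \<phi>) (q y)) z" by (rule lbih_holo_at[OF atlasE X V(2,1)])
    qed
    show "holo_fun E ?V (\<lambda>_. 0)" unfolding holo_fun_iff using q_chart_preimage[OF U(1)] by (simp add: holo_at_const)
    show "y \<in> ?V" using y U(2) by simp
    fix z assume z: "z \<in> ?V" "z \<in> T0"
    have "g z = s (U, \<phi>) (q z) * logjac \<phi> z ^ m" using g[of z U \<phi>] z U(1) by simp
    moreover have "logjac \<phi> z \<noteq> 0" using logjac_nonzero[OF z(2) U(1)] z by blast
    ultimately show "s (U, \<phi>) (q z) = 0" using g0[of z] z by simp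
  qed
  then show ?thesis using y by simp
qed

lemma kodaira_negative:
  assumes c: "compact_space (mtop X)" and ne: "carrier X \<noteq> {}" and y1: "y1 \<in> Om" "y1 \<notin> T0"
  shows "kodaira_dimension X < 0"
proof -
  have "plurigenus X m = 0" if m: "m \<ge> 1" for m
  proof -
    let ?L = "lb_power (canonical_bundle X) m"
    have idx: "lb_index ?L = charts X" "lb_open ?L = fst" by (simp_all add: lb_power_def canonical_bundle_def)
    define P where "P r \<longleftrightarrow> (\<exists>s. (\<forall>k<r. lb_section X ?L (s k)) \<and>
     (\<forall>c. (\<forall>i\<in>lb_index ?L. \<forall>x\<in>lb_open ?L i. (\<Sum>k<r. c k * s k i x) = 0) \<longrightarrow> (\<forall>k<r. c k = 0)))" for r :: nat
    have z: "r = 0" if P: "P r" for r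
    proof (rule ccontr)
      assume r: "r \<noteq> 0"
      obtain s where s: "\<forall>k<r. lb_section X ?L (s k)"
        "\<forall>c. (\<forall>i\<in>lb_index ?L. \<forall>x\<in>lb_open ?L i. (\<Sum>k<r. c k * s k i x) = 0) \<longrightarrow> (\<forall>k<r. c k = (0::complex))" using P unfolding P_def by blast
      \<comment> \<open>All sections vanish, so even the coefficients 1 give a relation; no nonempty
        family is independent.\<close>
      have "(\<Sum>k<r. 1 * s k i x) = 0" if "i \<in> lb_index ?L" "x \<in> lb_open ?L i" for i x
      proof (rule sum.neutral, intro ballI)
        fix k assume "k \<in> {..<r}"
        then have "lb_section X ?L (s k)" using s(1) by simp
        moreover obtain U \<phi> where "i = (U, \<phi>)" by (cases i)
        ultimately show "1 * s k i x = 0"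
          using pluricanonical_section_zero[OF c ne y1 m, of "s k" U \<phi> x] that by (simp add: idx)
      qed
      then have "\<forall>k<r. (1::complex) = 0" using spec[OF s(2), of "\<lambda>_. 1"] by blast
      moreover have "0 < r" using r by simp
      ultimately have "(1::complex) = 0" by blast
      then show False by simp
    qed
    have "Sup {enat r | r. P r} \<le> 0"
    proof (rule Sup_least)
      fix e assume "e \<in> {enat r | r. P r}"
      then obtain r where "e = enat r" "P r" by blast
      with z[OF this(2)] show "e \<le> 0" by (simp add: zero_enat_def)
    qed
    then show ?thesis unfolding P_def plurigenus_def lb_h0_def by simp
  qed
  then show ?thesis by (simp add: kodaira_dimension_def)
qed

end

subsection \<open>The universal cover is not contained in the torus\<close>

definition rot :: "complex^'n \<Rightarrow> complex^'n \<Rightarrow> complex^'n" where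
  "rot u z = (\<chi> k. u $ k * z $ k)"

lemma rot_rot:
  assumes "\<And>k. norm (u $ k) = 1"
  shows "rot (\<chi> k. inverse (u $ k)) (rot u z) = z" "rot u (rot (\<chi> k. inverse (u $ k)) z) = z"
proof -
  have "u $ k \<noteq> 0" for k using assms[of k] by auto
  then show "rot (\<chi> k. inverse (u $ k)) (rot u z) = z" "rot u (rot (\<chi> k. inverse (u $ k)) z) = z"
    by (simp_all add: rot_def vec_eq_iff)
qed

lemma rot_torus:
  assumes "\<And>k. norm (u $ k) = 1" "z \<in> torus" shows "rot u z \<in> torus"
proof -
  have "u $ k \<noteq> 0" for k using assms(1)[of k] by auto
  then show ?thesis using assms(2) by (simp add: torus_def rot_def)
qed

lemma norm_rot:
  assumes "\<And>k. norm (u $ k) = 1" shows "norm (rot u z) = norm z"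
  unfolding norm_vec_def by (simp add: rot_def norm_mult assms)

lemma continuous_rot: "continuous_on UNIV (rot u)"
  unfolding rot_def by (intro continuous_on_vec_lambda continuous_intros)

text \<open>Up to the constant \<open>lam\<close> a monomial map is a homomorphism, and it carries
  vectors with entries of modulus 1 to such vectors.\<close>

lemma monomial_map_rot:
  assumes "\<And>k. norm (u $ k) = 1"
  shows "\<exists>u'. (\<forall>k. norm (u' $ k) = 1) \<and> (monomial_map lam A ^^ m) (rot u z) = rot u' ((monomial_map lam A ^^ m) z)"
proof (induction m)
  case 0
  then show ?case using assms by (intro exI[of _ u]) simp
next
  case (Suc m)
  then obtain u' where u': "\<And>k. norm (u' $ k) = 1"
    "(monomial_map lam A ^^ m) (rot u z) = rot u' ((monomial_map lam A ^^ m) z)" by blast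
  let ?v = "\<chi> j. \<Prod>k\<in>UNIV. u' $ k powi A $ j $ k"
  have "monomial_map lam A (rot u' w) = rot ?v (monomial_map lam A w)" for w
    by (simp add: vec_eq_iff monomial_map_def rot_def power_int_mult_distrib prod.distrib mult_ac)
  moreover have "norm (?v $ j) = 1" for j
    by (simp add: prod_norm[symmetric] norm_power_int u'(1))
  ultimately show ?case using u'(2) by (intro exI[of _ ?v]) simp
qed

text \<open>The iterates of a rotated point are rotations of the iterates, so the norms that define
  the basin are unchanged.\<close>

lemma torus_basin_rot:
  assumes u: "\<And>k. norm (u $ k) = 1" and z: "z \<in> torus_basin lam A"
  shows "rot u z \<in> torus_basin lam A"
proof -
  have "norm ((monomial_map lam A ^^ m) (rot u z)) = norm ((monomial_map lam A ^^ m) z)" for m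
  proof -
    obtain u' where "\<And>k. norm (u' $ k) = 1"
      "(monomial_map lam A ^^ m) (rot u z) = rot u' ((monomial_map lam A ^^ m) z)"
      using monomial_map_rot[OF u, where m=m and z=z and lam=lam and A=A] by blast
    then show ?thesis using norm_rot by metis
  qed
  then show ?thesis using z rot_torus[OF u] by (simp add: torus_basin_def)
qed

context tcover
begin

lemma chart0Y: "(orb {0}, tc) \<in> charts (toric_variety S)"
proof -
  have "affine_piece S (lcone (mat 1) {}) = orb {0}"
    using affine_piece_lcone[OF F tchart0] by (auto simp: lcone_empty[OF mutual_inverse_mat1])
  then show ?thesis using tchart0 unfolding toric_variety_def toric_charts_iff by force
qed

lemma tc_orb0: assumes "y \<in> orb {0}" shows "torus_emb (tc y) = y" "tc y \<in> torus"
  using assms tc_emb unfolding orb_0 by auto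

lemma open_rot:
  assumes u: "\<And>k. norm (u $ k) = 1" and V: "openin (mtop (toric_variety S)) V" "V \<subseteq> orb {0}"
  shows "openin (mtop (toric_variety S)) (torus_emb ` rot u ` tc ` V)"
proof -
  note Y = toric_atlas(1)[OF F]
  have o: "open (tc ` V)" using atlasD(5)[OF Y chart0Y V(2)] V(1) by simp
  have "rot u ` tc ` V = rot (\<chi> k. inverse (u $ k)) -` (tc ` V)"
  proof
    show "rot u ` tc ` V \<subseteq> rot (\<chi> k. inverse (u $ k)) -` (tc ` V)"
      by (rule image_subsetI) (simp add: rot_rot(1)[OF u])
    show "rot (\<chi> k. inverse (u $ k)) -` (tc ` V) \<subseteq> rot u ` tc ` V"
    proof
      fix w assume "w \<in> rot (\<chi> k. inverse (u $ k)) -` (tc ` V)"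
      then have "rot (\<chi> k. inverse (u $ k)) w \<in> tc ` V" by simp
      from imageI[OF this, of "rot u"] show "w \<in> rot u ` tc ` V" by (simp add: rot_rot(2)[OF u])
    qed
  qed
  then have o': "open (rot u ` tc ` V)" using open_vimage[OF o continuous_rot] by simp
  have "torus_emb ` rot u ` tc ` V \<subseteq> orb {0}"
    unfolding orb_0
  proof (intro image_mono image_subsetI)
    fix z assume "z \<in> tc ` V"
    then obtain y where y: "y \<in> V" "z = tc y" by blast
    have "tc y \<in> torus" by (rule tc_orb0(2)) (use y(1) V(2) in blast)
    then show "rot u z \<in> torus" unfolding y(2) by (rule rot_torus[OF u])
  qed
  moreover have "tc ` torus_emb ` rot u ` tc ` V = rot u ` tc ` V" by (simp add: image_image tc_emb)
  ultimately show ?thesis using atlasD(5)[OF Y chart0Y] o' by simp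
qed

text \<open>The rotated \<open>Om\<close> is open and contained in the closure of the basin, hence
  in the interior of that closure. Rotations are defined here through torus coordinates, which is
  why \<open>Om\<close> is assumed to lie in the torus.\<close>

lemma Om_rot:
  assumes Omd: "Om = mtop (toric_variety S) interior_of (mtop (toric_variety S) closure_of (torus_emb ` torus_basin lam A))"
    and sub: "Om \<subseteq> orb {0}" and u: "\<And>k. norm (u $ k) = 1" and y: "y \<in> Om"
  shows "torus_emb (rot u (tc y)) \<in> Om"
proof -
  let ?Y = "mtop (toric_variety S)" let ?cl = "?Y closure_of (torus_emb ` torus_basin lam A)"
  let ?V = "torus_emb ` rot u ` tc ` Om" and ?u = "\<chi> k. inverse (u $ k)"
  have u': "norm (?u $ k) = 1" for k using u by (simp add: norm_inverse)
  have oV: "openin ?Y ?V" by (rule open_rot[OF u Om sub])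
  have "?V \<subseteq> ?cl"
  proof
    fix v' assume "v' \<in> ?V"
    then obtain v where v: "v \<in> Om" "v' = torus_emb (rot u (tc v))" by blast
    have "v \<in> ?cl" using v(1) dens by blast
    show "v' \<in> ?cl"
      unfolding in_closure_of
    proof (intro conjI allI impI)
      show "v' \<in> topspace ?Y" using openin_subset[OF oV] \<open>v' \<in> ?V\<close> by blast
      fix T assume T: "v' \<in> T \<and> openin ?Y T"
      \<comment> \<open>A neighbourhood must be rotated back to meet the basin near
        \<open>v\<close>, and only its part in the torus can be rotated.\<close>
      let ?T = "T \<inter> orb {0}"
      have "openin ?Y ?T" using T atlasD(2)[OF toric_atlas(1)[OF F] chart0Y] by (simp add: openin_Int)
      then have oT: "openin ?Y (torus_emb ` rot ?u ` tc ` ?T)" by (rule open_rot[OF u']) simp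
      have vo: "v \<in> orb {0}" using v(1) sub by blast
      have "v' \<in> orb {0}" unfolding v(2) orb_0 by (rule imageI) (rule rot_torus[OF u tc_orb0(2)[OF vo]])
      then have "v' \<in> ?T" using T by simp
      moreover have "torus_emb (rot ?u (tc v')) = v"
        unfolding v(2) tc_emb rot_rot(1)[OF u] by (rule tc_orb0(1)[OF vo])
      ultimately have vT: "v \<in> torus_emb ` rot ?u ` tc ` ?T" unfolding image_image by (intro image_eqI[of v _ v']) simp_all
      have "\<forall>T. v \<in> T \<and> openin ?Y T \<longrightarrow> (\<exists>y. y \<in> torus_emb ` torus_basin lam A \<and> y \<in> T)"
        using \<open>v \<in> ?cl\<close> unfolding in_closure_of by (rule conjunct2)
      from mp[OF spec[OF this] conjI[OF vT oT]]
      obtain w where w: "w \<in> torus_emb ` torus_basin lam A" "w \<in> torus_emb ` rot ?u ` tc ` ?T" by (elim exE conjE)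
      obtain b where b: "b \<in> torus_basin lam A" "w = torus_emb b" using w(1) by blast
      obtain x where x: "x \<in> ?T" "w = torus_emb (rot ?u (tc x))" using w(2) unfolding image_image by (elim imageE)
      have "tc (torus_emb b) = tc (torus_emb (rot ?u (tc x)))" using b(2) x(2) by simp
      then have "b = rot ?u (tc x)" unfolding tc_emb .
      then have "rot u b = tc x" using rot_rot(2)[OF u] by simp
      then have "torus_emb (rot u b) = x" using tc_orb0(1) x(1) by simp
      moreover have "rot u b \<in> torus_basin lam A" by (rule torus_basin_rot[OF u b(1)])
      ultimately show "\<exists>y. y \<in> torus_emb ` torus_basin lam A \<and> y \<in> T" using x(1) by blast
    qed
  qed
  then have "?V \<subseteq> Om" unfolding Omd using interior_of_maximal[OF _ oV[unfolded Omd]] by blast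
  then show ?thesis using y by blast
qed

text \<open>Otherwise a rotation of one coordinate would be a loop in \<open>E\<close> with winding number one.\<close>

lemma Om_not_torus:
  assumes Omd: "Om = mtop (toric_variety S) interior_of (mtop (toric_variety S) closure_of (torus_emb ` torus_basin lam A))"
    and ne: "Om \<noteq> {}"
  shows "\<exists>y\<in>Om. y \<notin> T0"
proof (rule ccontr)
  assume "\<not> ?thesis"
  then have OT: "Om \<subseteq> T0" by blast
  then have sub: "Om \<subseteq> orb {0}" by (auto simp: T0_def)
  obtain y0 where y0: "y0 \<in> Om" using ne by blast
  fix k0 :: 'n
  define e where "e \<theta> = exp (2 * of_real pi * \<i> * of_real \<theta>)" for \<theta> :: real
  \<comment> \<open>Only the coordinate \<open>k0\<close> is rotated; as the parameter runs through
    the unit interval it makes one full turn.\<close>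
  define u where "u \<theta> = (\<chi> k. if k = k0 then e \<theta> else 1)" for \<theta>
  let ?t = "tc y0"
  define p where "p \<theta> = torus_emb (rot (u \<theta>) ?t)" for \<theta>
  have un: "norm (u \<theta> $ k) = 1" for \<theta> k by (simp add: u_def e_def)
  have pO: "p \<theta> \<in> Om" for \<theta> unfolding p_def by (rule Om_rot[OF Omd sub un y0])
  have a0: "?t $ k0 \<noteq> 0" using T0E(1)[of y0] OT y0 by (auto simp: torus_def)
  have crot: "continuous_on UNIV (\<lambda>\<theta>. rot (u \<theta>) ?t)"
    unfolding rot_def u_def
  proof (intro continuous_on_vec_lambda)
    fix k show "continuous_on UNIV (\<lambda>\<theta>. (\<chi> k. if k = k0 then e \<theta> else 1) $ k * ?t $ k)"
      by (cases "k = k0") (auto simp: e_def intro!: continuous_intros)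
  qed
  have p: "continuous_map (top_of_set {0..1}) (mtop E) p"
    unfolding continuous_map
  proof (intro conjI allI impI)
    show "p ` topspace (top_of_set {0..1}) \<subseteq> carrier E" using pO by (auto simp: carrierE)
    fix W assume W: "openin (mtop E) W"
    then have WT: "W \<subseteq> T0" using OT by (auto simp: openinE)
    then have "open (tc ` W)" using atlasD(5)[OF atlasE chart0, of W] W by blast
    then have o: "open ((\<lambda>\<theta>. rot (u \<theta>) ?t) -` (tc ` W))" by (rule open_vimage[OF _ crot])
    have "p \<theta> \<in> W \<longleftrightarrow> rot (u \<theta>) ?t \<in> tc ` W" for \<theta>
    proof
      assume "p \<theta> \<in> W"
      then show "rot (u \<theta>) ?t \<in> tc ` W" using tc_emb[of "rot (u \<theta>) ?t"] unfolding p_def by (metis image_eqI)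
    next
      assume "rot (u \<theta>) ?t \<in> tc ` W"
      then obtain w where w: "w \<in> W" "rot (u \<theta>) ?t = tc w" by blast
      then have "p \<theta> = w" unfolding p_def using T0E(2)[of w] WT by auto
      then show "p \<theta> \<in> W" using w by simp
    qed
    then have "{x \<in> topspace (top_of_set {0..1}). p x \<in> W} = {0..1} \<inter> (\<lambda>\<theta>. rot (u \<theta>) ?t) -` (tc ` W)" by auto
    then show "openin (top_of_set {0..1}) {x \<in> topspace (top_of_set {0..1}). p x \<in> W}"
      using openin_open_Int[OF o] by simp
  qed
  have e01: "e 0 = 1" "e 1 = 1" by (simp_all add: e_def)
  have "u 0 = u 1" unfolding u_def e01 ..
  then have p01: "p 0 = p 1" by (simp add: p_def)
  have sc: "simply_connected_space (mtop E)" using uc by (simp add: universal_cover_with_generator_def)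
  have hom: "homotopic_with (\<lambda>h. h 0 = p 0 \<and> h 1 = p 0) (top_of_set {0..1}) (mtop E) p (\<lambda>_. p 0)"
    using sc p p01 unfolding simply_connected_space_def by blast
  \<comment> \<open>Dividing by the coordinate of the base point makes the image of the loop the
    standard unit circle.\<close>
  let ?f = "\<lambda>y. tc y $ k0 / ?t $ k0"
  have f: "continuous_map (mtop E) (top_of_set (- {0})) ?f"
    unfolding continuous_map
  proof (intro conjI allI impI)
    show "?f ` carrier E \<subseteq> topspace (top_of_set (- {0}))"
      using T0E(1) OT a0 by (auto simp: carrierE torus_def)
    fix W :: "complex set" assume W: "openin (top_of_set (- {0})) W"
    have "open (- {0::complex})" by (simp add: open_Compl)
    then have oW: "open W" using W by (simp add: openin_open_eq)
    have "holo_fun E Om (\<lambda>y. tc y $ k0 * (1 / ?t $ k0))"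
      unfolding holo_fun_iff
    proof (intro conjI ballI openE)
      fix y assume "y \<in> Om"
      then have "y \<in> tU (mat 1) {}" using OT tU0 by blast
      then show "holo_at E (\<lambda>y. tc y $ k0 * (1 / ?t $ k0)) y"
        by (intro holo_at_mult holo_at_const tcoord_holo[OF tchart0])
    qed
    from holo_fun_preimage[OF atlasE this oW]
    show "openin (mtop E) {x \<in> carrier E. ?f x \<in> W}" by (simp add: carrierE)
  qed
  have fp: "?f (p \<theta>) = e \<theta>" for \<theta>
    using a0 by (simp add: p_def tc_emb rot_def u_def)
  have "homotopic_with (\<lambda>h. h 0 = 1 \<and> h 1 = 1) (top_of_set {0..1}) (top_of_set (- {0})) (?f \<circ> p) (?f \<circ> (\<lambda>_. p 0))"
    by (rule homotopic_with_compose_continuous_map_left[OF hom f]) (use fp e01 in auto)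
  moreover have "?f \<circ> p = circlepath 0 1" by (simp only: fun_eq_iff o_apply fp) (simp add: circlepath e_def)
  moreover have "?f \<circ> (\<lambda>_. p 0) = (\<lambda>_::real. 1)" by (simp only: fun_eq_iff o_apply fp e01 simp_thms)
  ultimately have "homotopic_with (\<lambda>h. h 0 = 1 \<and> h 1 = 1) (top_of_set {0..1}) (top_of_set (- {0})) (circlepath 0 1) (\<lambda>_. 1)"
    by (simp only:)
  moreover have "circlepath 0 1 0 = (1::complex)" "circlepath 0 1 1 = (1::complex)"
    by (simp_all add: circlepath)
  ultimately have "homotopic_paths (- {0}) (circlepath 0 1) (\<lambda>_. 1)"
    unfolding homotopic_paths_def pathstart_def pathfinish_def by (simp only:)
  then have "winding_number (circlepath 0 1) 0 = winding_number (\<lambda>_. 1) 0"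
    by (rule winding_number_homotopic_paths)
  moreover have "winding_number (circlepath 0 1) 0 = 1" by (rule winding_number_circlepath_centre) simp
  moreover have "winding_number (\<lambda>_. 1) 0 = 0" by (rule winding_number_zero_const) simp
  ultimately show False by simp
qed

end

theorem proposition5p7:
  fixes \<Sigma> :: "(real^'n) set set"
    and \<pi> :: "'n tpoint \<Rightarrow> complex^'n"
    and \<sigma> :: "complex^'n \<Rightarrow> 'n tpoint"
    and lam :: "complex^'n" and A :: "int^'n^'n" and \<epsilon> :: real
    and \<Sigma>\<^sub>A :: "(real^'n) set set"
    and X :: "('n tpoint set, 'n) cmanifold" and E :: "('n tpoint, 'n) cmanifold"
    and q :: "'n tpoint \<Rightarrow> 'n tpoint set" and \<gamma> :: "'n tpoint \<Rightarrow> 'n tpoint"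
    and D :: "'n tpoint set divisor"
  assumes "CARD('n) \<ge> 2"
    and "toric_kato_data \<Sigma> \<pi> \<sigma>"
    and "collar_width \<pi> \<sigma> \<epsilon>"
    and "X = kato_manifold (hat_ball \<Sigma> \<pi>) \<pi> \<sigma> \<epsilon>"
    and "kato_matrix \<pi> \<sigma> lam A"
    and "\<Sigma>\<^sub>A = cover_fan \<Sigma> (fst (\<sigma> 0)) A"
    and "E = kato_cover \<Sigma>\<^sub>A lam A"
    and "extends_to_cover E lam A \<gamma>"
    and "universal_cover_with_generator E X q \<gamma>"
    and "cartier_divisor X D"
    and "divisor_eq E (divisor_pullback E q D) (cover_divisor \<Sigma>\<^sub>A E)"
  shows "lb_iso X (lb_tensor (canonical_bundle X) (flat_bundle E X q \<gamma> (of_int (det A))))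
             (divisor_bundle X (divisor_uminus D))
         \<and> kodaira_dimension X < 0"
proof -
  have "kato_data (hat_ball \<Sigma> \<pi>) \<pi> \<sigma>" using assms(2) by (simp add: toric_kato_data_def)
  then interpret K: kato "hat_ball \<Sigma> \<pi>" \<pi> \<sigma> \<epsilon> using assms(3) by unfold_locales
  have X: "X = K.X" using assms(4) by (simp add: K.X_def)
  have S: "face_closed \<Sigma>" "\<Sigma> \<noteq> {}"
    using assms(2) smooth_fan_face_closed by (auto simp: toric_kato_data_def smooth_fan_def)
  obtain A' where A: "mutual_inverse A A'"
    using assms(5) by (auto simp: kato_matrix_def invertible_def mutual_inverse_def)
  have "columns A = (\<lambda>j. column j A) ` UNIV" by (auto simp: columns_def)
  then have "fst (\<sigma> 0) = lcone A UNIV" using assms(5) by (simp add: kato_matrix_def lcone_def)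
  then have SA: "\<Sigma>\<^sub>A = cover_fan \<Sigma> (lcone A UNIV) A" using assms(6) by simp
  let ?cl = "mtop (toric_variety \<Sigma>\<^sub>A) closure_of (torus_emb ` torus_basin lam A)"
  \<comment> \<open>The locale asks only for openness and density of \<open>Om\<close>; this
    equation is kept for \<open>T.Om_not_torus\<close>.\<close>
  define Om where "Om = mtop (toric_variety \<Sigma>\<^sub>A) interior_of ?cl"
  have "E = open_sub (toric_variety \<Sigma>\<^sub>A) Om" using assms(7) by (simp add: kato_cover_def Let_def Om_def)
  moreover have "face_closed \<Sigma>\<^sub>A" unfolding SA by (rule cover_fan_face_closed[OF S(1) A])
  moreover have "{0} \<in> \<Sigma>\<^sub>A" unfolding SA by (rule zero_in_cover_fan[OF S A])
  moreover have "openin (mtop (toric_variety \<Sigma>\<^sub>A)) Om" unfolding Om_def by (rule openin_interior_of)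
  moreover have "Om \<subseteq> ?cl" unfolding Om_def by (rule interior_of_subset)
  moreover have "lam \<in> torus" using assms(5) by (simp add: kato_matrix_def)
  moreover have "atlas X" unfolding X by (rule K.atlasX)
  ultimately interpret T: tcover "\<Sigma>\<^sub>A" Om lam A A' X q \<gamma> E
    using assms(8,9) A by unfold_locales
  have ne: "carrier X \<noteq> {}" unfolding X by (rule K.X_nonempty)
  then have "Om \<noteq> {}" using T.q_surj by blast
  then obtain y where "y \<in> Om" "y \<notin> T.T0" using T.Om_not_torus[OF Om_def] by blast
  then have "kodaira_dimension X < 0"
    using T.kodaira_negative[OF _ ne] K.compactX by (simp add: X)
  then show ?thesis using T.canonical_iso[OF assms(10,11)] by (simp add: T.detA_def)
qed

end
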